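(* Let $m$ be a prime, let $n=2m>6$, and let $\mathrm{Dye}_n$ be the subgroup of $G_n=\mathrm{Sp}(n,2)$ described in the context. Then $\mathrm{Dye}_n$ is not a strong Gelfand subgroup of $G_n$.
   Context: For even $n$, let $V=\mathbb F_2^n$ carry a non-degenerate symplectic (alternating) form, and let $G_n=\mathrm{Sp}(n,2)=\mathrm{Sp}(V)$ be its isometry group. For $n=2m$ with $m$ prime, $\mathrm{Dye}_n$ denotes the maximal subgroup of $G_n$ (studied by Dye) that is the stabilizer in $G_n$ of a spread, that is, of a set $\{U_i\}_i$ of subspaces of $V$ such that the sets $U_i\setminus\{0\}$ partition $V\setminus\{0\}$; it satisfies $\mathrm{Dye}_n\cong \mathrm{SL}(2,2^m)\rtimes \mathcal C_m$, where $\mathcal C_m$ is the cyclic group of order $m$, so $|\mathrm{Dye}_n|=(2^n-1)2^m m$. For a finite group $G$ and a subgroup $H\le G$, $(G,H)$ is a strong Gelfand pair (and $H$ is a strong Gelfand subgroup of $G$) if $\langle\psi,\chi|_H\rangle\le1$ for every complex irreducible character $\chi$ of $G$ and every complex irreducible character $\psi$ of $H$. *)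

theory Defs
  imports
    "HOL-Algebra.Elementary_Groups"
    "HOL-Algebra.Algebraic_Closure_Type"
    "HOL-Library.Disjoint_Sets"
    "HOL-Library.Z2"
    "Jordan_Normal_Form.Matrix"
    "Jordan_Normal_Form.Determinant"
    "Jordan_Normal_Form.VS_Connect"
    "Jordan_Normal_Form.Conjugate"
begin

section \<open>Complex characters and strong Gelfand pairs\<close>

definition GL :: "'a::field itself \<Rightarrow> nat \<Rightarrow> 'a mat monoid" where
  "GL ty n = units_of (ring_mat ty n ())"

text \<open>A complex representation of \<open>G\<close> of degree \<open>d\<close> is a homomorphism from \<open>G\<close> to the
  matrix group \<open>GL(d, C)\<close>.\<close>

definition irreducible_rep :: "('g, 'b) monoid_scheme \<Rightarrow> nat \<Rightarrow> ('g \<Rightarrow> complex mat) \<Rightarrow> bool" where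
  "irreducible_rep G d \<rho> \<longleftrightarrow>
     0 < d \<and> \<rho> \<in> hom G (GL TYPE(complex) d) \<and>
     (\<forall>W. VectorSpace.subspace class_ring W (module_vec TYPE(complex) d) \<and>
          (\<forall>g\<in>carrier G. \<forall>w\<in>W. \<rho> g *\<^sub>v w \<in> W)
        \<longrightarrow> W = {0\<^sub>v d} \<or> W = carrier_vec d)"

definition mat_trace :: "'a::comm_monoid_add mat \<Rightarrow> 'a" where
  "mat_trace A = (\<Sum>i<dim_row A. A $$ (i, i))"

definition irreducible_characters :: "('g, 'b) monoid_scheme \<Rightarrow> ('g \<Rightarrow> complex) set" where
  "irreducible_characters G =
     {\<lambda>g\<in>carrier G. mat_trace (\<rho> g) | d \<rho>. irreducible_rep G d \<rho>}"

definition char_inner :: "('g, 'b) monoid_scheme \<Rightarrow> ('g \<Rightarrow> complex) \<Rightarrow> ('g \<Rightarrow> complex) \<Rightarrow> complex" where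
  "char_inner G \<phi> \<psi> = (\<Sum>g\<in>carrier G. \<phi> g * cnj (\<psi> g)) / of_nat (Coset.order G)"

text \<open>Only meaningful for a finite group \<open>G\<close> and a subgroup \<open>H\<close> of it. The comparison is the
  one of \<open>HOL-Library.Complex_Order\<close> (equal imaginary parts, ordered real parts); the
  inner products involved are nonnegative integers.\<close>

definition strong_Gelfand_pair :: "('g, 'b) monoid_scheme \<Rightarrow> 'g set \<Rightarrow> bool" where
  "strong_Gelfand_pair G H \<longleftrightarrow>
     (\<forall>\<chi>\<in>irreducible_characters G. \<forall>\<psi>\<in>irreducible_characters (G\<lparr>carrier := H\<rparr>).
        char_inner (G\<lparr>carrier := H\<rparr>) \<psi> (restrict \<chi> H) \<le> 1)"


section \<open>Symplectic groups and spreads\<close>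

definition symplectic_form :: "nat \<Rightarrow> ('a::field vec \<Rightarrow> 'a vec \<Rightarrow> 'a) \<Rightarrow> bool" where
  "symplectic_form n \<omega> \<longleftrightarrow>
     (\<forall>x\<in>carrier_vec n. \<forall>y\<in>carrier_vec n. \<forall>z\<in>carrier_vec n.
        \<omega> (x + y) z = \<omega> x z + \<omega> y z \<and> \<omega> x (y + z) = \<omega> x y + \<omega> x z) \<and>
     (\<forall>c. \<forall>x\<in>carrier_vec n. \<forall>y\<in>carrier_vec n.
        \<omega> (c \<cdot>\<^sub>v x) y = c * \<omega> x y \<and> \<omega> x (c \<cdot>\<^sub>v y) = c * \<omega> x y) \<and>
     (\<forall>x\<in>carrier_vec n. \<omega> x x = 0) \<and>
     (\<forall>x\<in>carrier_vec n. (\<forall>y\<in>carrier_vec n. \<omega> x y = 0) \<longrightarrow> x = 0\<^sub>v n)"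

definition Sp :: "nat \<Rightarrow> ('a::field vec \<Rightarrow> 'a vec \<Rightarrow> 'a) \<Rightarrow> 'a mat monoid" where
  "Sp n \<omega> = (GL TYPE('a) n)\<lparr>carrier :=
     {A \<in> carrier (GL TYPE('a) n).
        \<forall>x\<in>carrier_vec n. \<forall>y\<in>carrier_vec n. \<omega> (A *\<^sub>v x) (A *\<^sub>v y) = \<omega> x y}\<rparr>"

definition spread :: "nat \<Rightarrow> 'a::field vec set set \<Rightarrow> bool" where
  "spread n S \<longleftrightarrow>
     (\<forall>U\<in>S. VectorSpace.subspace class_ring U (module_vec TYPE('a) n)) \<and>
     partition_on (carrier_vec n - {0\<^sub>v n}) ((\<lambda>U. U - {0\<^sub>v n}) ` S)"

definition spread_stabilizer :: "('a::field mat, 'b) monoid_scheme \<Rightarrow> 'a vec set set \<Rightarrow> 'a mat set" where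
  "spread_stabilizer G S = {A \<in> carrier G. (\<lambda>U. (\<lambda>x. A *\<^sub>v x) ` U) ` S = S}"

definition maximal_subgroup :: "'g set \<Rightarrow> ('g, 'b) monoid_scheme \<Rightarrow> bool" where
  "maximal_subgroup H G \<longleftrightarrow>
     subgroup H G \<and> H \<noteq> carrier G \<and>
     (\<forall>K. subgroup K G \<and> H \<subseteq> K \<longrightarrow> K = H \<or> K = carrier G)"


section \<open>The groups \<open>SL(2, 2^m)\<close> and \<open>SL(2, 2^m) \<rtimes> C\<^sub>m\<close>\<close>

text \<open>The field with \<open>2^m\<close> elements, as a subfield of the algebraic closure of \<open>F\<^sub>2\<close>.\<close>

definition GF2 :: "nat \<Rightarrow> bit alg_closure set" where
  "GF2 m = {x. x ^ (2 ^ m) = x}"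

lemma card_GF2:
  assumes "m > 0"
  shows "card (GF2 m) = 2 ^ m"
proof -
  define p :: "bit alg_closure poly" where "p = monom 1 (2 ^ m) - monom 1 1"
  have two: "(2 :: bit alg_closure) = 0"
  proof -
    have "(2 :: bit alg_closure) = to_ac (2 :: bit)" by (simp only: to_ac_numeral)
    also have "(2 :: bit) = 0" by simp
    finally show ?thesis by simp
  qed
  have gt: "(2::nat) ^ m > 1" using assms by (intro one_less_power) auto
  have deg: "degree p = 2 ^ m"
    unfolding p_def using gt
    by (subst diff_conv_add_uminus, subst degree_add_eq_left) (auto simp: degree_monom_eq)
  have lc: "coeff p (2 ^ m) = 1"
    using gt by (simp add: p_def)
  have "p \<noteq> 0" using lc by auto
  from alg_closed_imp_factorization[OF this] obtain A
    where A: "size A = 2 ^ m" "p = (\<Prod>x\<in>#A. [:-x, 1:])"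
    using lc deg by auto
  have root: "poly p x = 0 \<longleftrightarrow> x \<in> GF2 m" for x
    by (simp add: p_def GF2_def poly_monom)
  have roots: "set_mset A = GF2 m"
  proof -
    have "poly p x = 0 \<longleftrightarrow> x \<in># A" for x
      unfolding A(2) by (induction A) auto
    then show ?thesis using root by auto
  qed
  have "(of_nat (2 ^ m) :: bit alg_closure) = 0"
    using assms by (simp add: two zero_power)
  then have der: "pderiv p = - 1"
    by (simp add: p_def pderiv_diff pderiv_monom)
  have "count A x \<le> 1" for x
  proof (rule ccontr)
    assume "\<not> count A x \<le> 1"
    then have "{#x, x#} \<subseteq># A" by (auto simp: subseteq_mset_def)
    then obtain B where "A = {#x, x#} + B" by (metis subset_mset.add_diff_inverse)
    then have "p = [:-x, 1:] * ([:-x, 1:] * (\<Prod>x\<in>#B. [:-x, 1:]))"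
      by (simp add: A(2))
    then have "poly (pderiv p) x = 0"
      by (simp only: pderiv_mult poly_add poly_mult) simp
    then show False by (simp add: der)
  qed
  then have "A = mset_set (set_mset A)"
    by (intro multiset_eqI) (metis count_eq_zero_iff count_mset_set(1,3) finite_set_mset
          le_antisym less_one linorder_le_less_linear)
  then have "size A = card (set_mset A)" by (metis size_mset_set)
  then show ?thesis by (simp add: A(1) roots)
qed

definition SL2 :: "nat \<Rightarrow> bit alg_closure mat monoid" where
  "SL2 m = (GL TYPE(bit alg_closure) 2)\<lparr>carrier :=
     {A \<in> carrier (GL TYPE(bit alg_closure) 2). elements_mat A \<subseteq> GF2 m \<and> det A = 1}\<rparr>"

definition semidirect_product ::
  "('a, 'c) monoid_scheme \<Rightarrow> ('b, 'd) monoid_scheme \<Rightarrow> ('b \<Rightarrow> 'a \<Rightarrow> 'a) \<Rightarrow> ('a \<times> 'b) monoid" where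
  "semidirect_product N Q \<phi> =
     \<lparr>carrier = carrier N \<times> carrier Q,
      monoid.mult = (\<lambda>(a, b) (a', b'). (a \<otimes>\<^bsub>N\<^esub> \<phi> b a', b \<otimes>\<^bsub>Q\<^esub> b')),
      one = (\<one>\<^bsub>N\<^esub>, \<one>\<^bsub>Q\<^esub>)\<rparr>"

text \<open>The carrier of \<open>integer_mod_group m\<close> is \<open>{0..<m}\<close>; \<open>i\<close> acts on matrices through the
  \<open>i\<close>-th power of the Frobenius automorphism \<open>x \<mapsto> x^2\<close>, which has order \<open>m\<close> on
  the field with \<open>2^m\<close> elements.\<close>

definition SL2_ext :: "nat \<Rightarrow> (bit alg_closure mat \<times> int) monoid" where
  "SL2_ext m = semidirect_product (SL2 m) (integer_mod_group m)
     (\<lambda>i. map_mat (\<lambda>x. x ^ (2 ^ nat i)))"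


section \<open>Dye's subgroup\<close>

text \<open>Spread stabilizer and maximality alone do not identify the group: a subspace \<open>U\<close> of
  dimension at least two together with all lines not contained in \<open>U\<close> is a spread too, and
  its stabilizer is the stabilizer of \<open>U\<close>.\<close>

definition Dye_subgroup :: "nat \<Rightarrow> (bit vec \<Rightarrow> bit vec \<Rightarrow> bit) \<Rightarrow> bit mat set \<Rightarrow> bool" where
  "Dye_subgroup m \<omega> H \<longleftrightarrow>
     (\<exists>S. spread (2 * m) S \<and> H = spread_stabilizer (Sp (2 * m) \<omega>) S) \<and>
     maximal_subgroup H (Sp (2 * m) \<omega>) \<and>
     (Sp (2 * m) \<omega>)\<lparr>carrier := H\<rparr> \<cong> SL2_ext m"

end

theory Submission
  imports Defs "HOL-Library.Function_Algebras"
begin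

text \<open>
  A multiplicity-free restriction of an irreducible representation of \<open>Sp(2m, 2)\<close> to Dye's subgroup
  \<open>H\<close> has small degree, but \<open>Sp(2m, 2)\<close> has irreducible representations of large degree.

  Small degree: let \<open>A\<close> be the Sylow 2-subgroup of upper unitriangular matrices in \<open>SL(2, q)\<close>, where
  \<open>q = 2^m\<close>. By the Bruhat decomposition \<open>H = A R A\<close> with \<open>|R| = 2 (q - 1) m\<close>. The elementary abelian
  group \<open>A\<close> has an eigenspace \<open>F\<close> in \<open>V\<close> with \<open>dim V \<le> |A| dim F\<close>. For \<open>v\<close> and \<open>w\<close> in \<open>F\<close>, the vector
  \<open>w\<close> is orthogonal to the \<open>H\<close>-orbit of \<open>v\<close> once it is orthogonal to \<open>R v\<close>. Hence if \<open>dim F > |R|\<close>, no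
  vector of \<open>F\<close> generates an \<open>H\<close>-submodule containing \<open>F\<close>, which forces an irreducible \<open>H\<close>-module to
  occur twice in \<open>V\<close>. So strong Gelfand pairs satisfy \<open>dim V \<le> |A| |R| < 2 m 4^m\<close>.

  Large degree: \<open>Sp(2m, 2)\<close> acts transitively on the \<open>(4^m - 1) 4^m / 2\<close> hyperbolic pairs, and by Witt's
  theorem the stabilizer of one pair has at most 40 orbits. The permutation representation therefore
  has at most 40 irreducible constituents, one of which has degree at least \<open>(4^m - 1) 4^m / 80\<close>. This
  exceeds \<open>2 m 4^m\<close> for \<open>m \<ge> 5\<close>.
\<close>

section \<open>Orthonormal bases of spaces of functions\<close>

text \<open>All modules are invariant subspaces of \<open>Fn D\<close>, the functions on a finite
  set with the standard inner product. Permutation actions are unitary there, so orthogonal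
  complements do the work of Maschke's theorem. Subspaces become matrix representations only in
  \<open>irr_character\<close>, to meet the definition of an irreducible character. That a
  constituent occurs twice must still be expressed by characters. The inner product of two
  characters is the trace of the averaging projection on a space of functions on
  \<open>D \<times> D\<close>, and each pair of intertwiners with orthogonal images yields two
  orthogonal fixed functions there; the lower bound 2 follows without Schur's lemma. The choice of
  hyperbolic pairs comes from the size of the degree bound, of order m 4^m. Functions on the 4^m - 1
  nonzero vectors form too small a space to exceed it, whereas there are about 16^m / 2 hyperbolic
  pairs and the rank of the action stays bounded independently of m.\<close>

definition cscale :: "complex \<Rightarrow> ('x \<Rightarrow> complex) \<Rightarrow> 'x \<Rightarrow> complex" (infixr "*c" 75) where
  "c *c f = (\<lambda>x. c * f x)"

lemma cscale_apply [simp]: "(c *c f) x = c * f x"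
  by (simp add: cscale_def)

global_interpretation cf: vector_space "cscale :: complex \<Rightarrow> ('x \<Rightarrow> complex) \<Rightarrow> 'x \<Rightarrow> complex"
  by unfold_locales (auto simp: fun_eq_iff algebra_simps)

lemma sum_fun_apply: "(\<Sum>i\<in>I. f i) x = (\<Sum>i\<in>I. f i x)"
  by (induction I rule: infinite_finite_induct) auto

text \<open>Requiring zeros outside \<open>D\<close> makes equality of functions the same as
  equality on \<open>D\<close>; for finite \<open>D\<close> this makes \<open>ip D\<close> definite
  on \<open>Fn D\<close>.\<close>

definition Fn :: "'x set \<Rightarrow> ('x \<Rightarrow> complex) set" where
  "Fn D = {f. \<forall>x. x \<notin> D \<longrightarrow> f x = 0}"

definition ip :: "'x set \<Rightarrow> ('x \<Rightarrow> complex) \<Rightarrow> ('x \<Rightarrow> complex) \<Rightarrow> complex" where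
  "ip D f g = (\<Sum>x\<in>D. f x * cnj (g x))"

lemma ip_add_left: "ip D (f + g) h = ip D f h + ip D g h"
  by (simp add: ip_def algebra_simps sum.distrib)

lemma ip_diff_left: "ip D (f - g) h = ip D f h - ip D g h"
  by (simp add: ip_def algebra_simps sum_subtractf)

lemma ip_scale_left: "ip D (c *c f) h = c * ip D f h"
  by (simp add: ip_def sum_distrib_left algebra_simps)

lemma cnj_ip: "cnj (ip D f g) = ip D g f"
  by (simp add: ip_def mult.commute)

lemma ip_add_right: "ip D h (f + g) = ip D h f + ip D h g"
  by (simp add: ip_def algebra_simps sum.distrib)

lemma ip_diff_right: "ip D h (f - g) = ip D h f - ip D h g"
  by (simp add: ip_def algebra_simps sum_subtractf)

lemma ip_scale_right: "ip D h (c *c f) = cnj c * ip D h f"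
  by (simp add: ip_def sum_distrib_left algebra_simps)

lemma ip_zero_left [simp]: "ip D 0 f = 0" and ip_zero_right [simp]: "ip D f 0 = 0"
  by (simp_all add: ip_def)

lemma ip_sum_left: "ip D (\<Sum>i\<in>I. f i) h = (\<Sum>i\<in>I. ip D (f i) h)"
  unfolding ip_def sum_fun_apply sum_distrib_right by (rule sum.swap)

lemma ip_sum_right: "ip D h (\<Sum>i\<in>I. f i) = (\<Sum>i\<in>I. ip D h (f i))"
  unfolding ip_def sum_fun_apply cnj_sum sum_distrib_left by (rule sum.swap)

lemma ip_self: "ip D f f = of_real (\<Sum>x\<in>D. (cmod (f x))\<^sup>2)"
  by (simp add: ip_def complex_norm_square del: of_real_power)

lemma ip_self_nonneg: "0 \<le> Re (ip D f f)" and ip_self_Im [simp]: "Im (ip D f f) = 0"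
  by (auto simp: ip_self sum_nonneg)

lemma sub_Fn: "cf.subspace (Fn D)"
  by (auto simp: cf.subspace_def Fn_def)

definition orthonormal :: "'x set \<Rightarrow> ('x \<Rightarrow> complex) set \<Rightarrow> bool" where
  "orthonormal D B \<longleftrightarrow> B \<subseteq> Fn D \<and> (\<forall>f\<in>B. \<forall>g\<in>B. ip D f g = (if f = g then 1 else 0))"

definition onb :: "'x set \<Rightarrow> ('x \<Rightarrow> complex) set \<Rightarrow> ('x \<Rightarrow> complex) set \<Rightarrow> bool" where
  "onb D B S \<longleftrightarrow> finite B \<and> orthonormal D B \<and> B \<subseteq> S \<and> S \<subseteq> cf.span B"

definition sub :: "'x set \<Rightarrow> ('x \<Rightarrow> complex) set \<Rightarrow> bool" where
  "sub D S \<longleftrightarrow> cf.subspace S \<and> S \<subseteq> Fn D"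

definition perp :: "'x set \<Rightarrow> ('x \<Rightarrow> complex) set \<Rightarrow> ('x \<Rightarrow> complex) set \<Rightarrow> ('x \<Rightarrow> complex) set" where
  "perp D S V = {f \<in> V. \<forall>s\<in>S. ip D f s = 0}"

definition proj :: "'x set \<Rightarrow> ('x \<Rightarrow> complex) set \<Rightarrow> ('x \<Rightarrow> complex) \<Rightarrow> 'x \<Rightarrow> complex" where
  "proj D B f = (\<Sum>b\<in>B. ip D f b *c b)"

lemma sub_zero: "sub D S \<Longrightarrow> 0 \<in> S"
  and sub_add: "sub D S \<Longrightarrow> f \<in> S \<Longrightarrow> g \<in> S \<Longrightarrow> f + g \<in> S"
  and sub_diff: "sub D S \<Longrightarrow> f \<in> S \<Longrightarrow> g \<in> S \<Longrightarrow> f - g \<in> S"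
  and sub_scale: "sub D S \<Longrightarrow> f \<in> S \<Longrightarrow> c *c f \<in> S"
  and sub_sum: "sub D S \<Longrightarrow> (\<And>i. i \<in> I \<Longrightarrow> h i \<in> S) \<Longrightarrow> (\<Sum>i\<in>I. h i) \<in> S"
  by (auto simp: sub_def intro: cf.subspace_0 cf.subspace_add cf.subspace_diff cf.subspace_scale cf.subspace_sum)

lemma sub_Int: "sub D S \<Longrightarrow> sub D T \<Longrightarrow> sub D (S \<inter> T)"
  by (auto simp: sub_def cf.subspace_inter)

lemma sub_perp: "sub D V \<Longrightarrow> sub D (perp D S V)"
  by (auto simp: sub_def perp_def cf.subspace_def ip_add_left ip_scale_left)

lemma sub_span: "B \<subseteq> Fn D \<Longrightarrow> sub D (cf.span B)"
  by (simp add: sub_def cf.span_minimal[OF _ sub_Fn])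

lemma sub_span_subset: "sub D S \<Longrightarrow> B \<subseteq> S \<Longrightarrow> cf.span B \<subseteq> S"
  by (simp add: sub_def cf.span_minimal)

lemma ip_eq_0_span:
  assumes "\<And>b. b \<in> B \<Longrightarrow> ip D f b = 0" and "g \<in> cf.span B"
  shows "ip D f g = 0"
proof -
  have "cf.subspace {g. ip D f g = 0}"
    by (auto simp: cf.subspace_def ip_add_right ip_scale_right)
  then have "cf.span B \<subseteq> {g. ip D f g = 0}" using assms(1) by (intro cf.span_minimal) auto
  then show ?thesis using assms(2) by auto
qed

lemma proj_in_span: "proj D B f \<in> cf.span B"
  unfolding proj_def by (intro cf.span_sum cf.span_scale cf.span_base)

lemma ip_proj:
  assumes "finite B" "orthonormal D B" "b \<in> B"
  shows "ip D (proj D B f) b = ip D f b"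
proof -
  have "ip D (proj D B f) b = (\<Sum>c\<in>B. ip D f c * ip D c b)"
    by (simp add: proj_def ip_sum_left ip_scale_left)
  also have "\<dots> = (\<Sum>c\<in>B. if c = b then ip D f b else 0)"
    using assms by (intro sum.cong) (auto simp: orthonormal_def)
  finally show ?thesis using assms by simp
qed

lemma residual_orth:
  assumes "finite B" "orthonormal D B" "g \<in> cf.span B"
  shows "ip D (f - proj D B f) g = 0"
  by (rule ip_eq_0_span[OF _ assms(3)]) (simp add: ip_diff_left ip_proj assms)

locale fin_supp =
  fixes D :: "'x set"
  assumes finX: "finite D"
begin

lemma ip_self_eq_0:
  assumes "f \<in> Fn D" "ip D f f = 0" shows "f = 0"
proof -
  have "(\<Sum>x\<in>D. (cmod (f x))\<^sup>2) = 0" using assms(2) unfolding ip_self using of_real_eq_0_iff by blast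
  then have "\<forall>x\<in>D. f x = 0" using finX by (subst (asm) sum_nonneg_eq_0_iff) auto
  then show ?thesis using assms(1) by (auto simp: Fn_def fun_eq_iff)
qed

lemma orthonormal_independent:
  assumes "orthonormal D B" shows "cf.independent B"
  unfolding cf.dependent_def
proof
  assume "\<exists>a\<in>B. a \<in> cf.span (B - {a})"
  then obtain a where a: "a \<in> B" "a \<in> cf.span (B - {a})" by blast
  have "ip D a a = 0" by (rule ip_eq_0_span[OF _ a(2)]) (use assms a in \<open>auto simp: orthonormal_def\<close>)
  then show False using assms a by (auto simp: orthonormal_def)
qed

lemma Fn_span: "Fn D \<subseteq> cf.span ((\<lambda>x y. if y = x then 1 else 0) ` D)"
proof
  fix f assume f: "f \<in> Fn D"
  have "f = (\<Sum>x\<in>D. f x *c (\<lambda>y. if y = x then 1 else 0))"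
    using f finX by (auto simp: fun_eq_iff sum_fun_apply Fn_def if_distrib cong: if_cong)
  also have "\<dots> \<in> cf.span ((\<lambda>x y. if y = x then 1 else 0) ` D)"
    by (intro cf.span_sum cf.span_scale cf.span_base) auto
  finally show "f \<in> cf.span ((\<lambda>x y. if y = x then 1 else 0) ` D)" .
qed

lemma independent_bound: 
  assumes "cf.independent B" "B \<subseteq> Fn D" shows "finite B \<and> card B \<le> card D"
proof -
  have "B \<subseteq> cf.span ((\<lambda>x y. if y = x then 1 else 0) ` D)" using assms Fn_span by blast
  from cf.independent_span_bound[OF _ assms(1) this] finX
  show ?thesis using card_image_le[OF finX] by (meson finite_imageI le_trans)
qed

lemma normalize:
  assumes "f \<in> Fn D" "f \<noteq> 0"
  obtains c where "c \<noteq> 0" "ip D (c *c f) (c *c f) = 1"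
proof -
  define n where "n = Re (ip D f f)"
  have n: "ip D f f = of_real n" "n > 0" using assms ip_self_eq_0[of f] ip_self_nonneg[of D f]
    by (auto simp: n_def complex_eq_iff)
  have "ip D (of_real (1 / sqrt n) *c f) (of_real (1 / sqrt n) *c f) = of_real (1 / sqrt n * (1 / sqrt n) * n)"
    by (simp only: ip_scale_left ip_scale_right n complex_cnj_complex_of_real of_real_mult mult.assoc)
  also have "1 / sqrt n * (1 / sqrt n) * n = 1"
    using n real_sqrt_mult_self[of n] by (simp add: field_simps)
  finally have "ip D (of_real (1 / sqrt n) *c f) (of_real (1 / sqrt n) *c f) = 1" by (simp only: of_real_1)
  moreover have "complex_of_real (1 / sqrt n) \<noteq> 0" using n by simp
  ultimately show ?thesis by (rule that[rotated])
qed

text \<open>One Gram-Schmidt step. The new vector is given in closed form because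
  \<open>onb_exists\<close> must see that it stays in the subspace.\<close>

lemma residual_nz_extend:
  assumes "orthonormal D B" "finite B" "f \<in> Fn D" "f \<notin> cf.span B"
  obtains c where "orthonormal D (insert (c *c (f - proj D B f)) B)" "c *c (f - proj D B f) \<notin> B"
proof -
  define r where "r = f - proj D B f"
  have pB: "proj D B f \<in> cf.span B" by (rule proj_in_span)
  have "B \<subseteq> Fn D" using assms(1) by (simp add: orthonormal_def)
  then have "proj D B f \<in> Fn D" using pB sub_span[of B D] unfolding sub_def by blast
  then have rF: "r \<in> Fn D" unfolding r_def by (rule cf.subspace_diff[OF sub_Fn assms(3)])
  have r0: "r \<noteq> 0" using assms(4) pB by (auto simp: r_def)
  have orth: "ip D r b = 0" if "b \<in> B" for b unfolding r_def
    by (rule residual_orth[OF assms(2,1)]) (use that in \<open>simp add: cf.span_base\<close>)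
  have orth': "ip D b r = 0" if "b \<in> B" for b using orth[OF that] cnj_ip[of D r b] by simp
  obtain c where one: "ip D (c *c r) (c *c r) = 1" using normalize[OF rF r0] .
  have nB: "c *c r \<notin> B"
  proof
    assume "c *c r \<in> B"
    then have "ip D (c *c r) (c *c r) = 0" unfolding ip_scale_left[of D c r] by (simp only: orth mult_zero_right)
    then show False using one by simp
  qed
  have "orthonormal D (insert (c *c r) B)"
    unfolding orthonormal_def
  proof (intro conjI ballI)
    show "insert (c *c r) B \<subseteq> Fn D" using cf.subspace_scale[OF sub_Fn rF, of c] \<open>B \<subseteq> Fn D\<close> by (simp only: insert_subset)
    have 0: "ip D (c *c r) b = 0" "ip D b (c *c r) = 0" if "b \<in> B" for b
      by (simp_all only: ip_scale_left ip_scale_right orth[OF that] orth'[OF that] mult_zero_right)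
    fix f g assume fg: "f \<in> insert (c *c r) B" "g \<in> insert (c *c r) B"
    consider "f = c *c r" "g = c *c r" | "f = c *c r" "g \<in> B" | "f \<in> B" "g = c *c r" | "f \<in> B" "g \<in> B"
      using fg unfolding insert_iff by argo
    then show "ip D f g = (if f = g then 1 else 0)"
    proof cases
      case 1 then show ?thesis using one by simp
    next
      case 2
      then have "f \<noteq> g" using nB by metis
      then show ?thesis using 0(1)[of g] 2 by (simp only: if_False)
    next
      case 3
      then have "f \<noteq> g" using nB by metis
      then show ?thesis using 0(2)[of f] 3 by (simp only: if_False)
    next
      case 4 then show ?thesis using assms(1) unfolding orthonormal_def by metis
    qed
  qed
  then show ?thesis using nB unfolding r_def by (rule that)
qed

text \<open>An orthonormal subset of \<open>S\<close> of maximal size spans \<open>S\<close>, since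
  otherwise a Gram-Schmidt step would enlarge it. The maximum exists because orthonormal sets are
  independent, hence of size at most \<open>card D\<close>.\<close>

lemma onb_exists:
  assumes "sub D S" obtains B where "onb D B S"
proof -
  let ?P = "\<lambda>k. \<exists>B. B \<subseteq> S \<and> orthonormal D B \<and> finite B \<and> card B = k"
  have P0: "?P 0" by (rule exI[of _ "{}"]) (simp add: orthonormal_def)
  have bound: "k \<le> card D" if "?P k" for k
  proof -
    obtain B where "orthonormal D B" "card B = k" using \<open>?P k\<close> by metis
    then show ?thesis using independent_bound[OF orthonormal_independent[of B]] by (simp add: orthonormal_def)
  qed
  define k where "k = Greatest ?P"
  have k: "?P k" "\<And>j. ?P j \<Longrightarrow> j \<le> k"
    unfolding k_def using GreatestI_nat[of ?P, OF P0 bound] Greatest_le_nat[of ?P, OF _ bound] by simp_all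
  then obtain B where B: "B \<subseteq> S" "orthonormal D B" "finite B" "card B = k" by blast
  have "S \<subseteq> cf.span B"
  proof (rule ccontr)
    assume "\<not> S \<subseteq> cf.span B"
    then obtain f where f: "f \<in> S" "f \<notin> cf.span B" by blast
    with assms have "f \<in> Fn D" by (auto simp: sub_def)
    from residual_nz_extend[OF B(2,3) this f(2)] obtain c where
      c: "orthonormal D (insert (c *c (f - proj D B f)) B)" "c *c (f - proj D B f) \<notin> B" .
    have "proj D B f \<in> S" using proj_in_span sub_span_subset[OF assms B(1)] by blast
    then have "c *c (f - proj D B f) \<in> S" using f assms by (intro sub_scale sub_diff)
    then have "insert (c *c (f - proj D B f)) B \<subseteq> S" using B(1) by (simp only: insert_subset)
    moreover have "card (insert (c *c (f - proj D B f)) B) = Suc k"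
      using card_insert_disjoint[OF B(3) c(2)] B(4) by (simp only:)
    ultimately have "?P (Suc k)" using c(1) B(3) by (metis finite_insert)
    from k(2)[OF this] show False by simp
  qed
  with B that show ?thesis by (auto simp: onb_def)
qed

lemma proj_eq:
  assumes "onb D B S" "f \<in> S" "S \<subseteq> Fn D" shows "proj D B f = f"
proof -
  have B: "finite B" "orthonormal D B" "f \<in> cf.span B" using assms by (auto simp: onb_def)
  let ?r = "f - proj D B f"
  have rs: "?r \<in> cf.span B" using B(3) proj_in_span[of D B f] by (rule cf.span_diff)
  then have "ip D ?r ?r = 0" using B by (intro residual_orth) auto
  moreover have "?r \<in> Fn D" using rs sub_span[of B D] B(2) by (auto simp: sub_def orthonormal_def)
  ultimately show ?thesis using ip_self_eq_0 by force
qed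

lemma onb_dim: "onb D B S \<Longrightarrow> card B = cf.dim S"
  using cf.basis_card_eq_dim orthonormal_independent by (auto simp: onb_def)

lemma independent_card_le_dim:
  assumes "sub D S" "B \<subseteq> S" "cf.independent B" shows "finite B \<and> card B \<le> cf.dim S"
proof -
  obtain C where C: "onb D C S" using onb_exists[OF assms(1)] .
  then have "finite C" "B \<subseteq> cf.span C" using assms by (auto simp: onb_def)
  from cf.independent_span_bound[OF this(1) assms(3) this(2)] onb_dim[OF C] show ?thesis by simp
qed

lemma dim_psubset:
  assumes "sub D S" "sub D T" "S \<subset> T" shows "cf.dim S < cf.dim T"
proof -
  obtain C where C: "onb D C S" using onb_exists[OF assms(1)] .
  obtain t where t: "t \<in> T" "t \<notin> S" using assms by blast
  have "cf.span C \<subseteq> S" using C assms sub_span_subset by (auto simp: onb_def)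
  then have t': "t \<notin> cf.span C" "t \<notin> C" using t cf.span_base by blast+
  have "cf.independent (insert t C)"
    using C orthonormal_independent t' by (intro cf.independent_insertI) (auto simp: onb_def)
  then have "card (insert t C) \<le> cf.dim T" 
    using C t assms by (intro conjunct2[OF independent_card_le_dim[OF assms(2)]]) (auto simp: onb_def)
  then show ?thesis using C onb_dim[OF C] t' by (auto simp: onb_def)
qed

lemma orth_decomp:
  assumes "sub D S" "sub D V" "S \<subseteq> V" "f \<in> V"
  obtains s t where "f = s + t" "s \<in> S" "t \<in> perp D S V"
proof -
  obtain B where B: "onb D B S" using onb_exists[OF assms(1)] .
  then have p: "proj D B f \<in> S"
    using proj_in_span[of D B f] sub_span_subset[OF assms(1), of B] by (auto simp: onb_def)
  have "f - proj D B f \<in> perp D S V"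
    unfolding perp_def using assms p B sub_diff[OF assms(2)] residual_orth[of B D _ f]
    by (auto simp: onb_def)
  with p that[of "proj D B f" "f - proj D B f"] show ?thesis by auto
qed

lemma perp_Int: "sub D S \<Longrightarrow> f \<in> S \<Longrightarrow> f \<in> perp D S V \<Longrightarrow> f = 0"
  using ip_self_eq_0 by (auto simp: perp_def sub_def)

text \<open>For elements of \<open>F\<close>, pairing with \<open>y\<close> and pairing with the
  projection of \<open>y\<close> to \<open>F\<close> agree. The projections of \<open>Y\<close> span
  at most \<open>card Y\<close> dimensions, so \<open>F\<close> contains a nonzero vector orthogonal
  to all of them.\<close>

lemma exists_orthogonal:
  assumes F: "sub D F" and Y: "finite Y" "Y \<subseteq> Fn D" and less: "card Y < cf.dim F"
  obtains w where "w \<in> F" "w \<noteq> 0" "\<And>y. y \<in> Y \<Longrightarrow> ip D w y = 0"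
proof -
  obtain B where B: "onb D B F" using onb_exists[OF F] .
  define P where "P = cf.span (proj D B ` Y)"
  have BF: "cf.span B \<subseteq> F" using B sub_span_subset[OF F] by (auto simp: onb_def)
  have PF: "P \<subseteq> F" unfolding P_def using proj_in_span BF
    by (intro sub_span_subset[OF F]) blast
  then have P: "sub D P" using F by (auto simp: sub_def P_def)
  have "cf.dim P \<le> card (proj D B ` Y)" unfolding P_def using Y
    by (simp add: cf.dim_le_card')
  also have "\<dots> \<le> card Y" by (rule card_image_le[OF Y(1)])
  finally have "P \<noteq> F" using less by auto
  then obtain f where f: "f \<in> F" "f \<notin> P" using PF by blast
  obtain s t where st: "f = s + t" "s \<in> P" "t \<in> perp D P F" using orth_decomp[OF P F PF f(1)] .
  have "t \<noteq> 0" using st f by auto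
  moreover have "t \<in> F" using st by (simp add: perp_def)
  moreover have "ip D t y = 0" if "y \<in> Y" for y
  proof -
    have "ip D t (proj D B y) = 0" using that st(3) by (auto simp: perp_def P_def cf.span_base)
    moreover have "ip D (y - proj D B y) t = 0"
      using B \<open>t \<in> F\<close> by (intro residual_orth) (auto simp: onb_def)
    then have "ip D t (y - proj D B y) = 0" by (metis cnj_ip complex_cnj_zero)
    ultimately show ?thesis by (simp add: ip_diff_right)
  qed
  ultimately show ?thesis using that by blast
qed

lemma parseval:
  assumes "onb D B S" "f \<in> S" "S \<subseteq> Fn D"
  shows "ip D f g = (\<Sum>b\<in>B. ip D f b * cnj (ip D g b))"
proof -
  have "ip D f g = ip D (proj D B f) g" using proj_eq[OF assms] by simp
  also have "\<dots> = (\<Sum>b\<in>B. ip D f b * ip D b g)"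
    by (simp add: proj_def ip_sum_left ip_scale_left)
  finally show ?thesis by (simp add: cnj_ip)
qed

lemma dim_le_add:
  assumes "sub D S" "sub D T" "\<And>f. f \<in> V \<Longrightarrow> \<exists>s\<in>S. \<exists>t\<in>T. f = s + t"
  shows "cf.dim V \<le> cf.dim S + cf.dim T"
proof -
  obtain B where B: "onb D B S" using onb_exists[OF assms(1)] .
  obtain C where C: "onb D C T" using onb_exists[OF assms(2)] .
  have "V \<subseteq> cf.span (B \<union> C)"
  proof
    fix f assume "f \<in> V"
    then obtain s t where st: "s \<in> S" "t \<in> T" "f = s + t" using assms(3) by blast
    have "s \<in> cf.span (B \<union> C)" using B st cf.span_mono[of B "B \<union> C"] by (auto simp: onb_def)
    moreover have "t \<in> cf.span (B \<union> C)" using C st cf.span_mono[of C "B \<union> C"] by (auto simp: onb_def)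
    ultimately show "f \<in> cf.span (B \<union> C)" using st by (simp add: cf.span_add)
  qed
  then have "cf.dim V \<le> card (B \<union> C)" using B C by (intro cf.dim_le_card) (auto simp: onb_def)
  also have "\<dots> \<le> card B + card C" by (rule card_Un_le)
  finally show ?thesis using onb_dim[OF B] onb_dim[OF C] by simp
qed

end

section \<open>Unitary permutation representations\<close>

lemma irreducible_charactersI:
  assumes "irreducible_rep G d \<rho>"
  shows "(\<lambda>g\<in>carrier G. mat_trace (\<rho> g)) \<in> irreducible_characters G"
  unfolding irreducible_characters_def
  by (rule CollectI, rule exI[of _ d], rule exI[of _ \<rho>], rule conjI[OF refl assms])

lemma hom_GL:
  fixes \<rho> :: "'g \<Rightarrow> 'a::field mat"
  assumes "group G" and "\<And>g. g \<in> carrier G \<Longrightarrow> \<rho> g \<in> carrier_mat d d"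
    and mult: "\<And>g h. g \<in> carrier G \<Longrightarrow> h \<in> carrier G \<Longrightarrow> \<rho> (g \<otimes>\<^bsub>G\<^esub> h) = \<rho> g * \<rho> h"
    and one: "\<rho> \<one>\<^bsub>G\<^esub> = 1\<^sub>m d"
  shows "\<rho> \<in> hom G (GL TYPE('a) d)"
proof -
  interpret group G by fact
  have "\<rho> g \<in> Units (ring_mat TYPE('a) d ())" if g: "g \<in> carrier G" for g
  proof -
    have "\<rho> g * \<rho> (inv\<^bsub>G\<^esub> g) = 1\<^sub>m d" "\<rho> (inv\<^bsub>G\<^esub> g) * \<rho> g = 1\<^sub>m d"
      using g by (simp_all flip: mult one)
    then show ?thesis using assms(2) g by (auto simp: Units_def ring_mat_simps intro!: bexI[of _ "\<rho> (inv\<^bsub>G\<^esub> g)"])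
  qed
  then show ?thesis using mult by (auto simp: hom_def GL_def units_of_def ring_mat_simps)
qed

lemma subspace_vecD:
  assumes "VectorSpace.subspace class_ring W (module_vec TYPE('a::field) d)"
  shows "W \<subseteq> carrier_vec d" "0\<^sub>v d \<in> W" "\<And>v w. v \<in> W \<Longrightarrow> w \<in> W \<Longrightarrow> v + w \<in> W"
    "\<And>c v. v \<in> W \<Longrightarrow> c \<cdot>\<^sub>v v \<in> W"
proof -
  have "submodule class_ring W (module_vec TYPE('a) d)" using assms by (simp add: VectorSpace.subspace_def)
  then interpret submodule class_ring W "module_vec TYPE('a) d" .
  show "W \<subseteq> carrier_vec d" using subset by (simp add: module_vec_simps)
  show "0\<^sub>v d \<in> W" using zero_closed by (simp add: module_vec_simps)
  show "\<And>v w. v \<in> W \<Longrightarrow> w \<in> W \<Longrightarrow> v + w \<in> W" using m_closed by (simp add: module_vec_simps)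
  show "\<And>c v. v \<in> W \<Longrightarrow> c \<cdot>\<^sub>v v \<in> W" using smult_closed by (simp add: module_vec_simps class_ring_simps)
qed

locale perm_rep = group G + fin_supp D for G (structure) and D :: "'x set" +
  fixes act :: "'a \<Rightarrow> 'x \<Rightarrow> 'x"
  assumes fin_G: "finite (carrier G)"
    and act_closed: "g \<in> carrier G \<Longrightarrow> x \<in> D \<Longrightarrow> act g x \<in> D"
    and act_one: "x \<in> D \<Longrightarrow> act \<one> x = x"
    and act_mult: "g \<in> carrier G \<Longrightarrow> h \<in> carrier G \<Longrightarrow> x \<in> D \<Longrightarrow> act (g \<otimes> h) x = act g (act h x)"
begin

text \<open>The inverse makes \<open>T\<close> a left action. Cutting values outside
  \<open>D\<close> to zero puts every \<open>T g f\<close> into \<open>Fn D\<close>; in return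
  \<open>T_one\<close> holds only on \<open>Fn D\<close>.\<close>

definition T :: "'a \<Rightarrow> ('x \<Rightarrow> complex) \<Rightarrow> 'x \<Rightarrow> complex" where
  "T g f = (\<lambda>x. if x \<in> D then f (act (inv g) x) else 0)"

lemma T_Fn: "T g f \<in> Fn D"
  by (simp add: T_def Fn_def)

lemma T_add: "T g (f + f') = T g f + T g f'"
  and T_diff: "T g (f - f') = T g f - T g f'"
  and T_scale: "T g (c *c f) = c *c T g f"
  and T_zero [simp]: "T g 0 = 0"
  by (auto simp: T_def fun_eq_iff)

lemma T_sum: "T g (\<Sum>i\<in>I. f i) = (\<Sum>i\<in>I. T g (f i))"
  by (auto simp: T_def fun_eq_iff sum_fun_apply)

lemma T_mult: "g \<in> carrier G \<Longrightarrow> h \<in> carrier G \<Longrightarrow> T (g \<otimes> h) f = T g (T h f)"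
  by (auto simp: T_def fun_eq_iff act_mult act_closed inv_mult_group)

lemma T_one: "f \<in> Fn D \<Longrightarrow> T \<one> f = f"
  by (auto simp: T_def fun_eq_iff act_one Fn_def)

lemma act_inv: "g \<in> carrier G \<Longrightarrow> x \<in> D \<Longrightarrow> act (inv g) (act g x) = x"
  and act_inv': "g \<in> carrier G \<Longrightarrow> x \<in> D \<Longrightarrow> act g (act (inv g) x) = x"
  by (simp_all add: act_one flip: act_mult)

lemma act_bij: "g \<in> carrier G \<Longrightarrow> bij_betw (act g) D D"
  by (rule bij_betwI[where g = "act (inv g)"]) (auto simp: act_closed act_inv act_inv')

lemma ip_T: "g \<in> carrier G \<Longrightarrow> ip D (T g f) (T g f') = ip D f f'"
  unfolding ip_def T_def
  by (rule trans[OF _ sum.reindex_bij_betw[OF act_bij[of "inv g"]]]) auto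

lemma ip_T_left: "g \<in> carrier G \<Longrightarrow> f \<in> Fn D \<Longrightarrow> f' \<in> Fn D \<Longrightarrow> ip D (T g f) f' = ip D f (T (inv g) f')"
  using ip_T[of g f "T (inv g) f'"] by (simp add: T_one flip: T_mult)

definition inv_sub :: "('x \<Rightarrow> complex) set \<Rightarrow> bool" where
  "inv_sub S \<longleftrightarrow> sub D S \<and> (\<forall>g\<in>carrier G. \<forall>f\<in>S. T g f \<in> S)"

definition irr :: "('x \<Rightarrow> complex) set \<Rightarrow> bool" where
  "irr S \<longleftrightarrow> inv_sub S \<and> S \<noteq> {0} \<and> (\<forall>Y. inv_sub Y \<and> Y \<subseteq> S \<longrightarrow> Y = {0} \<or> Y = S)"

lemma inv_subD: "inv_sub S \<Longrightarrow> sub D S" "inv_sub S \<Longrightarrow> g \<in> carrier G \<Longrightarrow> f \<in> S \<Longrightarrow> T g f \<in> S"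
  "inv_sub S \<Longrightarrow> S \<subseteq> Fn D"
  by (auto simp: inv_sub_def sub_def)

lemma inv_sub_perp:
  assumes "inv_sub S" "inv_sub V" shows "inv_sub (perp D S V)"
  unfolding inv_sub_def
proof (intro conjI ballI)
  show "sub D (perp D S V)" using assms by (simp add: inv_sub_def sub_perp)
  fix g f assume g: "g \<in> carrier G" and f: "f \<in> perp D S V"
  have "ip D (T g f) s = 0" if "s \<in> S" for s
  proof -
    have "T (inv g) s \<in> S" using that g assms by (simp add: inv_sub_def)
    then show ?thesis using f g that inv_subD(3)[OF assms(1)] inv_subD(3)[OF assms(2)]
      by (subst ip_T_left) (auto simp: perp_def)
  qed
  then show "T g f \<in> perp D S V" using f g assms by (auto simp: perp_def inv_sub_def)
qed

lemma inv_sub_Int: "inv_sub S \<Longrightarrow> inv_sub V \<Longrightarrow> inv_sub (S \<inter> V)"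
  by (auto simp: inv_sub_def sub_Int)

lemma inv_sub_span:
  assumes "B \<subseteq> Fn D" "\<And>g b. g \<in> carrier G \<Longrightarrow> b \<in> B \<Longrightarrow> T g b \<in> cf.span B"
  shows "inv_sub (cf.span B)"
  unfolding inv_sub_def
proof (intro conjI ballI sub_span assms(1))
  fix g f assume g: "g \<in> carrier G" and f: "f \<in> cf.span B"
  have "cf.subspace {f. T g f \<in> cf.span B}"
    by (auto simp: cf.subspace_def T_add T_scale cf.span_zero cf.span_add cf.span_scale)
  then have "cf.span B \<subseteq> {f. T g f \<in> cf.span B}" using assms(2)[OF g] by (intro cf.span_minimal) auto
  then show "T g f \<in> cf.span B" using f by auto
qed

text \<open>For an orthonormal basis \<open>B\<close> of an invariant subspace this is the trace of
  \<open>T g\<close> on that subspace.\<close>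

definition chr :: "('x \<Rightarrow> complex) set \<Rightarrow> 'a \<Rightarrow> complex" where
  "chr B g = (\<Sum>b\<in>B. ip D (T g b) b)"

text \<open>Coordinates with respect to \<open>B\<close> turn \<open>S\<close> into a matrix
  representation, and invariant spaces of coordinate vectors correspond to invariant subspaces of
  \<open>S\<close>, so irreducibility is preserved.\<close>

lemma irr_character:
  assumes irr: "irr S" and B: "onb D B S"
  shows "restrict (chr B) (carrier G) \<in> irreducible_characters G"
proof -
  define d where "d = card B"
  have S: "inv_sub S" "sub D S" "S \<subseteq> Fn D" using irr by (auto simp: irr_def inv_sub_def sub_def)
  have finB: "finite B" and BS: "B \<subseteq> S" and ortho: "orthonormal D B" and span: "S \<subseteq> cf.span B"
    using B by (auto simp: onb_def)
  obtain b where b: "bij_betw b {..<d} B"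
    using ex_bij_betw_nat_finite[OF finB] by (auto simp: d_def atLeast0LessThan)
  have bB: "i < d \<Longrightarrow> b i \<in> B" for i using b by (auto simp: bij_betw_def)
  have b_inj: "i < d \<Longrightarrow> j < d \<Longrightarrow> b i = b j \<longleftrightarrow> i = j" for i j using b by (auto simp: bij_betw_def inj_on_def)
  have bb: "i < d \<Longrightarrow> j < d \<Longrightarrow> ip D (b i) (b j) = (if i = j then 1 else 0)" for i j
    using ortho bB b_inj by (auto simp: orthonormal_def)
  have expand: "f = (\<Sum>i<d. ip D f (b i) *c b i)" if "f \<in> S" for f
    using proj_eq[OF B that S(3)] unfolding proj_def by (simp flip: sum.reindex_bij_betw[OF b])
  define \<rho> where "\<rho> g = mat d d (\<lambda>(i, j). ip D (T g (b j)) (b i))" for g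
  have comb: "ip D (\<Sum>i<d. c i *c b i) (b j) = c j" if "j < d" for c j
    using that by (simp add: ip_sum_left ip_scale_left bb if_distrib cong: if_cong)
  have T_comb: "ip D (T g (\<Sum>i<d. c i *c b i)) (b j) = (\<Sum>i<d. c i * ip D (T g (b i)) (b j))" for g c j
    by (simp add: T_sum T_scale ip_sum_left ip_scale_left)
  have mult: "\<rho> (g \<otimes> h) = \<rho> g * \<rho> h" if g: "g \<in> carrier G" and h: "h \<in> carrier G" for g h
  proof (rule eq_matI)
    fix i j assume ij: "i < dim_row (\<rho> g * \<rho> h)" "j < dim_col (\<rho> g * \<rho> h)"
    then have ij: "i < d" "j < d" by (auto simp: \<rho>_def)
    have "T h (b j) = (\<Sum>k<d. ip D (T h (b j)) (b k) *c b k)"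
      using ij bB BS S h by (intro expand) (auto simp: inv_sub_def)
    then have "ip D (T g (T h (b j))) (b i) = (\<Sum>k<d. ip D (T h (b j)) (b k) * ip D (T g (b k)) (b i))"
      using T_comb by metis
    then show "\<rho> (g \<otimes> h) $$ (i, j) = (\<rho> g * \<rho> h) $$ (i, j)"
      using ij g h by (simp add: \<rho>_def T_mult scalar_prod_def atLeast0LessThan mult.commute)
  qed (simp_all add: \<rho>_def)
  have one: "\<rho> \<one> = 1\<^sub>m d"
    using bB BS S by (intro eq_matI) (auto simp: \<rho>_def bb T_one subset_iff)
  have hom: "\<rho> \<in> hom G (GL TYPE(complex) d)"
    by (intro hom_GL mult one is_group) (simp_all add: \<rho>_def)
  have "B \<noteq> {}"
  proof
    assume "B = {}"
    then have "S = {0}" using span sub_zero[OF S(2)] by auto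
    then show False using irr by (simp add: irr_def)
  qed
  then have d0: "0 < d" using finB by (simp add: d_def card_gt_0_iff)
  have "W = {0\<^sub>v d} \<or> W = carrier_vec d"
    if W: "VectorSpace.subspace class_ring W (module_vec TYPE(complex) d)"
      and inv: "\<forall>g\<in>carrier G. \<forall>w\<in>W. \<rho> g *\<^sub>v w \<in> W" for W
  proof -
    note W' = subspace_vecD[OF W]
    \<comment> \<open>The inverse of the coordinate map. It intertwines the matrices
      \<open>\<rho> g\<close> with \<open>T g\<close>, so the image of \<open>W\<close> is an
      invariant subspace of \<open>S\<close>.\<close>
    define F where "F w = (\<Sum>i<d. (w $ i) *c b i)" for w :: "complex vec"
    have FS: "F w \<in> S" for w unfolding F_def using bB BS S(2) by (intro sub_sum sub_scale) auto
    have F_ip: "ip D (F w) (b i) = w $ i" if "i < d" for w :: "complex vec" and i using comb that by (simp add: F_def)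
    have inj: "v = w" if "v \<in> carrier_vec d" "w \<in> carrier_vec d" "F v = F w" for v w
    proof (rule eq_vecI)
      show "v $ i = w $ i" if "i < dim_vec w" for i
        using F_ip[of i v] F_ip[of i w] that \<open>F v = F w\<close> \<open>w \<in> carrier_vec d\<close> by simp
    qed (use that in auto)
    have F_add: "F (v + w) = F v + F w" if "v \<in> carrier_vec d" "w \<in> carrier_vec d" for v w
      using that by (simp add: F_def cf.scale_left_distrib sum.distrib)
    have F_scale: "F (c \<cdot>\<^sub>v v) = c *c F v" if "v \<in> carrier_vec d" for v c
      using that by (simp add: F_def cf.scale_sum_right)
    have F_zero: "F (0\<^sub>v d) = 0" by (simp add: F_def)
    have F_T: "F (\<rho> g *\<^sub>v w) = T g (F w)" if "g \<in> carrier G" "w \<in> carrier_vec d" for g w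
    proof -
      have "T g (F w) \<in> S" using FS S that by (simp add: inv_sub_def)
      from expand[OF this] have "T g (F w) = (\<Sum>i<d. ip D (T g (F w)) (b i) *c b i)" .
      also have "\<dots> = F (\<rho> g *\<^sub>v w)" unfolding F_def[of "\<rho> g *\<^sub>v w"]
      proof (rule sum.cong[OF refl])
        fix i assume "i \<in> {..<d}"
        then have "ip D (T g (F w)) (b i) = (\<rho> g *\<^sub>v w) $ i"
          unfolding F_def T_comb using that
          by (simp add: \<rho>_def scalar_prod_def atLeast0LessThan mult.commute)
        then show "ip D (T g (F w)) (b i) *c b i = (\<rho> g *\<^sub>v w) $ i *c b i" by simp
      qed
      finally show ?thesis by simp
    qed
    have sFW: "cf.subspace (F ` W)"
      unfolding cf.subspace_def
    proof (intro conjI ballI allI)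
      show "0 \<in> F ` W" using W'(2) F_zero by force
      fix x assume "x \<in> F ` W"
      then obtain v where v: "v \<in> W" "v \<in> carrier_vec d" "x = F v" using W'(1) by blast
      show "c *c x \<in> F ` W" for c
        using F_scale[OF v(2)] v(3) W'(4)[OF v(1)] by (metis imageI)
      fix y assume "y \<in> F ` W"
      then obtain w where w: "w \<in> W" "w \<in> carrier_vec d" "y = F w" using W'(1) by blast
      show "x + y \<in> F ` W"
        using F_add[OF v(2) w(2)] v(3) w(3) W'(3)[OF v(1) w(1)] by (metis imageI)
    qed
    have FWS: "F ` W \<subseteq> S" using FS by (rule image_subsetI)
    have TFW: "T g f \<in> F ` W" if g: "g \<in> carrier G" and f: "f \<in> F ` W" for g f
    proof -
      obtain v where v: "v \<in> W" "v \<in> carrier_vec d" "f = F v" using f W'(1) by blast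
      have "\<rho> g *\<^sub>v v \<in> W" using inv g v(1) by blast
      then show ?thesis using F_T[OF g v(2)] v(3) by (metis imageI)
    qed
    have "inv_sub (F ` W)"
      unfolding inv_sub_def sub_def
      by (intro conjI ballI sFW subset_trans[OF FWS S(3)] TFW)
    then have "F ` W = {0} \<or> F ` W = S"
      using irr FWS unfolding irr_def by metis
    then show ?thesis
    proof
      assume 1: "F ` W = {0}"
      have "w = 0\<^sub>v d" if w: "w \<in> W" for w
      proof (rule inj)
        show "w \<in> carrier_vec d" using W'(1) w by (rule subsetD)
        have "F w \<in> {0}" using imageI[OF w, of F] unfolding 1 .
        then show "F w = F (0\<^sub>v d)" unfolding F_zero by (rule singletonD)
      qed simp
      then have "W \<subseteq> {0\<^sub>v d}" by (intro subsetI singletonI) (simp only: singleton_iff)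
      moreover have "{0\<^sub>v d} \<subseteq> W" using W'(2) by (simp only: insert_subset empty_subsetI)
      ultimately have "W = {0\<^sub>v d}" by (rule equalityI)
      then show ?thesis by (rule disjI1)
    next
      assume 2: "F ` W = S"
      have "w \<in> W" if "w \<in> carrier_vec d" for w
      proof -
        have "F w \<in> F ` W" unfolding 2 by (rule FS)
        then obtain v where v: "F w = F v" "v \<in> W" by (rule imageE)
        from inj[OF that subsetD[OF W'(1) v(2)] v(1)] v(2) show ?thesis by (simp only:)
      qed
      then have "carrier_vec d \<subseteq> W" by (rule subsetI)
      with W'(1) have "W = carrier_vec d" by (rule equalityI)
      then show ?thesis by (rule disjI2)
    qed
  qed
  note irreducible = this
  have "irreducible_rep G d \<rho>"
    unfolding irreducible_rep_def
  proof (intro conjI allI impI d0 hom)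
    fix W assume W: "VectorSpace.subspace class_ring W (module_vec TYPE(complex) d) \<and>
      (\<forall>g\<in>carrier G. \<forall>w\<in>W. \<rho> g *\<^sub>v w \<in> W)"
    show "W = {0\<^sub>v d} \<or> W = carrier_vec d" by (rule irreducible[OF conjunct1[OF W] conjunct2[OF W]])
  qed
  note character = irreducible_charactersI[OF this]
  have "mat_trace (\<rho> g) = chr B g" for g
  proof -
    have "chr B g = (\<Sum>i<d. ip D (T g (b i)) (b i))"
      unfolding chr_def by (rule sum.reindex_bij_betw[OF b, symmetric])
    also have "\<dots> = mat_trace (\<rho> g)"
      unfolding mat_trace_def by (rule sum.cong) (simp_all add: \<rho>_def)
    finally show ?thesis by (rule sym)
  qed
  note tr = this
  have "(\<lambda>g\<in>carrier G. mat_trace (\<rho> g)) = restrict (chr B) (carrier G)"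
    by (rule restrict_cong) (simp_all only: tr simp_implies_def)
  with character show ?thesis by (simp only:)
qed

end

section \<open>Averaging over the group\<close>

context fin_supp begin

lemma bessel:
  assumes "finite B" "orthonormal D B"
  shows "(\<Sum>b\<in>B. (cmod (ip D f b))\<^sup>2) \<le> Re (ip D f f)"
proof -
  let ?p = "proj D B f"
  have "ip D (f - ?p) ?p = 0" using assms proj_in_span by (rule residual_orth)
  then have fp: "ip D f ?p = ip D ?p ?p" by (simp add: ip_diff_left)
  then have pf: "ip D ?p f = ip D ?p ?p" by (metis cnj_ip)
  have "ip D f ?p = (\<Sum>b\<in>B. of_real ((cmod (ip D f b))\<^sup>2))"
    unfolding proj_def ip_sum_right ip_scale_right
    by (intro sum.cong refl) (simp add: complex_norm_square mult.commute del: of_real_power)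
  then have "Re (ip D f ?p) = (\<Sum>b\<in>B. (cmod (ip D f b))\<^sup>2)" by simp
  moreover have "ip D (f - ?p) (f - ?p) = ip D f f - ip D f ?p"
    by (simp add: ip_diff_left ip_diff_right fp pf)
  ultimately show ?thesis using ip_self_nonneg[of D "f - ?p"] by simp
qed

end

context perm_rep begin

text \<open>The Reynolds operator: the orthogonal projection of \<open>Fn D\<close> onto the
  functions fixed by the group.\<close>

definition avg :: "('x \<Rightarrow> complex) \<Rightarrow> 'x \<Rightarrow> complex" where
  "avg f = (1 / of_nat (card (carrier G))) *c (\<Sum>g\<in>carrier G. T g f)"

lemma card_G_pos: "card (carrier G) > 0"
  using fin_G one_closed by (auto simp: card_gt_0_iff)

lemma avg_Fn: "avg f \<in> Fn D"
  unfolding avg_def by (intro cf.subspace_scale[OF sub_Fn] cf.subspace_sum[OF sub_Fn] T_Fn)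

lemma T_avg:
  assumes h: "h \<in> carrier G" shows "T h (avg f) = avg f"
proof -
  have "bij_betw (\<lambda>g. h \<otimes> g) (carrier G) (carrier G)"
    using h by (intro bij_betwI[where g = "\<lambda>g. inv h \<otimes> g"]) (auto simp: m_assoc[symmetric])
  from sum.reindex_bij_betw[OF this, of "\<lambda>g. T g f"]
  have "(\<Sum>g\<in>carrier G. T h (T g f)) = (\<Sum>g\<in>carrier G. T g f)"
    using h by (simp add: T_mult[symmetric] cong: sum.cong)
  then show ?thesis by (simp add: avg_def T_scale T_sum)
qed

lemma ip_avg_inv:
  assumes K: "\<And>g. g \<in> carrier G \<Longrightarrow> T g K = K"
  shows "ip D (avg f) K = ip D f K"
proof -
  have "ip D (T g f) K = ip D f K" if "g \<in> carrier G" for g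
    using ip_T[OF that, of f K] K[OF that] by simp
  then have "ip D (avg f) K = 1 / of_nat (card (carrier G)) * (\<Sum>g\<in>carrier G. ip D f K)"
    by (simp add: avg_def ip_scale_left ip_sum_left)
  then show ?thesis using card_G_pos by simp
qed

lemma ip_avg_self: "ip D (avg f) f = ip D (avg f) (avg f)"
  using ip_avg_inv[of "avg f" f] T_avg by (metis cnj_ip)

text \<open>The left-hand side is the trace of the averaging projection on the span of \<open>F\<close>.\<close>
lemma trace_avg_ge:
  assumes F: "finite F" "orthonormal D F" and K: "finite K" "orthonormal D K" "K \<subseteq> cf.span F"
    and inv: "\<And>g k. g \<in> carrier G \<Longrightarrow> k \<in> K \<Longrightarrow> T g k = k"
  shows "Re (\<Sum>f\<in>F. ip D (avg f) f) \<ge> card K"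
proof -
  have onbF: "onb D F (cf.span F)" using F cf.span_superset by (auto simp: onb_def)
  have spF: "cf.span F \<subseteq> Fn D" using F sub_span[of F D] by (auto simp: sub_def orthonormal_def)
  have k1: "(\<Sum>f\<in>F. (cmod (ip D f k))\<^sup>2) = 1" if "k \<in> K" for k
  proof -
    have "complex_of_real (\<Sum>f\<in>F. (cmod (ip D f k))\<^sup>2) = (\<Sum>f\<in>F. ip D k f * cnj (ip D k f))"
      unfolding of_real_sum
    proof (rule sum.cong[OF refl])
      fix f
      have "cmod (ip D f k) = cmod (ip D k f)" by (metis cnj_ip complex_mod_cnj)
      then show "complex_of_real ((cmod (ip D f k))\<^sup>2) = ip D k f * cnj (ip D k f)"
        by (simp only: complex_norm_square)
    qed
    also have "\<dots> = ip D k k" using parseval[OF onbF _ spF] that K by (metis subsetD)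
    also have "\<dots> = of_real 1" using that K by (simp add: orthonormal_def)
    finally show ?thesis by (simp only: of_real_eq_iff)
  qed
  \<comment> \<open>Parseval makes the sum over \<open>F\<close> equal to 1 for each
    \<open>k\<close>. After exchanging the sums, Bessel bounds the sum over \<open>K\<close> by the
    squared norm of \<open>avg f\<close>, which is the diagonal entry
    \<open>ip D (avg f) f\<close>.\<close>
  have "card K = (\<Sum>k\<in>K. \<Sum>f\<in>F. (cmod (ip D f k))\<^sup>2)" using k1 by simp
  also have "\<dots> = (\<Sum>f\<in>F. \<Sum>k\<in>K. (cmod (ip D (avg f) k))\<^sup>2)"
    by (subst sum.swap) (simp add: ip_avg_inv inv)
  also have "\<dots> \<le> (\<Sum>f\<in>F. Re (ip D (avg f) (avg f)))" by (intro sum_mono bessel K)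
  also have "\<dots> = Re (\<Sum>f\<in>F. ip D (avg f) f)" by (simp add: ip_avg_self)
  finally show ?thesis .
qed

end

section \<open>Invariant kernels on the square and multiplicities\<close>

definition tens :: "('x \<Rightarrow> complex) \<Rightarrow> ('x \<Rightarrow> complex) \<Rightarrow> 'x \<times> 'x \<Rightarrow> complex" where
  "tens f g = (\<lambda>(x, y). f x * cnj (g y))"

text \<open>The conjugate built into \<open>tens\<close> makes the second factor come out
  conjugated. Traces on such products are therefore \<open>chr C g * cnj (chr B g)\<close>, the
  summand of the character inner product, with no dual space involved.\<close>

lemma ip_tens: "ip (D \<times> D) (tens f g) (tens f' g') = ip D f f' * cnj (ip D g g')"
  unfolding ip_def cnj_sum sum_product sum.cartesian_product
  by (intro sum.cong refl) (auto simp: tens_def mult_ac)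

lemma tens_Fn: "f \<in> Fn D \<Longrightarrow> g \<in> Fn D \<Longrightarrow> tens f g \<in> Fn (D \<times> D)"
  by (auto simp: Fn_def tens_def)

lemma tens_sum_left: "tens (\<Sum>i\<in>I. f i) g = (\<Sum>i\<in>I. tens (f i) g)"
  by (auto simp: tens_def fun_eq_iff sum_fun_apply sum_distrib_right)

lemma tens_sum_right: "tens f (\<Sum>i\<in>I. g i) = (\<Sum>i\<in>I. tens f (g i))"
  by (auto simp: tens_def fun_eq_iff sum_fun_apply sum_distrib_left)

lemma tens_scale_left: "tens (c *c f) g = c *c tens f g"
  and tens_scale_right: "tens f (c *c g) = cnj c *c tens f g"
  by (auto simp: tens_def fun_eq_iff)

context perm_rep begin

text \<open>The diagonal action; through it the averaging results apply to functions of two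
  variables.\<close>

lemma perm_rep_square: "perm_rep G (D \<times> D) (\<lambda>g (x, y). (act g x, act g y))"
  by unfold_locales (auto simp: finX fin_G act_closed act_one act_mult)

interpretation sq: perm_rep G "D \<times> D" "\<lambda>g (x, y). (act g x, act g y)"
  by (rule perm_rep_square)

lemma T_tens: "sq.T g (tens f f') = tens (T g f) (T g f')"
  by (auto simp: sq.T_def T_def tens_def fun_eq_iff)

definition equivariant :: "('x \<Rightarrow> complex) set \<Rightarrow> ('x \<Rightarrow> complex) set \<Rightarrow> (('x \<Rightarrow> complex) \<Rightarrow> 'x \<Rightarrow> complex) \<Rightarrow> bool" where
  "equivariant W V \<phi> \<longleftrightarrow> (\<forall>f\<in>W. \<phi> f \<in> V) \<and> (\<forall>f\<in>W. \<forall>h\<in>W. \<phi> (f + h) = \<phi> f + \<phi> h) \<and>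
     (\<forall>c. \<forall>f\<in>W. \<phi> (c *c f) = c *c \<phi> f) \<and> (\<forall>g\<in>carrier G. \<forall>f\<in>W. \<phi> (T g f) = T g (\<phi> f))"

lemma equivariant_sum:
  assumes "equivariant W V \<phi>" "sub D W" "\<And>i. i \<in> I \<Longrightarrow> f i \<in> W" "finite I"
  shows "\<phi> (\<Sum>i\<in>I. c i *c f i) = (\<Sum>i\<in>I. c i *c \<phi> (f i))"
  using assms(4,3)
proof (induction I rule: finite_induct)
  case empty
  have "\<phi> (0 *c 0) = 0 *c \<phi> 0" using assms sub_zero[OF assms(2)] unfolding equivariant_def by blast
  then have "\<phi> 0 = 0" by (simp only: cf.scale_zero_left)
  then show ?case by (simp only: sum.empty)
next
  case (insert i I)
  have "\<phi> (c i *c f i + (\<Sum>i\<in>I. c i *c f i)) = \<phi> (c i *c f i) + \<phi> (\<Sum>i\<in>I. c i *c f i)"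
    using assms(1) insert.prems sub_scale[OF assms(2)] sub_sum[OF assms(2), of I "\<lambda>i. c i *c f i"]
    unfolding equivariant_def by (metis insertCI)
  also have "\<phi> (c i *c f i) = c i *c \<phi> (f i)" using assms(1) insert.prems
    unfolding equivariant_def by blast
  also have "\<phi> (\<Sum>i\<in>I. c i *c f i) = (\<Sum>i\<in>I. c i *c \<phi> (f i))" using insert by blast
  finally show ?case unfolding sum.insert[OF insert.hyps(1,2)] .
qed

text \<open>The sum of the \<open>tens c (\<phi> c)\<close> does not depend on the orthonormal basis
  of \<open>W\<close>, and \<open>T g\<close> maps \<open>C\<close> to another such basis while
  commuting with \<open>\<phi>\<close>. The computation carries this out with the unitary matrix
  \<open>a\<close> of \<open>T g\<close>.\<close>

lemma kernel_invariant:
  assumes W: "inv_sub W" and C: "onb D C W" and \<phi>: "equivariant W V \<phi>" and g: "g \<in> carrier G"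
  shows "sq.T g (\<Sum>c\<in>C. tens c (\<phi> c)) = (\<Sum>c\<in>C. tens c (\<phi> c))"
proof -
  have CW: "C \<subseteq> W" "finite C" "orthonormal D C" using C by (auto simp: onb_def)
  have WF: "W \<subseteq> Fn D" using inv_subD(3)[OF W] .
  define a where "a c c' = ip D (T g c) c'" for c c'
  have exp: "T g c = (\<Sum>c'\<in>C. a c c' *c c')" if "c \<in> C" for c
    using proj_eq[OF C _ WF, of "T g c"] inv_subD(2)[OF W g] that CW(1)
    unfolding proj_def a_def by (metis subsetD)
  have exp\<phi>: "T g (\<phi> c) = (\<Sum>c'\<in>C. a c c' *c \<phi> c')" if "c \<in> C" for c
  proof -
    have "T g (\<phi> c) = \<phi> (T g c)" using \<phi> that CW g unfolding equivariant_def by (metis subsetD)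
    also have "\<dots> = \<phi> (\<Sum>c'\<in>C. a c c' *c c')" using exp[OF that] by simp
    also have "\<dots> = (\<Sum>c'\<in>C. a c c' *c \<phi> c')"
      using CW by (intro equivariant_sum[OF \<phi> inv_subD(1)[OF W]]) auto
    finally show ?thesis .
  qed
  \<comment> \<open>The sum runs over the first index of \<open>a\<close>. Passing to the adjoint
    \<open>T (inv g)\<close> moves this index to the place where Parseval over \<open>C\<close>
    applies.\<close>
  have orth: "(\<Sum>c\<in>C. a c c' * cnj (a c c'')) = (if c' = c'' then 1 else 0)" if "c' \<in> C" "c'' \<in> C" for c' c''
  proof -
    have F: "c \<in> Fn D" if "c \<in> C" for c using that CW WF by blast
    have ac: "a c d = cnj (ip D (T (inv g) d) c)" if "c \<in> C" "d \<in> C" for c d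
      using ip_T_left[OF g F F, OF that] by (simp add: a_def cnj_ip)
    have "(\<Sum>c\<in>C. a c c' * cnj (a c c'')) = (\<Sum>c\<in>C. ip D (T (inv g) c'') c * cnj (ip D (T (inv g) c') c))"
      using that by (intro sum.cong refl) (simp add: ac)
    also have "\<dots> = ip D (T (inv g) c'') (T (inv g) c')"
      using inv_subD(2)[OF W, of "inv g" c''] g that CW by (intro parseval[OF C _ WF, symmetric]) auto
    also have "\<dots> = ip D c'' c'" using g by (simp add: ip_T)
    finally show ?thesis using CW(3) that by (auto simp: orthonormal_def)
  qed
  have "sq.T g (\<Sum>c\<in>C. tens c (\<phi> c)) = (\<Sum>c\<in>C. tens (T g c) (T g (\<phi> c)))"
    by (simp add: sq.T_sum T_tens)
  also have "\<dots> = (\<Sum>c\<in>C. tens (\<Sum>c'\<in>C. a c c' *c c') (\<Sum>c''\<in>C. a c c'' *c \<phi> c''))"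
    by (intro sum.cong refl) (simp only: exp exp\<phi>)
  also have "\<dots> = (\<Sum>c\<in>C. \<Sum>c'\<in>C. \<Sum>c''\<in>C. (a c c' * cnj (a c c'')) *c tens c' (\<phi> c''))"
    unfolding tens_sum_left tens_sum_right tens_scale_left tens_scale_right cf.scale_sum_right
    by (rule sum.cong[OF refl], subst sum.swap) (simp only: cf.scale_scale mult.commute)
  also have "\<dots> = (\<Sum>c'\<in>C. \<Sum>c''\<in>C. \<Sum>c\<in>C. (a c c' * cnj (a c c'')) *c tens c' (\<phi> c''))"
    by (rule trans[OF sum.swap sum.cong[OF refl sum.swap]])
  also have "\<dots> = (\<Sum>c'\<in>C. \<Sum>c''\<in>C. (\<Sum>c\<in>C. a c c' * cnj (a c c'')) *c tens c' (\<phi> c''))"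
    by (simp add: cf.scale_sum_left)
  also have "\<dots> = (\<Sum>c'\<in>C. \<Sum>c''\<in>C. if c' = c'' then tens c' (\<phi> c'') else 0)"
    by (intro sum.cong refl) (auto simp: orth)
  also have "\<dots> = (\<Sum>c\<in>C. tens c (\<phi> c))" using CW(2) by simp
  finally show ?thesis .
qed

text \<open>The intertwiners \<open>\<phi>\<close> and \<open>\<phi>'\<close> yield two orthogonal invariant functions on \<open>D \<times> D\<close> in the span
  of the \<open>tens c b\<close>, where the averaging projection has trace \<open>\<langle>chr C, chr B\<rangle>\<close>.\<close>
lemma multiplicity_ge_2:
  assumes W: "inv_sub W" and C: "onb D C W" and V: "inv_sub V" and B: "onb D B V"
    and \<phi>: "equivariant W V \<phi>" and \<phi>': "equivariant W V \<phi>'"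
    and orth: "\<And>f h. f \<in> W \<Longrightarrow> h \<in> W \<Longrightarrow> ip D (\<phi> f) (\<phi>' h) = 0"
    and nz: "\<exists>f\<in>W. \<phi> f \<noteq> 0" "\<exists>f\<in>W. \<phi>' f \<noteq> 0"
  shows "Re (\<Sum>g\<in>carrier G. chr C g * cnj (chr B g)) \<ge> 2 * card (carrier G)"
proof -
  have CW: "C \<subseteq> W" "finite C" "orthonormal D C" "W \<subseteq> cf.span C" using C by (auto simp: onb_def)
  have BV: "B \<subseteq> V" "finite B" "orthonormal D B" "V \<subseteq> cf.span B" using B by (auto simp: onb_def)
  have WF: "W \<subseteq> Fn D" and VF: "V \<subseteq> Fn D" using inv_subD(3) W V by auto
  define F where "F = (\<lambda>(c, b). tens c b) ` (C \<times> B)"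
  have ipF: "ip (D \<times> D) (tens c b) (tens c' b') = (if c = c' \<and> b = b' then 1 else 0)"
    if "c \<in> C" "c' \<in> C" "b \<in> B" "b' \<in> B" for c c' b b'
    using that CW(3) BV(3) by (auto simp: ip_tens orthonormal_def)
  have inj: "inj_on (\<lambda>(c, b). tens c b) (C \<times> B)"
  proof (rule inj_onI, clarify)
    fix c b c' b' assume *: "c \<in> C" "b \<in> B" "c' \<in> C" "b' \<in> B" "tens c b = tens c' b'"
    have "ip (D \<times> D) (tens c b) (tens c' b') = 1" using * ipF[of c c b b] by simp
    then show "c = c' \<and> b = b'" using * ipF[of c c' b b'] by (auto split: if_splits)
  qed
  have finF: "finite F" using CW BV by (simp add: F_def)
  have F_iff: "tens c b = tens c' b' \<longleftrightarrow> c = c' \<and> b = b'"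
    if "c \<in> C" "c' \<in> C" "b \<in> B" "b' \<in> B" for c c' b b'
    using inj that by (auto simp: inj_on_def)
  have orthF: "orthonormal (D \<times> D) F"
    using CW(1) BV(1) WF VF by (auto simp: orthonormal_def F_def ipF F_iff intro!: tens_Fn)
  define K where "K \<psi> = (\<Sum>c\<in>C. tens c (\<psi> c))" for \<psi>
  have K_span: "K \<psi> \<in> cf.span F" if "equivariant W V \<psi>" for \<psi>
    unfolding K_def
  proof (rule cf.span_sum)
    fix c assume c: "c \<in> C"
    then have "\<psi> c \<in> V" using that CW by (auto simp: equivariant_def)
    then have "\<psi> c = (\<Sum>b\<in>B. ip D (\<psi> c) b *c b)" using proj_eq[OF B _ VF] by (simp add: proj_def)
    then have "tens c (\<psi> c) = (\<Sum>b\<in>B. cnj (ip D (\<psi> c) b) *c tens c b)"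
      by (metis (no_types, lifting) sum.cong tens_scale_right tens_sum_right)
    also have "\<dots> \<in> cf.span F"
      using c by (intro cf.span_sum cf.span_scale cf.span_base) (auto simp: F_def)
    finally show "tens c (\<psi> c) \<in> cf.span F" .
  qed
  \<comment> \<open>A Hilbert-Schmidt inner product: intertwiners with orthogonal images have
    orthogonal kernels, and the norm of a kernel vanishes only if its intertwiner vanishes on
    \<open>C\<close>.\<close>
  have ipK: "ip (D \<times> D) (K \<psi>) (K \<psi>') = (\<Sum>c\<in>C. cnj (ip D (\<psi> c) (\<psi>' c)))" for \<psi> \<psi>'
  proof -
    have "ip (D \<times> D) (K \<psi>) (K \<psi>') = (\<Sum>c\<in>C. \<Sum>c'\<in>C. ip D c c' * cnj (ip D (\<psi> c) (\<psi>' c')))"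
      unfolding K_def ip_sum_left ip_sum_right ip_tens by (rule sum.swap)
    also have "\<dots> = (\<Sum>c\<in>C. \<Sum>c'\<in>C. if c = c' then cnj (ip D (\<psi> c) (\<psi>' c')) else 0)"
      using CW(3) by (intro sum.cong refl) (auto simp: orthonormal_def)
    finally show ?thesis using CW(2) by simp
  qed
  have K_nz: "K \<psi> \<noteq> 0" if \<psi>: "equivariant W V \<psi>" and ex: "\<exists>f\<in>W. \<psi> f \<noteq> 0" for \<psi>
  proof
    assume "K \<psi> = 0"
    then have "(\<Sum>c\<in>C. cnj (ip D (\<psi> c) (\<psi> c))) = 0" using ipK[of \<psi> \<psi>] by simp
    then have "(\<Sum>c\<in>C. Re (ip D (\<psi> c) (\<psi> c))) = 0" by (metis (no_types, lifting) Re_sum cnj_ip sum.cong zero_complex.sel(1))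
    then have "\<forall>c\<in>C. Re (ip D (\<psi> c) (\<psi> c)) = 0" using CW(2)
      by (subst (asm) sum_nonneg_eq_0_iff) (auto simp: ip_self_nonneg)
    then have z: "\<psi> c = 0" if "c \<in> C" for c
      using that CW \<psi> VF by (intro ip_self_eq_0) (auto simp: complex_eq_iff equivariant_def)
    obtain f where f: "f \<in> W" "\<psi> f \<noteq> 0" using ex by blast
    have "f = (\<Sum>c\<in>C. ip D f c *c c)" using proj_eq[OF C f(1) WF] by (simp add: proj_def)
    then have "\<psi> f = (\<Sum>c\<in>C. ip D f c *c \<psi> c)"
      using equivariant_sum[OF \<psi> inv_subD(1)[OF W], of C "\<lambda>c. c" "ip D f"] CW by (simp add: subset_iff)
    then show False using f z by simp
  qed
  have KF: "K \<psi> \<in> Fn (D \<times> D)" if "equivariant W V \<psi>" for \<psi>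
    using K_span[OF that] sub_span[of F "D \<times> D"] orthF by (auto simp: sub_def orthonormal_def)
  obtain a where a: "a \<noteq> 0" "ip (D \<times> D) (a *c K \<phi>) (a *c K \<phi>) = 1"
    using sq.normalize[OF KF[OF \<phi>] K_nz[OF \<phi> nz(1)]] .
  obtain a' where a': "a' \<noteq> 0" "ip (D \<times> D) (a' *c K \<phi>') (a' *c K \<phi>') = 1"
    using sq.normalize[OF KF[OF \<phi>'] K_nz[OF \<phi>' nz(2)]] .
  have "ip D (\<phi> c) (\<phi>' c) = 0" if "c \<in> C" for c using orth that CW(1) by blast
  then have K0: "ip (D \<times> D) (K \<phi>) (K \<phi>') = 0" by (simp add: ipK)
  then have K0': "ip (D \<times> D) (K \<phi>') (K \<phi>) = 0" by (metis cnj_ip complex_cnj_zero)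
  define KK where "KK = {a *c K \<phi>, a' *c K \<phi>'}"
  have ne: "a *c K \<phi> \<noteq> a' *c K \<phi>'"
    using a(2) K0 by (metis ip_scale_left ip_scale_right mult_zero_right zero_neq_one)
  have "orthonormal (D \<times> D) KK"
    using a a' K0 K0' ne KF[OF \<phi>] KF[OF \<phi>'] cf.subspace_scale[OF sub_Fn]
    unfolding orthonormal_def KK_def by (auto simp: ip_scale_left ip_scale_right)
  moreover have "KK \<subseteq> cf.span F" using K_span \<phi> \<phi>' by (auto simp: KK_def cf.span_scale)
  moreover have "sq.T g k = k" if "g \<in> carrier G" "k \<in> KK" for g k
    using kernel_invariant[OF W C \<phi> that(1)] kernel_invariant[OF W C \<phi>' that(1)] that(2)
    by (auto simp: KK_def K_def sq.T_scale)
  ultimately have "Re (\<Sum>f\<in>F. ip (D \<times> D) (sq.avg f) f) \<ge> card KK"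
    by (intro sq.trace_avg_ge finF orthF) (auto simp: KK_def)
  moreover have "card KK = 2" using ne by (simp add: KK_def)
  \<comment> \<open>The trace of the averaging projection, computed from its definition: the
    diagonal entry of \<open>g\<close> at \<open>tens c b\<close> is the one at \<open>c\<close>
    times the conjugate of the one at \<open>b\<close>.\<close>
  moreover have "(\<Sum>f\<in>F. ip (D \<times> D) (sq.avg f) f) =
    1 / of_nat (card (carrier G)) * (\<Sum>g\<in>carrier G. chr C g * cnj (chr B g))"
  proof -
    have "(\<Sum>f\<in>F. ip (D \<times> D) (sq.avg f) f) = (\<Sum>p\<in>C \<times> B. ip (D \<times> D) (sq.avg (tens (fst p) (snd p))) (tens (fst p) (snd p)))"
      unfolding F_def using inj by (subst sum.reindex) (auto simp: case_prod_beta)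
    also have "\<dots> = (\<Sum>p\<in>C \<times> B. 1 / of_nat (card (carrier G)) * (\<Sum>g\<in>carrier G. ip D (T g (fst p)) (fst p) * cnj (ip D (T g (snd p)) (snd p))))"
      by (simp add: sq.avg_def ip_scale_left ip_sum_left T_tens ip_tens)
    also have "\<dots> = 1 / of_nat (card (carrier G)) * (\<Sum>p\<in>C \<times> B. \<Sum>g\<in>carrier G. ip D (T g (fst p)) (fst p) * cnj (ip D (T g (snd p)) (snd p)))"
      by (simp only: sum_distrib_left)
    also have "(\<Sum>p\<in>C \<times> B. \<Sum>g\<in>carrier G. ip D (T g (fst p)) (fst p) * cnj (ip D (T g (snd p)) (snd p)))
      = (\<Sum>g\<in>carrier G. \<Sum>p\<in>C \<times> B. ip D (T g (fst p)) (fst p) * cnj (ip D (T g (snd p)) (snd p)))"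
      by (rule sum.swap)
    also have "\<dots> = (\<Sum>g\<in>carrier G. chr C g * cnj (chr B g))"
      unfolding chr_def cnj_sum sum_product sum.cartesian_product
      by (intro sum.cong refl) (simp add: case_prod_beta)
    finally show ?thesis .
  qed
  ultimately have "2 \<le> Re (1 / of_nat (card (carrier G)) * (\<Sum>g\<in>carrier G. chr C g * cnj (chr B g)))"
    by simp
  also have "\<dots> = Re (\<Sum>g\<in>carrier G. chr C g * cnj (chr B g)) / card (carrier G)"
    by (simp add: Re_divide_of_nat)
  finally show ?thesis using card_G_pos by (simp add: field_simps)
qed

end

section \<open>Cyclic submodules and repeated constituents\<close>

lemma proj_add: "proj D B (f + h) = proj D B f + proj D B h"
  unfolding proj_def ip_add_left cf.scale_left_distrib sum.distrib ..

lemma proj_scale: "proj D B (c *c f) = c *c proj D B f"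
  unfolding proj_def ip_scale_left cf.scale_sum_right cf.scale_scale ..

context perm_rep begin

lemma dim_le_card_D: "sub D S \<Longrightarrow> cf.dim S \<le> card D"
proof -
  assume S: "sub D S"
  obtain B where B: "onb D B S" using onb_exists[OF S] .
  have "card B \<le> card D"
    using B independent_bound[of B] orthonormal_independent[of B] by (auto simp: onb_def orthonormal_def)
  then show ?thesis using onb_dim[OF B] by simp
qed

text \<open>A member of least dimension is minimal. The predicate is left free because two are used:
  being nonzero, and containing a nonzero vector of a given eigenspace.\<close>

lemma inv_sub_minimal:
  assumes "inv_sub S" "P S"
  obtains W where "inv_sub W" "P W" "W \<subseteq> S" "\<And>Y. inv_sub Y \<Longrightarrow> P Y \<Longrightarrow> Y \<subseteq> W \<Longrightarrow> Y = W"
proof -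
  let ?Q = "\<lambda>W. inv_sub W \<and> P W \<and> W \<subseteq> S"
  obtain W where W: "?Q W" "\<And>Y. ?Q Y \<Longrightarrow> cf.dim W \<le> cf.dim Y"
    using ex_has_least_nat[of ?Q S cf.dim] assms by blast
  have "Y = W" if "inv_sub Y" "P Y" "Y \<subseteq> W" for Y
    using dim_psubset[of Y W] W that inv_subD(1) by (metis leD psubsetI subset_trans)
  with W(1) that show ?thesis by blast
qed

lemma exists_irr:
  assumes "inv_sub S" "S \<noteq> {0}"
  obtains W where "irr W" "W \<subseteq> S"
proof -
  obtain W where W: "inv_sub W" "W \<noteq> {0}" "W \<subseteq> S" "\<And>Y. inv_sub Y \<Longrightarrow> Y \<noteq> {0} \<Longrightarrow> Y \<subseteq> W \<Longrightarrow> Y = W"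
    using inv_sub_minimal[of S "\<lambda>Y. Y \<noteq> {0}"] assms by metis
  then have "irr W" unfolding irr_def by blast
  with W(3) that show ?thesis by blast
qed

text \<open>The cyclic submodule generated by \<open>v\<close>.\<close>

definition Z :: "('x \<Rightarrow> complex) \<Rightarrow> ('x \<Rightarrow> complex) set" where
  "Z v = cf.span ((\<lambda>g. T g v) ` carrier G)"

lemma inv_sub_Z: "inv_sub (Z v)"
  unfolding Z_def by (intro inv_sub_span) (auto simp: T_Fn T_mult[symmetric] intro!: cf.span_base)

lemma in_Z: "v \<in> Fn D \<Longrightarrow> v \<in> Z v"
  unfolding Z_def using T_one[of v] one_closed by (metis cf.span_base image_eqI)

lemma Z_subset: "inv_sub V \<Longrightarrow> v \<in> V \<Longrightarrow> Z v \<subseteq> V"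
  unfolding Z_def by (rule sub_span_subset) (auto simp: inv_sub_def)

text \<open>The residual of \<open>f\<close> stays orthogonal to the invariant subspace
  \<open>S\<close> under \<open>T g\<close>, because \<open>T (inv g)\<close> maps \<open>S\<close>
  into itself.\<close>

lemma T_proj:
  assumes B: "onb D B S" and S: "inv_sub S" and g: "g \<in> carrier G" and f: "f \<in> Fn D"
  shows "T g (proj D B f) = proj D B (T g f)"
proof -
  have BS: "finite B" "orthonormal D B" "B \<subseteq> S" "S \<subseteq> cf.span B" using B by (auto simp: onb_def)
  have SF: "S \<subseteq> Fn D" using S by (rule inv_subD)
  have pS: "proj D B f \<in> S" using proj_in_span sub_span_subset[OF inv_subD(1)[OF S] BS(3)] by blast
  have Tp: "T g (proj D B f) \<in> S" using inv_subD(2)[OF S g pS] .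
  let ?r = "f - proj D B f"
  have rF: "?r \<in> Fn D" using f pS SF cf.subspace_diff[OF sub_Fn] by blast
  have "ip D (T g ?r) b = 0" if b: "b \<in> B" for b
  proof -
    have "T (inv g) b \<in> cf.span B" using inv_subD(2)[OF S, of "inv g" b] g b BS by auto
    then have "ip D ?r (T (inv g) b) = 0" by (rule residual_orth[OF BS(1,2)])
    then show ?thesis using ip_T_left[OF g rF] b BS(3) SF by (metis subsetD)
  qed
  then have "proj D B (T g ?r) = 0" by (simp add: proj_def)
  moreover have "proj D B (T g (proj D B f + ?r)) = proj D B (T g (proj D B f)) + proj D B (T g ?r)"
    unfolding T_add proj_add ..
  moreover have "proj D B f + ?r = f" using diff_add_cancel[of f "proj D B f"] by (simp only: add.commute)
  ultimately show ?thesis using proj_eq[OF B Tp SF] by (simp only: add_0_right)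
qed

lemma sub_eigenspace: "inv_sub V \<Longrightarrow> sub D {v \<in> V. \<forall>a\<in>A. T a v = \<epsilon> a *c v}"
  by (auto simp: sub_def inv_sub_def cf.subspace_def T_add T_scale cf.scale_right_distrib mult.commute
      simp del: cscale_apply plus_fun_apply)

text \<open>Take \<open>v \<in> F\<close> with \<open>Z v\<close> as large as possible and \<open>w \<in> F\<close> generating an irreducible module
  \<open>Q'\<close> orthogonal to \<open>Z v\<close>. By maximality \<open>Z (v + w)\<close> meets \<open>Q'\<close> trivially, so it is the graph of
  a nonzero homomorphism, and the two coordinate projections of an irreducible submodule of
  that graph not contained in \<open>Z v\<close> are the intertwiners.\<close>
lemma repeated_constituent:
  fixes \<epsilon> :: "'a \<Rightarrow> complex"
  assumes V: "inv_sub V" and A: "A \<subseteq> carrier G" "\<And>a. a \<in> A \<Longrightarrow> inv a \<in> A" and R: "finite R" "R \<subseteq> carrier G"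
    and ARA: "\<And>g. g \<in> carrier G \<Longrightarrow> \<exists>a\<in>A. \<exists>r\<in>R. \<exists>a'\<in>A. g = a \<otimes> (r \<otimes> a')"
    and F: "F = {v \<in> V. \<forall>a\<in>A. T a v = \<epsilon> a *c v}" and less: "card R < cf.dim F"
  obtains W \<phi> \<phi>' where "irr W" "equivariant W V \<phi>" "equivariant W V \<phi>'"
    "\<And>f h. f \<in> W \<Longrightarrow> h \<in> W \<Longrightarrow> ip D (\<phi> f) (\<phi>' h) = 0" "\<exists>f\<in>W. \<phi> f \<noteq> 0" "\<exists>f\<in>W. \<phi>' f \<noteq> 0"
proof -
  have sF: "sub D F" unfolding F by (rule sub_eigenspace[OF V])
  have FV: "F \<subseteq> V" unfolding F by (rule Collect_restrict)
  have FD: "T a x = \<epsilon> a *c x" if "x \<in> F" "a \<in> A" for x a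
    using that unfolding F mem_Collect_eq by metis
  have VF: "V \<subseteq> Fn D" using inv_subD(3)[OF V] .
  have sV: "sub D V" using inv_subD(1)[OF V] .
  have "\<exists>v. v \<in> F \<and> (\<forall>u. u \<in> F \<longrightarrow> cf.dim (Z u) \<le> cf.dim (Z v))"
    by (rule ex_has_greatest_nat[where b = "card D + 1" and k = 0])
       (use sub_zero[OF sF] dim_le_card_D inv_subD(1)[OF inv_sub_Z] in \<open>auto simp: less_Suc_eq_le\<close>)
  then obtain v where v: "v \<in> F" "\<And>u. u \<in> F \<Longrightarrow> cf.dim (Z u) \<le> cf.dim (Z v)" by blast
  have ZV: "Z v \<subseteq> V" using Z_subset[OF V] v(1) FV by blast
  have "card ((\<lambda>r. T r v) ` R) < cf.dim F" using le_less_trans[OF card_image_le[OF R(1)] less] .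
  moreover have "(\<lambda>r. T r v) ` R \<subseteq> Fn D" by (rule image_subsetI, rule T_Fn)
  ultimately obtain w0 where w0: "w0 \<in> F" "w0 \<noteq> 0" "\<And>y. y \<in> (\<lambda>r. T r v) ` R \<Longrightarrow> ip D w0 y = 0"
    using exists_orthogonal[OF sF finite_imageI[OF R(1)]] by metis
  \<comment> \<open>Write \<open>g\<close> in double coset form. The right factor acts on
    \<open>v\<close> by a scalar, and the left factor, moved across the inner product, acts on
    \<open>w0\<close> by a scalar; only \<open>T r v\<close> remains.\<close>
  have w0T: "ip D w0 (T g v) = 0" if g: "g \<in> carrier G" for g
  proof -
    obtain a r a' where ara: "a \<in> A" "r \<in> R" "a' \<in> A" "g = a \<otimes> (r \<otimes> a')" using ARA[OF g] by blast
    have c: "a \<in> carrier G" "r \<in> carrier G" "a' \<in> carrier G"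
      using subsetD[OF A(1) ara(1)] subsetD[OF R(2) ara(2)] subsetD[OF A(1) ara(3)] .
    have wF: "w0 \<in> Fn D" using subsetD[OF VF subsetD[OF FV w0(1)]] .
    have "ip D (T g v) w0 = ip D (T a (T r (T a' v))) w0" unfolding ara(4) using c by (simp only: T_mult m_closed)
    also have "\<dots> = ip D (T r (T a' v)) (T (inv a) w0)" by (rule ip_T_left[OF c(1) T_Fn wF])
    also have "\<dots> = 0"
      unfolding FD[OF w0(1) A(2)[OF ara(1)]] FD[OF v(1) ara(3)] T_scale ip_scale_left ip_scale_right
      using w0(3)[OF imageI[OF ara(2)]] cnj_ip[of D w0 "T r v"] by simp
    finally show ?thesis using cnj_ip[of D "T g v" w0] by simp
  qed
  have w0y: "ip D w0 y = 0" if "y \<in> (\<lambda>g. T g v) ` carrier G" for y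
    using that by (rule imageE) (simp only: w0T)
  have w0z: "ip D w0 z = 0" if "z \<in> Z v" for z
    using w0y that unfolding Z_def by (rule ip_eq_0_span)
  have w0Q: "w0 \<in> perp D (Z v) V" unfolding perp_def
    by (intro CollectI conjI ballI w0z subsetD[OF FV w0(1)])
  define Q where "Q = perp D (Z v) V"
  have Q: "inv_sub Q" unfolding Q_def by (rule inv_sub_perp[OF inv_sub_Z V])
  obtain Q' where Q': "inv_sub Q'" "\<exists>x\<in>F \<inter> Q'. x \<noteq> 0" "Q' \<subseteq> Q"
    "\<And>Y. inv_sub Y \<Longrightarrow> \<exists>x\<in>F \<inter> Y. x \<noteq> 0 \<Longrightarrow> Y \<subseteq> Q' \<Longrightarrow> Y = Q'"
    using inv_sub_minimal[of Q "\<lambda>Y. \<exists>x\<in>F \<inter> Y. x \<noteq> 0"] Q w0(1,2) w0Q unfolding Q_def by (metis (no_types, lifting) IntI)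
  obtain w where w: "w \<in> F" "w \<in> Q'" "w \<noteq> 0" using Q'(2) by blast
  have Q'V: "Q' \<subseteq> V" using Q'(3) by (auto simp: Q_def perp_def)
  \<comment> \<open>If \<open>Q'\<close> split into \<open>Y\<close> and its complement, both
    components of \<open>w\<close> would again lie in \<open>F\<close>, while minimality of
    \<open>Q'\<close> leaves no nonzero vector of \<open>F\<close> in either piece.\<close>
  have irrQ': "Y = {0} \<or> Y = Q'" if Y: "inv_sub Y" "Y \<subseteq> Q'" for Y
  proof (rule ccontr)
    assume neg: "\<not> (Y = {0} \<or> Y = Q')"
    define Y' where "Y' = perp D Y Q'"
    have Y': "inv_sub Y'" "Y' \<subseteq> Q'" unfolding Y'_def using inv_sub_perp[OF Y(1) Q'(1)] by (auto simp: perp_def)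
    have "Y' \<noteq> Q'"
    proof
      assume "Y' = Q'"
      then have "y = 0" if "y \<in> Y" for y
        using perp_Int[OF inv_subD(1)[OF Y(1)] that, of Q'] that Y(2) by (auto simp: Y'_def)
      then show False using neg sub_zero[OF inv_subD(1)[OF Y(1)]] by auto
    qed
    then have no: "x = 0" if "x \<in> F" "x \<in> Y \<or> x \<in> Y'" for x
      using Q'(4)[OF Y(1) _ Y(2)] Q'(4)[OF Y'(1) _ Y'(2)] neg that by blast
    obtain s t where st: "w = s + t" "s \<in> Y" "t \<in> Y'"
      using orth_decomp[OF inv_subD(1)[OF Y(1)] inv_subD(1)[OF Q'(1)] Y(2) w(2)] unfolding Y'_def by metis
    have "T a s = \<epsilon> a *c s \<and> T a t = \<epsilon> a *c t" if a: "a \<in> A" for a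
    proof -
      have ac: "a \<in> carrier G" using a A by blast
      have "T a s + T a t = \<epsilon> a *c s + \<epsilon> a *c t"
        using w(1) a unfolding F st(1) by (simp only: T_add cf.scale_right_distrib mem_Collect_eq)
      \<comment> \<open>Regrouped so that the left side lies in \<open>Y\<close> and the right side
        in its orthogonal complement; both therefore vanish.\<close>
      then have eq: "T a s - \<epsilon> a *c s = \<epsilon> a *c t - T a t" by (metis add_diff_cancel_left' add_diff_eq diff_add_cancel diff_diff_eq2)
      have "T a s - \<epsilon> a *c s \<in> Y"
        using inv_subD(2)[OF Y(1) ac st(2)] st(2) inv_subD(1)[OF Y(1)] by (simp only: sub_diff sub_scale)
      moreover have "\<epsilon> a *c t - T a t \<in> Y'"
        using inv_subD(2)[OF Y'(1) ac st(3)] st(3) inv_subD(1)[OF Y'(1)] by (simp only: sub_diff sub_scale)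
      ultimately have "T a s - \<epsilon> a *c s = 0"
        using perp_Int[OF inv_subD(1)[OF Y(1)]] eq unfolding Y'_def by metis
      with eq show ?thesis by (simp only: right_minus_eq) (metis right_minus_eq)
    qed
    then have "s \<in> F" "t \<in> F" using st Y Y' Q'V by (auto simp: F)
    then show False using no st w(3) by (metis add_0_right)
  qed
  have zeroQ': "0 \<in> Q'" using sub_zero[OF inv_subD(1)[OF Q'(1)]] .
  define U where "U = Z (v + w)"
  have U: "inv_sub U" unfolding U_def by (rule inv_sub_Z)
  have vwF: "v + w \<in> F" using sub_add[OF sF v(1) w(1)] .
  have UV: "U \<subseteq> V" unfolding U_def using Z_subset[OF V] vwF FV by blast
  have vwU: "v + w \<in> U" unfolding U_def using in_Z vwF FV VF by blast
  have vZ: "v \<in> Z v" using in_Z v(1) FV VF by blast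
  have "U \<subseteq> {x + y |x y. x \<in> Z v \<and> y \<in> Q'}"
    unfolding U_def Z_def[of "v + w"]
  proof (rule cf.span_minimal)
    show "cf.subspace {x + y |x y. x \<in> Z v \<and> y \<in> Q'}"
      using inv_subD(1)[OF inv_sub_Z] inv_subD(1)[OF Q'(1)] by (intro cf.subspace_sums) (auto simp: sub_def)
    show "(\<lambda>g. T g (v + w)) ` carrier G \<subseteq> {x + y |x y. x \<in> Z v \<and> y \<in> Q'}"
      unfolding T_add using inv_subD(2)[OF inv_sub_Z _ vZ] inv_subD(2)[OF Q'(1) _ w(2)] by blast
  qed
  then have Usum: "\<exists>x\<in>Z v. \<exists>y\<in>Q'. u = x + y" if "u \<in> U" for u using that by blast
  have wperp: "w \<in> perp D (Z v) V" using w(2) Q'(3) by (auto simp: Q_def)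
  have wZ: "w \<notin> Z v" using perp_Int[OF inv_subD(1)[OF inv_sub_Z] _ wperp] w(3) by blast
  \<comment> \<open>Here the choice of \<open>v\<close> enters: if \<open>U\<close> met the
    irreducible \<open>Q'\<close>, it would contain \<open>Q'\<close>, hence \<open>w\<close> and
    \<open>v\<close>, and would be strictly larger than \<open>Z v\<close>.\<close>
  have UQ': "U \<inter> Q' = {0}"
  proof (rule ccontr)
    assume "U \<inter> Q' \<noteq> {0}"
    then have "Q' \<subseteq> U" using irrQ'[OF inv_sub_Int[OF U Q'(1)]] by auto
    then have wU: "w \<in> U" using w(2) by blast
    then have "v \<in> U" using sub_diff[OF inv_subD(1)[OF U] vwU wU] by (simp only: add_diff_cancel_right')
    then have "Z v \<subset> U" using Z_subset[OF U] wU wZ by blast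
    then have "cf.dim (Z v) < cf.dim U" by (intro dim_psubset inv_subD(1) inv_sub_Z U)
    then show False using v(2)[OF vwF] by (simp add: U_def)
  qed
  \<comment> \<open>An irreducible \<open>W\<close> inside \<open>U0\<close> meets
    \<open>Z v\<close> only in 0, so the residual of the projection to \<open>Z v\<close> is nonzero
    on it. \<open>U0\<close> itself is nonzero because \<open>v + w\<close> lies outside
    \<open>Z v\<close>.\<close>
  define U0 where "U0 = perp D (U \<inter> Z v) U"
  have UZ: "inv_sub (U \<inter> Z v)" by (intro inv_sub_Int U inv_sub_Z)
  have U0: "inv_sub U0" unfolding U0_def by (rule inv_sub_perp[OF UZ U])
  have "U0 \<noteq> {0}"
  proof
    assume U00: "U0 = {0}"
    obtain s t where "v + w = s + t" "s \<in> U \<inter> Z v" "t \<in> U0"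
      using orth_decomp[OF inv_subD(1)[OF UZ] inv_subD(1)[OF U] Int_lower1 vwU] unfolding U0_def by metis
    then have "v + w \<in> Z v" using U00 by (metis IntD2 add_0_right singletonD)
    from sub_diff[OF inv_subD(1)[OF inv_sub_Z] this vZ] show False using wZ by (simp only: add_diff_cancel_left')
  qed
  then obtain W where W: "irr W" "W \<subseteq> U0" using exists_irr[OF U0] by blast
  have WU: "W \<subseteq> U" using W(2) by (auto simp: U0_def perp_def)
  have iW: "inv_sub W" using W(1) by (simp add: irr_def)
  obtain u where u: "u \<in> W" "u \<noteq> 0" using W(1) sub_zero[OF inv_subD(1)[OF iW]] by (auto simp: irr_def)
  have uZ: "u \<notin> Z v"
  proof
    assume "u \<in> Z v"
    then have "u \<in> U \<inter> Z v" using u(1) WU by blast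
    then have "u = 0" using perp_Int[OF inv_subD(1)[OF UZ], of u U] u(1) W(2) by (auto simp: U0_def)
    then show False using u(2) by blast
  qed
  obtain B where B: "onb D B (Z v)" using onb_exists[OF inv_subD(1)[OF inv_sub_Z]] .
  have BB: "finite B" "orthonormal D B" "B \<subseteq> Z v" "Z v \<subseteq> cf.span B" using B by (auto simp: onb_def)
  have WF: "W \<subseteq> Fn D" using inv_subD(3)[OF iW] .
  have pZ: "proj D B f \<in> Z v" for f using proj_in_span sub_span_subset[OF inv_subD(1)[OF inv_sub_Z] BB(3)] by blast
  have e1: "equivariant W V (proj D B)"
    unfolding equivariant_def
  proof (intro conjI ballI allI proj_add proj_scale)
    show "proj D B f \<in> V" for f using pZ ZV by blast
    show "proj D B (T g f) = T g (proj D B f)" if "g \<in> carrier G" "f \<in> W" for g f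
      using T_proj[OF B inv_sub_Z that(1) subsetD[OF WF that(2)]] by (rule sym)
  qed
  have e2: "equivariant W V (\<lambda>f. f - proj D B f)"
    unfolding equivariant_def
  proof (intro conjI ballI allI)
    show "f - proj D B f \<in> V" if "f \<in> W" for f using that WU UV pZ ZV sub_diff[OF sV] by blast
    show "f + h - proj D B (f + h) = f - proj D B f + (h - proj D B h)" for f h
      by (simp only: proj_add add_diff_add)
    show "c *c f - proj D B (c *c f) = c *c (f - proj D B f)" for c f
      by (simp only: proj_scale cf.scale_right_diff_distrib)
    show "T g f - proj D B (T g f) = T g (f - proj D B f)" if "g \<in> carrier G" "f \<in> W" for g f
      unfolding T_diff T_proj[OF B inv_sub_Z that(1) subsetD[OF WF that(2)]] ..
  qed
  have orth: "ip D (proj D B f) (h - proj D B h) = 0" for f h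
    using residual_orth[OF BB(1,2) proj_in_span] by (metis cnj_ip complex_cnj_zero)
  have "u - proj D B u \<noteq> 0" using uZ pZ[of u] by (metis right_minus_eq)
  \<comment> \<open>If the projection vanished, \<open>u\<close> would equal its component in
    \<open>Q'\<close> and lie in \<open>U \<inter> Q'\<close>, which is zero.\<close>
  moreover have "proj D B u \<noteq> 0"
  proof
    assume p0: "proj D B u = 0"
    obtain x y where xy: "x \<in> Z v" "y \<in> Q'" "u = x + y" using Usum u(1) WU by blast
    have "proj D B y = 0"
    proof -
      have "ip D y b = 0" if "b \<in> B" for b using xy(2) Q'(3) that BB(3) by (auto simp: Q_def perp_def)
      then show ?thesis by (simp add: proj_def)
    qed
    moreover have "proj D B x = x" using proj_eq[OF B xy(1) inv_subD(3)[OF inv_sub_Z]] .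
    ultimately have "x = 0" using p0 xy(3) proj_add by (metis add_0_right)
    then have "u \<in> U \<inter> Q'" using xy u(1) WU by (metis IntI add_0_left subsetD)
    then show False using UQ' u(2) by blast
  qed
  ultimately show ?thesis using that[OF W(1) e1 e2] orth u(1) by blast
qed

end

section \<open>Simultaneous eigenspaces of an elementary abelian 2-group\<close>

context fin_supp begin

lemma dim_mono: "sub D S \<Longrightarrow> sub D S' \<Longrightarrow> S \<subseteq> S' \<Longrightarrow> cf.dim S \<le> cf.dim S'"
  using dim_psubset[of S S'] by (metis less_imp_le order_refl psubsetI)

end

context perm_rep begin

text \<open>Adjoining an involution doubles the subgroup and at worst halves the best eigenspace.\<close>
lemma eigenspace_bound:
  assumes V: "inv_sub V" and A: "subgroup A G" and sq1: "\<And>a. a \<in> A \<Longrightarrow> a \<otimes> a = \<one>"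
  obtains \<epsilon> :: "'a \<Rightarrow> complex" where "cf.dim V \<le> card A * cf.dim {v \<in> V. \<forall>a\<in>A. T a v = \<epsilon> a *c v}"
proof -
  have sV: "sub D V" using inv_subD(1)[OF V] .
  have VF: "V \<subseteq> Fn D" using inv_subD(3)[OF V] .
  have AG: "A \<subseteq> carrier G" using A by (rule subgroup.subset)
  have finA: "finite A" using finite_subset[OF AG fin_G] .
  have invA: "inv a = a" if "a \<in> A" for a using that sq1 AG by (simp add: inv_equality subsetD)
  have commA: "a \<otimes> b = b \<otimes> a" if ab: "a \<in> A" "b \<in> A" for a b
  proof -
    have "a \<otimes> b = inv (a \<otimes> b)" using invA[OF subgroup.m_closed[OF A ab]] by (rule sym)
    also have "\<dots> = inv b \<otimes> inv a" using ab AG by (simp add: inv_mult_group subsetD)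
    finally show ?thesis using ab invA by simp
  qed
  define E where "E B \<epsilon> = {v \<in> V. \<forall>a\<in>B. T a v = \<epsilon> a *c v}" for B and \<epsilon> :: "'a \<Rightarrow> complex"
  have sE: "sub D (E B \<epsilon>)" for B \<epsilon> unfolding E_def by (rule sub_eigenspace[OF V])
  \<comment> \<open>The subgroups of \<open>A\<close> for which the bound is already established;
    one of largest order is shown to be \<open>A\<close> itself.\<close>
  define Good where "Good B \<longleftrightarrow> subgroup B G \<and> B \<subseteq> A \<and> (\<exists>\<epsilon>. cf.dim V \<le> card B * cf.dim (E B \<epsilon>))" for B
  have "E {\<one>} (\<lambda>_. 1) = V"
    using VF by (auto simp: E_def T_one subsetD)
  then have "cf.dim V \<le> card {\<one>} * cf.dim (E {\<one>} (\<lambda>_. 1))" by simp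
  moreover have "{\<one>} \<subseteq> A" using subgroup.one_closed[OF A] by simp
  ultimately have G1: "Good {\<one>}" unfolding Good_def by (intro conjI exI[of _ "\<lambda>_. 1"] triv_subgroup)
  have bound: "\<forall>B. Good B \<longrightarrow> card B < Suc (card A)"
    using card_mono[OF finA] by (simp add: Good_def less_Suc_eq_le)
  from ex_has_greatest_nat[OF G1 bound]
  obtain B where B: "Good B" "\<And>C. Good C \<Longrightarrow> card C \<le> card B" by metis
  have BG: "subgroup B G" and BA: "B \<subseteq> A" using B(1) by (simp_all add: Good_def)
  obtain \<epsilon> where \<epsilon>: "cf.dim V \<le> card B * cf.dim (E B \<epsilon>)" using B(1) unfolding Good_def by metis
  have "B = A"
  proof (rule ccontr)
    assume "B \<noteq> A"
    then obtain a where a: "a \<in> A" "a \<notin> B" using BA by blast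
    have aG: "a \<in> carrier G" using a AG by blast
    have BGc: "b \<in> carrier G" if "b \<in> B" for b using that BA AG by blast
    have aa: "a \<otimes> (a \<otimes> b) = b" if "b \<in> carrier G" for b
      using that aG sq1[OF a(1)] by (simp add: m_assoc[symmetric])
    \<comment> \<open>The subgroup generated by \<open>B\<close> and \<open>a\<close>. It has twice
      the order of \<open>B\<close>, since \<open>a\<close> lies outside \<open>B\<close>, commutes
      with it and squares to one.\<close>
    define B' where "B' = B \<union> (\<lambda>b. a \<otimes> b) ` B"
    have abB: "a \<otimes> b \<notin> B" if b: "b \<in> B" for b
    proof
      assume "a \<otimes> b \<in> B"
      then have "(a \<otimes> b) \<otimes> b \<in> B" using b BG by (simp add: subgroup.m_closed)
      moreover have "(a \<otimes> b) \<otimes> b = a" using sq1 b BA aG BGc[OF b] by (simp add: m_assoc subsetD)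
      ultimately show False using a(2) by simp
    qed
    have finB: "finite B" using finite_subset[OF BA finA] .
    have "inj_on (\<lambda>b. a \<otimes> b) B" using aG BGc by (auto simp: inj_on_def)
    then have cardB': "card B' = 2 * card B"
      unfolding B'_def using finB abB by (subst card_Un_disjoint) (auto simp: card_image)
    have B'A: "B' \<subseteq> A" unfolding B'_def using BA a(1) subgroup.m_closed[OF A] by auto
    have "subgroup B' G"
    proof (rule subgroupI)
      show "B' \<subseteq> carrier G" using B'A AG by blast
      show "B' \<noteq> {}" using subgroup.one_closed[OF BG] by (auto simp: B'_def)
      show "inv x \<in> B'" if "x \<in> B'" for x using that invA B'A by (simp add: subsetD)
      fix x y assume xy: "x \<in> B'" "y \<in> B'"
      obtain b i where x: "b \<in> B" "x = b \<or> x = a \<otimes> b" using xy(1) by (auto simp: B'_def)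
      obtain c where y: "c \<in> B" "y = c \<or> y = a \<otimes> c" using xy(2) by (auto simp: B'_def)
      have bc: "b \<otimes> c \<in> B" using x y BG by (simp add: subgroup.m_closed)
      have G: "b \<in> carrier G" "c \<in> carrier G" using x y BGc by auto
      have ba: "b \<otimes> a = a \<otimes> b" by (rule commA[OF subsetD[OF BA x(1)] a(1)])
      have 1: "b \<otimes> (a \<otimes> c) = a \<otimes> (b \<otimes> c)"
        unfolding m_assoc[OF G(1) aG G(2), symmetric] ba by (rule m_assoc[OF aG G])
      moreover have "(a \<otimes> b) \<otimes> c = a \<otimes> (b \<otimes> c)" by (rule m_assoc[OF aG G])
      moreover have "(a \<otimes> b) \<otimes> (a \<otimes> c) = b \<otimes> c"
        unfolding m_assoc[OF aG G(1) m_closed[OF aG G(2)]] 1 by (rule aa[OF m_closed[OF G]])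
      ultimately show "x \<otimes> y \<in> B'" using x y bc unfolding B'_def by auto
    qed
    define P where "P c = {v \<in> E B \<epsilon>. T a v = c *c v}" for c
    have sP: "sub D (P c)" for c
    proof -
      have "P c = E B \<epsilon> \<inter> {v \<in> V. \<forall>x\<in>{a}. T x v = (\<lambda>_. c) x *c v}"
        by (intro equalityI subsetI) (simp_all add: P_def E_def del: cscale_apply)
      then show ?thesis by (simp only: sub_Int[OF sE sub_eigenspace[OF V]])
    qed
    have "cf.dim (E B \<epsilon>) \<le> cf.dim (P 1) + cf.dim (P (-1))"
    proof (rule dim_le_add[OF sP sP])
      fix f assume f: "f \<in> E B \<epsilon>"
      have fV: "f \<in> V" and fB: "\<And>b. b \<in> B \<Longrightarrow> T b f = \<epsilon> b *c f" using f by (simp_all add: E_def)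
      have TV: "T a f \<in> V" using inv_subD(2)[OF V aG fV] .
      have "T b (T a f) = \<epsilon> b *c T a f" if b: "b \<in> B" for b
      proof -
        have "T b (T a f) = T (b \<otimes> a) f" using T_mult[OF BGc[OF b] aG] by (rule sym)
        also have "b \<otimes> a = a \<otimes> b" using commA b BA a(1) by blast
        also have "T (a \<otimes> b) f = T a (T b f)" using T_mult[OF aG BGc[OF b]] .
        finally show ?thesis unfolding fB[OF b] T_scale .
      qed
      with TV have TE: "T a f \<in> E B \<epsilon>" unfolding E_def by simp
      have TT: "T a (T a f) = f"
      proof -
        have "T a (T a f) = T (a \<otimes> a) f" using T_mult[OF aG aG] by (rule sym)
        then show ?thesis using sq1[OF a(1)] T_one[of f] VF fV by (simp add: subsetD)
      qed
      \<comment> \<open>On \<open>V\<close> the operator \<open>T a\<close> squares to the identity,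
        so these are the components of \<open>f\<close> for the eigenvalues 1 and -1.\<close>
      let ?s = "(1/2) *c (f + T a f)" and ?t = "(1/2) *c (f - T a f)"
      have s1: "?s \<in> P 1" unfolding P_def mem_Collect_eq T_scale T_add TT
        using sub_scale[OF sE sub_add[OF sE f TE]] by (simp only: add.commute cf.scale_one)
      have t1: "?t \<in> P (-1)"
      proof -
        have "T a ?t = (-1) *c ?t" unfolding T_scale T_diff TT by (simp add: fun_eq_iff cscale_def)
        then show ?thesis unfolding P_def mem_Collect_eq using sub_scale[OF sE sub_diff[OF sE f TE], of "1/2"] by metis
      qed
      have "f = ?s + ?t" by (rule ext) (simp add: cscale_def algebra_simps)
      then show "\<exists>s\<in>P 1. \<exists>t\<in>P (-1). f = s + t" by (rule bexI[OF bexI[OF _ t1] s1])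
    qed
    then have "cf.dim (E B \<epsilon>) \<le> 2 * cf.dim (P 1) \<or> cf.dim (E B \<epsilon>) \<le> 2 * cf.dim (P (-1))"
      by linarith
    then obtain c where c: "cf.dim (E B \<epsilon>) \<le> 2 * cf.dim (P c)" by (elim disjE)
    \<comment> \<open>For \<open>x = a \<otimes> b\<close> outside \<open>B\<close>, the argument
      \<open>a \<otimes> x\<close> recovers \<open>b\<close>.\<close>
    define \<epsilon>' where "\<epsilon>' x = (if x \<in> B then \<epsilon> x else c * \<epsilon> (a \<otimes> x))" for x
    have "P c \<subseteq> E B' \<epsilon>'"
    proof
      fix v assume v: "v \<in> P c"
      have vV: "v \<in> V" and vB: "\<And>b. b \<in> B \<Longrightarrow> T b v = \<epsilon> b *c v" and va: "T a v = c *c v"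
        using v by (simp_all add: P_def E_def)
      have "T x v = \<epsilon>' x *c v" if "x \<in> B'" for x
      proof (cases "x \<in> B")
        case True then show ?thesis using vB by (simp add: \<epsilon>'_def)
      next
        case False
        then obtain b where b: "b \<in> B" "x = a \<otimes> b" using \<open>x \<in> B'\<close> by (auto simp: B'_def)
        have "T x v = T a (T b v)" unfolding b(2) by (rule T_mult[OF aG BGc[OF b(1)]])
        also have "\<dots> = (\<epsilon> b * c) *c v" unfolding vB[OF b(1)] T_scale va cf.scale_scale ..
        finally show ?thesis using False aa[OF BGc[OF b(1)]] b by (simp add: \<epsilon>'_def mult.commute)
      qed
      then show "v \<in> E B' \<epsilon>'" using vV by (simp add: E_def)
    qed
    from dim_mono[OF sP sE this] have "cf.dim (P c) \<le> cf.dim (E B' \<epsilon>')" .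
    then have "2 * cf.dim (P c) \<le> 2 * cf.dim (E B' \<epsilon>')" by (rule mult_le_mono2)
    from order_trans[OF \<epsilon> mult_le_mono2[OF order_trans[OF c this]]]
    have "cf.dim V \<le> card B' * cf.dim (E B' \<epsilon>')" unfolding cardB' by (simp only: mult.assoc mult.left_commute)
    then have "Good B'" unfolding Good_def by (intro conjI exI[of _ \<epsilon>'] \<open>subgroup B' G\<close> B'A)
    from B(2)[OF this] have "card B = 0" unfolding cardB' by simp
    then show False using finB subgroup.one_closed[OF BG] by auto
  qed
  from \<epsilon>[unfolded this E_def] show ?thesis by (rule that)
qed

section \<open>Restriction to a subgroup and the degree bound\<close>

lemma subrep:
  assumes "subgroup H G" shows "perm_rep (G\<lparr>carrier := H\<rparr>) D act"
proof -
  interpret H: group "G\<lparr>carrier := H\<rparr>" by (rule subgroup_imp_group[OF assms])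
  show ?thesis
    using finite_subset[OF subgroup.subset[OF assms] fin_G] subgroup.subset[OF assms] finX
    by unfold_locales (auto simp: act_closed act_one act_mult subsetD)
qed

lemma subrep_T:
  assumes "subgroup H G" "h \<in> H" shows "perm_rep.T (G\<lparr>carrier := H\<rparr>) D act h f = T h f"
  unfolding perm_rep.T_def[OF subrep[OF assms(1)]] T_def m_inv_consistent[OF assms] ..

text \<open>\<open>V\<close> remains a space of functions on the same \<open>D\<close>, now under
  the action of \<open>H\<close>. The character of the constituent \<open>W\<close> that occurs
  twice is the \<open>\<psi>\<close> violating the strong Gelfand condition.\<close>

lemma dim_irr_le:
  assumes V: "irr V" and H: "subgroup H G" and sg: "strong_Gelfand_pair G H"
    and A: "subgroup A G" "A \<subseteq> H" "\<And>a. a \<in> A \<Longrightarrow> a \<otimes> a = \<one>" and R: "finite R" "R \<subseteq> H"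
    and ARA: "\<And>g. g \<in> H \<Longrightarrow> \<exists>a\<in>A. \<exists>r\<in>R. \<exists>a'\<in>A. g = a \<otimes> (r \<otimes> a')"
  shows "cf.dim V \<le> card A * card R"
proof (rule ccontr)
  assume neg: "\<not> cf.dim V \<le> card A * card R"
  interpret h: perm_rep "G\<lparr>carrier := H\<rparr>" D act by (rule subrep[OF H])
  have hT: "h.T g f = T g f" if "g \<in> H" for g f using subrep_T[OF H that] .
  have HG: "H \<subseteq> carrier G" using H by (rule subgroup.subset)
  have iV: "inv_sub V" using V by (simp add: irr_def)
  have hV: "h.inv_sub V"
    unfolding h.inv_sub_def using inv_subD(1)[OF iV] inv_subD(2)[OF iV] HG hT by (simp add: subsetD)
  have AH: "subgroup A (G\<lparr>carrier := H\<rparr>)" by (rule subgroup_incl[OF A(1) H A(2)])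
  obtain \<epsilon> where \<epsilon>: "cf.dim V \<le> card A * cf.dim {v \<in> V. \<forall>a\<in>A. h.T a v = \<epsilon> a *c v}"
    using h.eigenspace_bound[OF hV AH] A(3) by auto
  have "card R < cf.dim {v \<in> V. \<forall>a\<in>A. h.T a v = \<epsilon> a *c v}"
  proof (rule ccontr)
    assume "\<not> ?thesis"
    then have "cf.dim {v \<in> V. \<forall>a\<in>A. h.T a v = \<epsilon> a *c v} \<le> card R" by (simp only: not_less)
    from order_trans[OF \<epsilon> mult_le_mono2[OF this]] show False using neg by (rule notE[rotated])
  qed
  note large = this
  obtain W \<phi> \<phi>' where W: "h.irr W" "h.equivariant W V \<phi>" "h.equivariant W V \<phi>'"
    "\<And>f h. f \<in> W \<Longrightarrow> h \<in> W \<Longrightarrow> ip D (\<phi> f) (\<phi>' h) = 0" "\<exists>f\<in>W. \<phi> f \<noteq> 0" "\<exists>f\<in>W. \<phi>' f \<noteq> 0"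
  proof (rule h.repeated_constituent[OF hV _ _ R(1) _ _ refl large])
    show "A \<subseteq> carrier (G\<lparr>carrier := H\<rparr>)" "R \<subseteq> carrier (G\<lparr>carrier := H\<rparr>)" using A(2) R(2) by simp_all
    show "inv\<^bsub>G\<lparr>carrier := H\<rparr>\<^esub> a \<in> A" if "a \<in> A" for a using subgroup.m_inv_closed[OF AH that] .
    show "\<exists>a\<in>A. \<exists>r\<in>R. \<exists>a'\<in>A. g = a \<otimes>\<^bsub>G\<lparr>carrier := H\<rparr>\<^esub> (r \<otimes>\<^bsub>G\<lparr>carrier := H\<rparr>\<^esub> a')"
      if "g \<in> carrier (G\<lparr>carrier := H\<rparr>)" for g
      using ARA[of g] that by simp
  qed (rule that)
  have iW: "h.inv_sub W" using W(1) by (simp add: h.irr_def)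
  obtain C where C: "onb D C W" using onb_exists[OF h.inv_subD(1)[OF iW]] .
  obtain B where B: "onb D B V" using onb_exists[OF inv_subD(1)[OF iV]] .
  have ge2: "Re (\<Sum>g\<in>H. h.chr C g * cnj (h.chr B g)) \<ge> 2 * card H"
    using h.multiplicity_ge_2[OF iW C hV B W(2-6)] by simp
  define \<chi> where "\<chi> = restrict (chr B) (carrier G)"
  define \<psi> where "\<psi> = restrict (h.chr C) H"
  have \<chi>: "\<chi> \<in> irreducible_characters G" unfolding \<chi>_def by (rule irr_character[OF V B])
  have \<psi>: "\<psi> \<in> irreducible_characters (G\<lparr>carrier := H\<rparr>)"
    unfolding \<psi>_def using h.irr_character[OF W(1) C] by simp
  have le1: "char_inner (G\<lparr>carrier := H\<rparr>) \<psi> (restrict \<chi> H) \<le> 1"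
    using sg \<chi> \<psi> unfolding strong_Gelfand_pair_def by metis
  have "(\<Sum>g\<in>H. \<psi> g * cnj (restrict \<chi> H g)) = (\<Sum>g\<in>H. h.chr C g * cnj (h.chr B g))"
    using HG by (intro sum.cong refl) (simp add: \<psi>_def \<chi>_def h.chr_def chr_def hT subsetD)
  then have ci: "char_inner (G\<lparr>carrier := H\<rparr>) \<psi> (restrict \<chi> H) = (\<Sum>g\<in>H. h.chr C g * cnj (h.chr B g)) / of_nat (card H)"
    by (simp add: char_inner_def Coset.order_def)
  \<comment> \<open>The order on complex numbers compares real parts, and these suffice against
    \<open>ge2\<close>.\<close>
  have "Re (char_inner (G\<lparr>carrier := H\<rparr>) \<psi> (restrict \<chi> H)) \<le> 1"
    using le1 by (simp add: less_eq_complex_def)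
  then have "Re (\<Sum>g\<in>H. h.chr C g * cnj (h.chr B g)) / card H \<le> 1" unfolding ci Re_divide_of_nat .
  moreover have "card H > 0" using h.card_G_pos by simp
  ultimately show False using ge2 by (simp add: divide_le_eq)
qed

section \<open>Degrees of constituents and the rank of an action\<close>

lemma inv_sub_Fn: "inv_sub (Fn D)"
  by (simp add: inv_sub_def sub_def sub_Fn T_Fn)

lemma card_le_dim_Fn: "card D \<le> cf.dim (Fn D)"
proof -
  define \<delta> where "\<delta> x = (\<lambda>y. if y = x then 1 else 0 :: complex)" for x :: 'x
  have \<delta>: "ip D (\<delta> x) (\<delta> y) = (if x = y then 1 else 0)" if "x \<in> D" "y \<in> D" for x y
    using that finX by (simp add: ip_def \<delta>_def if_distrib cong: if_cong)
  have inj: "inj_on \<delta> D"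
  proof (rule inj_onI)
    fix x y assume "\<delta> x = \<delta> y"
    then have "\<delta> x x = \<delta> y x" by simp
    then show "x = y" by (simp add: \<delta>_def split: if_splits)
  qed
  have sub: "\<delta> ` D \<subseteq> Fn D" by (auto simp: \<delta>_def Fn_def)
  have "orthonormal D (\<delta> ` D)"
    unfolding orthonormal_def using sub inj by (auto simp: \<delta> inj_on_def)
  then have "cf.independent (\<delta> ` D)" by (rule orthonormal_independent)
  from independent_card_le_dim[OF inv_subD(1)[OF inv_sub_Fn] sub this]
  show ?thesis by (simp add: card_image[OF inj])
qed

text \<open>Every nonzero invariant subspace contains a nonzero function fixed by the stabilizer of the
  base point, so the number of irreducible constituents is at most the rank of the action.\<close>
lemma card_le_max_degree_mult_rank:
  assumes x0: "x0 \<in> D" and trans: "\<And>x. x \<in> D \<Longrightarrow> \<exists>g\<in>carrier G. act g x0 = x"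
    and I: "finite I" "i ` D \<subseteq> I"
    and orb: "\<And>x y. x \<in> D \<Longrightarrow> y \<in> D \<Longrightarrow> i x = i y \<Longrightarrow> \<exists>k\<in>carrier G. act k x0 = x0 \<and> act k x = y"
    and deg: "\<And>V. irr V \<Longrightarrow> cf.dim V \<le> d"
  shows "card D \<le> d * card I"
proof -
  define K where "K = {k \<in> carrier G. act k x0 = x0}"
  have K: "subgroup K G"
  proof (rule subgroupI)
    show "K \<subseteq> carrier G" "K \<noteq> {}" using x0 act_one by (auto simp: K_def)
    show "inv k \<in> K" if "k \<in> K" for k using that act_inv[of k x0] x0 by (auto simp: K_def)
    show "k \<otimes> l \<in> K" if "k \<in> K" "l \<in> K" for k l using that x0 by (auto simp: K_def act_mult)
  qed
  interpret k: perm_rep "G\<lparr>carrier := K\<rparr>" D act by (rule subrep[OF K])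
  have kT: "k.T g f = T g f" if "g \<in> K" for g f using subrep_T[OF K that] .
  have KG: "K \<subseteq> carrier G" using K by (rule subgroup.subset)
  define F where "F = {f \<in> Fn D. \<forall>k\<in>K. T k f = 1 *c f}"
  have sF: "sub D F" unfolding F_def by (rule sub_eigenspace[OF inv_sub_Fn])
  have FD: "T k f = f" if "f \<in> F" "k \<in> K" for f k
    using that unfolding F_def mem_Collect_eq cf.scale_one by metis
  \<comment> \<open>By transitivity a nonzero function can be translated to one that is nonzero at
    \<open>x0\<close>. Averaging it over \<open>K\<close> keeps the value at \<open>x0\<close>,
    because \<open>K\<close> fixes this point.\<close>
  have WF: "\<exists>f\<in>W \<inter> F. f \<noteq> 0" if W: "inv_sub W" "W \<noteq> {0}" for W
  proof -
    have "\<not> W \<subseteq> {0}"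
    proof
      assume "W \<subseteq> {0}"
      moreover have "{0} \<subseteq> W" using sub_zero[OF inv_subD(1)[OF W(1)]] by (simp only: insert_subset empty_subsetI)
      ultimately have "W = {0}" by (rule equalityI)
      with W(2) show False by (rule notE)
    qed
    then obtain f where f: "f \<in> W" "f \<noteq> 0"
      unfolding subset_iff not_all not_imp singleton_iff by (elim exE conjE)
    have fF: "f \<in> Fn D" using f(1) inv_subD(3)[OF W(1)] by (rule subsetD[rotated])
    have "\<exists>x. f x \<noteq> 0"
    proof (rule ccontr)
      assume "\<nexists>x. f x \<noteq> 0"
      then have "f = 0" by (intro ext) simp
      with f(2) show False by (rule notE)
    qed
    then obtain x where fx: "f x \<noteq> 0" by (elim exE)
    have x: "x \<in> D" "f x \<noteq> 0" using fF fx unfolding Fn_def by (simp_all, metis)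
    obtain g where g: "g \<in> carrier G" "act g x0 = x" using trans[OF x(1)] by blast
    define f' where "f' = T (inv g) f"
    have f'W: "f' \<in> W" unfolding f'_def using inv_subD(2)[OF W(1) inv_closed[OF g(1)] f(1)] .
    have f'x0: "f' x0 = f x" using x0 g by (simp add: f'_def T_def)
    have avgW: "k.avg f' \<in> W" unfolding k.avg_def
    proof (intro sub_scale[OF inv_subD(1)[OF W(1)]] sub_sum[OF inv_subD(1)[OF W(1)]])
      fix h assume "h \<in> carrier (G\<lparr>carrier := K\<rparr>)"
      then have h: "h \<in> K" by simp
      show "k.T h f' \<in> W" unfolding kT[OF h] using inv_subD(2)[OF W(1) subsetD[OF KG h] f'W] .
    qed
    have "T h (k.avg f') = k.avg f'" if "h \<in> K" for h
      using k.T_avg[of h f'] that kT[OF that] by simp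
    then have avgF: "k.avg f' \<in> F" unfolding F_def mem_Collect_eq cf.scale_one
      by (intro conjI ballI k.avg_Fn)
    have "k.avg f' x0 = f x"
    proof -
      have "k.T h f' x0 = f x" if h: "h \<in> K" for h
      proof -
        have "act (inv h) x0 = x0" using subgroup.m_inv_closed[OF K h] by (simp add: K_def)
        then show ?thesis unfolding kT[OF h] using x0 f'x0 by (simp add: T_def)
      qed
      then have "k.avg f' x0 = 1 / of_nat (card K) * (\<Sum>h\<in>K. f x)"
        by (simp add: k.avg_def sum_fun_apply)
      then show ?thesis using k.card_G_pos by simp
    qed
    then have "k.avg f' \<noteq> 0" using x(2) by auto
    then show ?thesis by (rule bexI[OF _ IntI[OF avgW avgF]])
  qed
  \<comment> \<open>Splitting off an irreducible \<open>W\<close> costs at most \<open>d\<close>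
    dimensions of \<open>S\<close> and at least one dimension of its \<open>K\<close>-fixed
    functions, since \<open>W\<close> contains a nonzero one.\<close>
  have claim: "cf.dim S \<le> d * cf.dim (S \<inter> F)" if "inv_sub S" for S
    using that
  proof (induction "cf.dim S" arbitrary: S rule: less_induct)
    case less
    show ?case
    proof (cases "S = {0}")
      case True
      have "cf.dim S \<le> card ({} :: ('x \<Rightarrow> complex) set)" unfolding True
        by (rule cf.dim_le_card) (simp_all add: cf.span_empty)
      then show ?thesis by simp
    next
      case False
      obtain W where W: "irr W" "W \<subseteq> S" using exists_irr[OF less.prems False] .
      have iW: "inv_sub W" and W0: "W \<noteq> {0}" using W(1) by (simp_all add: irr_def)
      define S2 where "S2 = perp D W S"
      have S2: "inv_sub S2" unfolding S2_def by (rule inv_sub_perp[OF iW less.prems])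
      have S2S: "S2 \<subseteq> S" unfolding S2_def perp_def by (rule Collect_restrict)
      obtain f where f: "f \<in> W" "f \<in> F" "f \<noteq> 0" using WF[OF iW W0] by (metis IntE)
      have fS2: "f \<notin> S2" using perp_Int[OF inv_subD(1)[OF iW] f(1)] f(3) unfolding S2_def by metis
      have fS: "f \<in> S" using f(1) W(2) by (rule subsetD[rotated])
      have "S2 \<subset> S" using S2S fS fS2 by (metis psubsetI)
      then have "cf.dim S2 < cf.dim S" by (intro dim_psubset inv_subD(1) S2 less.prems)
      from less.hyps[OF this S2] have IH: "cf.dim S2 \<le> d * cf.dim (S2 \<inter> F)" .
      have "S2 \<inter> F \<subset> S \<inter> F"
      proof (rule psubsetI)
        show "S2 \<inter> F \<subseteq> S \<inter> F" using S2S by (rule Int_mono) (rule order_refl)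
        show "S2 \<inter> F \<noteq> S \<inter> F" using f(2) fS fS2 by (metis IntD1 IntI)
      qed
      then have lt: "cf.dim (S2 \<inter> F) < cf.dim (S \<inter> F)"
        by (intro dim_psubset sub_Int inv_subD(1) S2 sF less.prems)
      have "cf.dim S \<le> cf.dim W + cf.dim S2"
      proof (rule dim_le_add[OF inv_subD(1)[OF iW] inv_subD(1)[OF S2]])
        fix h assume "h \<in> S"
        from orth_decomp[OF inv_subD(1)[OF iW] inv_subD(1)[OF less.prems] W(2) this]
        show "\<exists>s\<in>W. \<exists>t\<in>S2. h = s + t" unfolding S2_def by metis
      qed
      also have "\<dots> \<le> d + d * cf.dim (S2 \<inter> F)" by (rule add_mono[OF deg[OF W(1)] IH])
      also have "\<dots> = d * Suc (cf.dim (S2 \<inter> F))" by simp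
      also have "\<dots> \<le> d * cf.dim (S \<inter> F)" using lt by (intro mult_le_mono2) simp
      finally show ?thesis .
    qed
  qed
  \<comment> \<open>Indicators of the fibres of \<open>i\<close>. By \<open>orb\<close> each fibre
    lies in a single \<open>K\<close>-orbit, so every \<open>K\<close>-fixed function is a
    combination of them.\<close>
  define ind where "ind j = (\<lambda>x. if x \<in> D \<and> i x = j then 1 else 0 :: complex)" for j
  have "F \<subseteq> cf.span (ind ` I)"
  proof
    fix f assume f: "f \<in> F"
    have fF: "f \<in> Fn D" using f unfolding F_def by simp
    have const: "f x = f y" if xy: "x \<in> D" "y \<in> D" "i x = i y" for x y
    proof -
      obtain k where k: "k \<in> carrier G" "act k x0 = x0" "act k x = y" using orb[OF xy] by blast
      then have "f y = T k f y" using FD[OF f, of k] by (simp add: K_def)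
      also have "\<dots> = f x" using k xy act_inv[of k x] by (simp add: T_def)
      finally show ?thesis ..
    qed
    \<comment> \<open>For a value \<open>j\<close> that \<open>i\<close> does not attain, the choice
      is arbitrary but harmless: \<open>ind j\<close> is then zero.\<close>
    define c where "c j = f (SOME x. x \<in> D \<and> i x = j)" for j
    have "f = (\<Sum>j\<in>I. c j *c ind j)"
    proof
      fix y
      show "f y = (\<Sum>j\<in>I. c j *c ind j) y"
      proof (cases "y \<in> D")
        case False then show ?thesis using fF by (simp add: sum_fun_apply ind_def Fn_def)
      next
        case True
        have some: "(SOME x. x \<in> D \<and> i x = i y) \<in> D \<and> i (SOME x. x \<in> D \<and> i x = i y) = i y"
          by (rule someI[of "\<lambda>x. x \<in> D \<and> i x = i y" y]) (simp add: True)
        have cy: "c (i y) = f y"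
          unfolding c_def by (rule const[OF conjunct1[OF some] True conjunct2[OF some]])
        have "(\<Sum>j\<in>I. c j *c ind j) y = (\<Sum>j\<in>I. if i y = j then c j else 0)"
          unfolding sum_fun_apply using True by (intro sum.cong refl) (simp add: ind_def)
        also have "\<dots> = c (i y)" using I True by (simp add: image_subset_iff)
        finally show ?thesis using cy by simp
      qed
    qed
    also have "\<dots> \<in> cf.span (ind ` I)"
      by (intro cf.span_sum cf.span_scale cf.span_base imageI)
    finally show "f \<in> cf.span (ind ` I)" .
  qed
  then have "cf.dim F \<le> card (ind ` I)" by (rule cf.dim_le_card) (simp add: I)
  also have "\<dots> \<le> card I" by (rule card_image_le[OF I(1)])
  finally have dF: "cf.dim F \<le> card I" .
  have "Fn D \<inter> F = F" unfolding F_def by (rule Int_absorb1[OF Collect_restrict])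
  then have "card D \<le> d * cf.dim F" using card_le_dim_Fn claim[OF inv_sub_Fn] by simp
  also have "\<dots> \<le> d * card I" using dF by (rule mult_le_mono2)
  finally show ?thesis .
qed

end

section \<open>Transvections and hyperbolic pairs\<close>

text \<open>These rules would rewrite sums and products in \<open>bit\<close> as bit operations and
  so hide them from the field laws.\<close>

declare add_bit_eq_xor [simp del] mult_bit_eq_and [simp del]

lemma bit_cases: "x = 0 \<or> x = 1" for x :: bit
  by (cases x) simp_all

lemma UNIV_bit: "(UNIV :: bit set) = {0, 1}"
  using bit_cases by auto

lemma card_bit: "card (UNIV :: bit set) = 2"
  by (simp add: UNIV_bit)

lemma zero_smult_vec: "x \<in> carrier_vec n \<Longrightarrow> 0 \<cdot>\<^sub>v x = 0\<^sub>v n" for x :: "'a::semiring_0 vec"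
  by (intro eq_vecI) auto

lemma bit_add_self [simp]: "x + x = 0" for x :: bit
  by (cases x) simp_all

lemma bit_vec_add_self [simp]: "x \<in> carrier_vec n \<Longrightarrow> x + x = 0\<^sub>v n" for x :: "bit vec"
  by (intro eq_vecI) auto

lemma bit_vec_add_cancel [simp]: "x \<in> carrier_vec n \<Longrightarrow> y \<in> carrier_vec n \<Longrightarrow> x + (x + y) = y"
  for x :: "bit vec"
  by (simp flip: assoc_add_vec)

lemma bit_vec_add_left_cancel:
  "x \<in> carrier_vec n \<Longrightarrow> y \<in> carrier_vec n \<Longrightarrow> z \<in> carrier_vec n \<Longrightarrow> x + y = x + z \<longleftrightarrow> y = z" for x :: "bit vec"
  using bit_vec_add_cancel by metis

text \<open>Linearity is available only on \<open>carrier_vec n\<close>, so \<open>x\<close> is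
  built up from the zero vector one coordinate at a time through its truncations
  \<open>y k\<close>.\<close>

lemma linear_functional_expand:
  fixes f :: "'a::field vec \<Rightarrow> 'a"
  assumes add: "\<And>x y. x \<in> carrier_vec n \<Longrightarrow> y \<in> carrier_vec n \<Longrightarrow> f (x + y) = f x + f y"
    and smult: "\<And>c x. x \<in> carrier_vec n \<Longrightarrow> f (c \<cdot>\<^sub>v x) = c * f x" and x: "x \<in> carrier_vec n"
  shows "f x = (\<Sum>j<n. x $ j * f (unit_vec n j))"
proof -
  define y where "y k = vec n (\<lambda>i. if i < k then x $ i else 0)" for k
  have y: "y k \<in> carrier_vec n" for k by (simp add: y_def)
  have step: "f (y k) = (\<Sum>j<k. x $ j * f (unit_vec n j))" if "k \<le> n" for k
    using that
  proof (induction k)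
    case 0
    have "y 0 = 0 \<cdot>\<^sub>v y 0" by (intro eq_vecI) (simp_all add: y_def)
    then have "f (y 0) = 0 * f (y 0)" using smult[OF y] by metis
    then show ?case by simp
  next
    case (Suc k)
    have "y (Suc k) = y k + (x $ k) \<cdot>\<^sub>v unit_vec n k"
      using Suc.prems by (intro eq_vecI) (auto simp: y_def less_Suc_eq)
    then have "f (y (Suc k)) = f (y k) + x $ k * f (unit_vec n k)"
      using add[OF y] smult by simp
    then show ?case using Suc by simp
  qed
  have "y n = x" using x by (intro eq_vecI) (simp_all add: y_def)
  with step[of n] show ?thesis by simp
qed

lemma mat_eq_by_action:
  fixes A B :: "'a::semiring_1 mat"
  assumes A: "A \<in> carrier_mat n n" and B: "B \<in> carrier_mat n n"
    and eq: "\<And>x. x \<in> carrier_vec n \<Longrightarrow> A *\<^sub>v x = B *\<^sub>v x"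
  shows "A = B"
proof (rule eq_matI)
  fix i j assume ij: "i < dim_row B" "j < dim_col B"
  have entry: "(M *\<^sub>v unit_vec n j) $ i = M $$ (i, j)" if "M \<in> carrier_mat n n" for M :: "'a mat"
    using that ij B by (simp add: scalar_prod_right_unit)
  show "A $$ (i, j) = B $$ (i, j)" using eq[of "unit_vec n j"] entry[OF A] entry[OF B] by simp
qed (use A B in auto)

lemma carrier_GL: "A \<in> carrier (GL TYPE('a::field) n) \<longleftrightarrow>
    A \<in> carrier_mat n n \<and> (\<exists>B\<in>carrier_mat n n. B * A = 1\<^sub>m n \<and> A * B = 1\<^sub>m n)"
  by (auto simp: GL_def units_of_def Units_def ring_mat_simps)

lemma mult_GL: "A \<otimes>\<^bsub>GL ty n\<^esub> B = A * B" and one_GL: "\<one>\<^bsub>GL ty n\<^esub> = 1\<^sub>m n"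
  by (simp_all add: GL_def units_of_def ring_mat_simps)

lemma group_GL: "group (GL TYPE('a::field) n)"
proof -
  interpret ring "ring_mat TYPE('a) n ()" by (rule ring_mat)
  show ?thesis unfolding GL_def by (rule units_group)
qed

text \<open>Over the two-element field these sums form the linear span of the list. The recursion
  adds one vector at a time, as the inductions below require.\<close>

primrec subset_sums :: "nat \<Rightarrow> bit vec list \<Rightarrow> bit vec set" where
  "subset_sums n [] = {0\<^sub>v n}"
| "subset_sums n (s # S) = subset_sums n S \<union> (\<lambda>x. s + x) ` subset_sums n S"

lemma subset_sums_carrier: "set S \<subseteq> carrier_vec n \<Longrightarrow> x \<in> subset_sums n S \<Longrightarrow> x \<in> carrier_vec n"
  by (induction S arbitrary: x) auto

lemma subset_sums_add:
  assumes "set S \<subseteq> carrier_vec n" "x \<in> subset_sums n S" "y \<in> subset_sums n S"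
  shows "x + y \<in> subset_sums n S"
  using assms
proof (induction S arbitrary: x y)
  case Nil then show ?case by simp
next
  case (Cons s S)
  have sC: "s \<in> carrier_vec n" and SC: "set S \<subseteq> carrier_vec n" using Cons.prems(1) by auto
  have C: "z \<in> carrier_vec n" if "z \<in> subset_sums n S" for z using subset_sums_carrier[OF SC that] .
  obtain x' i where x: "x' \<in> subset_sums n S" "x = x' \<or> x = s + x'" using Cons.prems(2) by auto
  obtain y' j where y: "y' \<in> subset_sums n S" "y = y' \<or> y = s + y'" using Cons.prems(3) by auto
  note xy = Cons.IH[OF SC x(1) y(1)]
  note c = sC C[OF x(1)] C[OF y(1)]
  have 1: "s + x' + y' = s + (x' + y')" by (rule assoc_add_vec[OF c])
  have "x' + (s + y') = x' + s + y'" by (rule assoc_add_vec[OF c(2,1,3), symmetric])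
  also have "x' + s = s + x'" by (rule comm_add_vec[OF c(2,1)])
  finally have 2: "x' + (s + y') = s + (x' + y')" unfolding 1 .
  have "s + x' + (s + y') = s + (x' + (s + y'))" by (rule assoc_add_vec[OF c(1,2) add_carrier_vec[OF c(1,3)]])
  then have 3: "s + x' + (s + y') = x' + y'" unfolding 2 using c by simp
  show ?case using x(2) y(2) 1 2 3 xy by auto
qed

lemma fixes_subset_sums:
  assumes "A \<in> carrier_mat n n" "set S \<subseteq> carrier_vec n" "\<And>s. s \<in> set S \<Longrightarrow> A *\<^sub>v s = s" "x \<in> subset_sums n S"
  shows "A *\<^sub>v x = x"
  using assms(2-4)
proof (induction S arbitrary: x)
  case Nil then show ?case using assms(1) by (auto intro!: eq_vecI)
next
  case (Cons s S)
  have IH: "A *\<^sub>v y = y \<and> y \<in> carrier_vec n" if "y \<in> subset_sums n S" for y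
    using that Cons.IH[of y] Cons.prems subset_sums_carrier[of S n y] by auto
  show ?case using Cons.prems IH mult_add_distrib_mat_vec[OF assms(1)] by auto
qed

section \<open>Symplectic groups over the two-element field\<close>

locale symplectic_bit =
  fixes n :: nat and \<omega> :: "bit vec \<Rightarrow> bit vec \<Rightarrow> bit"
  assumes sf: "symplectic_form n \<omega>"
begin

abbreviation "C \<equiv> carrier_vec n :: bit vec set"
abbreviation "G \<equiv> Sp n \<omega>"

lemma add_left: "x \<in> C \<Longrightarrow> y \<in> C \<Longrightarrow> z \<in> C \<Longrightarrow> \<omega> (x + y) z = \<omega> x z + \<omega> y z"
  and add_right: "x \<in> C \<Longrightarrow> y \<in> C \<Longrightarrow> z \<in> C \<Longrightarrow> \<omega> x (y + z) = \<omega> x y + \<omega> x z"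
  and smult_left: "x \<in> C \<Longrightarrow> y \<in> C \<Longrightarrow> \<omega> (c \<cdot>\<^sub>v x) y = c * \<omega> x y"
  and alt: "x \<in> C \<Longrightarrow> \<omega> x x = 0"
  and nondeg: "x \<in> C \<Longrightarrow> (\<And>y. y \<in> C \<Longrightarrow> \<omega> x y = 0) \<Longrightarrow> x = 0\<^sub>v n"
  using sf unfolding symplectic_form_def by blast+

lemma sym: "x \<in> C \<Longrightarrow> y \<in> C \<Longrightarrow> \<omega> x y = \<omega> y x"
proof -
  assume xy: "x \<in> C" "y \<in> C"
  have "\<omega> (x + y) (x + y) = 0" using xy by (intro alt) simp
  moreover have "\<omega> (x + y) (x + y) = \<omega> x (x + y) + \<omega> y (x + y)" using xy by (intro add_left) simp_all
  ultimately have "\<omega> x y + \<omega> y x = 0" using xy by (simp add: add_right alt)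
  then show ?thesis by (cases "\<omega> x y"; cases "\<omega> y x") auto
qed

lemma zero_left: "y \<in> C \<Longrightarrow> \<omega> (0\<^sub>v n) y = 0"
  using smult_left[of "0\<^sub>v n" y 0] by (simp add: zero_smult_vec[of _ n])

lemma carrier_G: "A \<in> carrier G \<longleftrightarrow> A \<in> carrier (GL TYPE(bit) n) \<and> (\<forall>x\<in>C. \<forall>y\<in>C. \<omega> (A *\<^sub>v x) (A *\<^sub>v y) = \<omega> x y)"
  by (simp add: Sp_def)

lemma G_mat: "A \<in> carrier G \<Longrightarrow> A \<in> carrier_mat n n"
  and G_form: "A \<in> carrier G \<Longrightarrow> x \<in> C \<Longrightarrow> y \<in> C \<Longrightarrow> \<omega> (A *\<^sub>v x) (A *\<^sub>v y) = \<omega> x y"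
  by (simp_all add: carrier_G carrier_GL)

lemma G_vec: "A \<in> carrier G \<Longrightarrow> x \<in> C \<Longrightarrow> A *\<^sub>v x \<in> C"
  using G_mat by (rule mult_mat_vec_carrier)

lemma mult_G: "A \<otimes>\<^bsub>G\<^esub> B = A * B" and one_G: "\<one>\<^bsub>G\<^esub> = 1\<^sub>m n"
  by (simp_all add: Sp_def mult_GL one_GL)

lemma group_G: "group G"
proof -
  interpret GL: group "GL TYPE(bit) n" by (rule group_GL)
  let ?H = "{A \<in> carrier (GL TYPE(bit) n). \<forall>x\<in>C. \<forall>y\<in>C. \<omega> (A *\<^sub>v x) (A *\<^sub>v y) = \<omega> x y}"
  have "subgroup ?H (GL TYPE(bit) n)"
  proof (rule GL.subgroupI)
    show "?H \<subseteq> carrier (GL TYPE(bit) n)" by auto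
    have "1\<^sub>m n \<in> ?H" using GL.one_closed by (simp add: one_GL)
    then show "?H \<noteq> {}" by blast
    fix A assume A: "A \<in> ?H"
    have Am: "A \<in> carrier_mat n n" using A by (simp add: carrier_GL)
    let ?B = "inv\<^bsub>GL TYPE(bit) n\<^esub> A"
    have B: "?B \<in> carrier (GL TYPE(bit) n)" "A * ?B = 1\<^sub>m n"
      using A GL.r_inv[of A] by (simp_all add: mult_GL one_GL)
    then have Bm: "?B \<in> carrier_mat n n" by (simp add: carrier_GL)
    have AB: "A *\<^sub>v (?B *\<^sub>v x) = x" if "x \<in> C" for x
      using that B(2) Am Bm by (simp flip: assoc_mult_mat_vec)
    have "\<omega> (?B *\<^sub>v x) (?B *\<^sub>v y) = \<omega> x y" if "x \<in> C" "y \<in> C" for x y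
    proof -
      have "\<omega> (A *\<^sub>v (?B *\<^sub>v x)) (A *\<^sub>v (?B *\<^sub>v y)) = \<omega> (?B *\<^sub>v x) (?B *\<^sub>v y)"
        using A that mult_mat_vec_carrier[OF Bm] by simp
      then show ?thesis using AB that by simp
    qed
    then show "?B \<in> ?H" using B(1) by simp
    fix A' assume A': "A' \<in> ?H"
    have A'm: "A' \<in> carrier_mat n n" using A' by (simp add: carrier_GL)
    have "A \<otimes>\<^bsub>GL TYPE(bit) n\<^esub> A' \<in> carrier (GL TYPE(bit) n)" using A A' by simp
    then show "A \<otimes>\<^bsub>GL TYPE(bit) n\<^esub> A' \<in> ?H"
      using A A' Am A'm mult_mat_vec_carrier[OF A'm] by (simp add: mult_GL)
  qed
  from GL.subgroup_imp_group[OF this] show ?thesis by (simp add: Sp_def)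
qed

lemma finite_G: "finite (carrier G)"
proof -
  have "finite {A :: bit mat. A \<in> carrier_mat n n}"
  proof -
    have "inj_on (\<lambda>A. restrict (\<lambda>ij. A $$ ij) ({..<n} \<times> {..<n})) {A :: bit mat. A \<in> carrier_mat n n}"
    proof (rule inj_onI)
      fix A B :: "bit mat"
      assume A: "A \<in> {A. A \<in> carrier_mat n n}" and B: "B \<in> {A. A \<in> carrier_mat n n}"
        and eq: "restrict (\<lambda>ij. A $$ ij) ({..<n} \<times> {..<n}) = restrict (\<lambda>ij. B $$ ij) ({..<n} \<times> {..<n})"
      show "A = B"
      proof (rule eq_matI)
        fix i j assume ij: "i < dim_row B" "j < dim_col B"
        from fun_cong[OF eq, of "(i, j)"] show "A $$ (i, j) = B $$ (i, j)" using ij B by auto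
      qed (use A B in auto)
    qed
    moreover have "(\<lambda>A. restrict (\<lambda>ij. A $$ ij) ({..<n} \<times> {..<n})) ` {A :: bit mat. A \<in> carrier_mat n n}
      \<subseteq> ({..<n} \<times> {..<n}) \<rightarrow>\<^sub>E UNIV"
      by (intro image_subsetI) (simp add: restrict_PiE_iff)
    moreover have "finite (({..<n} \<times> {..<n}) \<rightarrow>\<^sub>E (UNIV :: bit set))" by (intro finite_PiE) (simp_all add: UNIV_bit)
    ultimately show ?thesis using finite_imageD finite_subset by blast
  qed
  then show ?thesis by (rule finite_subset[rotated]) (auto simp: G_mat)
qed

definition transvection :: "bit vec \<Rightarrow> bit mat" where
  "transvection u = mat n n (\<lambda>(i, j). (if i = j then 1 else 0) + u $ i * \<omega> (unit_vec n j) u)"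

lemma transvection_apply:
  assumes u: "u \<in> C" and x: "x \<in> C"
  shows "transvection u *\<^sub>v x = x + \<omega> x u \<cdot>\<^sub>v u"
proof (rule eq_vecI)
  have \<omega>x: "\<omega> x u = (\<Sum>j<n. x $ j * \<omega> (unit_vec n j) u)"
    using add_left smult_left u by (intro linear_functional_expand x) simp_all
  show "(transvection u *\<^sub>v x) $ i = (x + \<omega> x u \<cdot>\<^sub>v u) $ i" if "i < dim_vec (x + \<omega> x u \<cdot>\<^sub>v u)" for i
  proof -
    have i: "i < n" using that u by simp
    have "(transvection u *\<^sub>v x) $ i = (\<Sum>j<n. ((if i = j then 1 else 0) + u $ i * \<omega> (unit_vec n j) u) * x $ j)"
      using i x by (simp add: transvection_def scalar_prod_def atLeast0LessThan)
    also have "\<dots> = (\<Sum>j<n. (if i = j then x $ j else 0)) + (\<Sum>j<n. u $ i * (x $ j * \<omega> (unit_vec n j) u))"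
      unfolding sum.distrib[symmetric] by (intro sum.cong refl) (simp add: algebra_simps)
    also have "\<dots> = x $ i + u $ i * \<omega> x u" using i by (simp add: \<omega>x sum_distrib_left)
    finally show ?thesis using i u x by (simp add: mult.commute)
  qed
qed (use u in \<open>simp add: transvection_def\<close>)

text \<open>In characteristic 2 a transvection is its own inverse, and the two cross terms produced
  in the form are equal and cancel.\<close>

lemma transvection_G:
  assumes u: "u \<in> C" shows "transvection u \<in> carrier G"
proof -
  have m: "transvection u \<in> carrier_mat n n" by (simp add: transvection_def)
  have c: "x + \<omega> x u \<cdot>\<^sub>v u \<in> C" if "x \<in> C" for x using that u by simp
  have form: "\<omega> (transvection u *\<^sub>v x) (transvection u *\<^sub>v y) = \<omega> x y" if "x \<in> C" "y \<in> C" for x y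
  proof -
    have s: "\<omega> z (a \<cdot>\<^sub>v u) = a * \<omega> z u" if "z \<in> C" for z a
      using that u sym smult_left smult_carrier_vec by metis
    have "\<omega> (transvection u *\<^sub>v x) (transvection u *\<^sub>v y) = \<omega> x y + \<omega> y u * \<omega> x u + (\<omega> x u * \<omega> u y + 0)"
      using that u by (simp add: transvection_apply add_left add_right s smult_left alt)
    also have "\<omega> u y = \<omega> y u" using that u by (intro sym)
    finally show ?thesis by (simp add: mult.commute add.assoc)
  qed
  have "transvection u * transvection u = 1\<^sub>m n"
  proof (rule mat_eq_by_action)
    fix x assume x: "x \<in> C"
    have "\<omega> (x + \<omega> x u \<cdot>\<^sub>v u) u = \<omega> x u" using x u by (simp add: add_left smult_left alt)
    then have "transvection u *\<^sub>v (transvection u *\<^sub>v x) = x + \<omega> x u \<cdot>\<^sub>v u + \<omega> x u \<cdot>\<^sub>v u"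
      using x u c by (simp add: transvection_apply)
    also have "\<dots> = x" using x u by simp
    finally show "transvection u * transvection u *\<^sub>v x = 1\<^sub>m n *\<^sub>v x" using x m by simp
  qed (use m in simp_all)
  then show ?thesis using m form by (auto simp: carrier_G carrier_GL)
qed

text \<open>Induction on \<open>S\<close>, starting from nondegeneracy. If every vector orthogonal
  to \<open>S\<close> is also orthogonal to \<open>s\<close>, then \<open>s\<close> adds no
  condition. Otherwise some \<open>z0\<close> orthogonal to \<open>S\<close> detects
  \<open>s\<close>, and adding \<open>s\<close> to \<open>t\<close> reduces to the shorter
  list.\<close>

lemma double_perp:
  assumes "set S \<subseteq> C" "t \<in> C" "\<And>z. z \<in> C \<Longrightarrow> (\<And>s. s \<in> set S \<Longrightarrow> \<omega> z s = 0) \<Longrightarrow> \<omega> z t = 0"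
  shows "t \<in> subset_sums n S"
  using assms
proof (induction S arbitrary: t)
  case Nil
  have "\<omega> t z = 0" if "z \<in> C" for z using Nil.prems that sym[of t z] by simp
  then show ?case using nondeg[OF Nil.prems(2)] by simp
next
  case (Cons s S)
  have sC: "s \<in> C" and SC: "set S \<subseteq> C" using Cons.prems(1) by auto
  show ?case
  proof (cases "\<forall>z\<in>C. (\<forall>s'\<in>set S. \<omega> z s' = 0) \<longrightarrow> \<omega> z s = 0")
    case True
    then have "t \<in> subset_sums n S"
      using Cons.prems(2,3) by (intro Cons.IH[OF SC]) auto
    then show ?thesis by simp
  next
    case False
    then obtain z0 where z0: "z0 \<in> C" "\<And>s'. s' \<in> set S \<Longrightarrow> \<omega> z0 s' = 0" "\<omega> z0 s = 1" by auto
    \<comment> \<open>Chosen so that \<open>\<omega> z0 t' = 0\<close>; in the same way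
      \<open>w\<close> below is \<open>z\<close> corrected by \<open>z0\<close> to become orthogonal
      to \<open>s\<close>.\<close>
    define t' where "t' = (if \<omega> z0 t = 1 then s + t else t)"
    have "t' \<in> subset_sums n S"
    proof (rule Cons.IH[OF SC])
      show "t' \<in> C" using sC Cons.prems(2) by (simp add: t'_def)
      fix z assume z: "z \<in> C" "\<And>s'. s' \<in> set S \<Longrightarrow> \<omega> z s' = 0"
      define w where "w = (if \<omega> z s = 1 then z + z0 else z)"
      have w: "w \<in> C" using z z0 by (simp add: w_def)
      have "\<omega> w s' = 0" if "s' \<in> set (s # S)" for s'
        using that z z0 sC SC by (auto simp: w_def add_left subsetD)
      then have "\<omega> w t = 0" by (intro Cons.prems(3) w)
      then have "(if \<omega> z s = 1 then \<omega> z t + \<omega> z0 t else \<omega> z t) = 0"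
        using z z0 Cons.prems(2) by (auto simp: w_def add_left split: if_splits)
      then show "\<omega> z t' = 0"
        using z z0 sC Cons.prems(2)
        by (cases "\<omega> z s"; cases "\<omega> z t"; cases "\<omega> z0 t") (auto simp: t'_def add_right)
    qed
    moreover have "t = s + t'" if "\<omega> z0 t = 1" using that sC Cons.prems(2) by (simp add: t'_def)
    moreover have "t = t'" if "\<omega> z0 t \<noteq> 1" using that by (simp add: t'_def)
    ultimately show ?thesis by (cases "\<omega> z0 t = 1") auto
  qed
qed

text \<open>Witt's extension theorem, one vector at a time: if \<open>\<omega> x y = 1\<close> the transvection along
  \<open>x + y\<close> maps \<open>x\<close> to \<open>y\<close>, and otherwise one passes through an intermediate vector.\<close>
lemma witt_step:
  assumes S: "set S \<subseteq> C" and x: "x \<in> C" "x \<notin> subset_sums n S" and y: "y \<in> C" "y \<notin> subset_sums n S"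
    and eq: "\<And>s. s \<in> set S \<Longrightarrow> \<omega> x s = \<omega> y s"
  obtains g where "g \<in> carrier G" "\<And>s. s \<in> set S \<Longrightarrow> g *\<^sub>v s = s" "g *\<^sub>v x = y"
proof -
  \<comment> \<open>The vector \<open>a + b\<close> is orthogonal to \<open>S\<close> and pairs to 1
    with \<open>a\<close>, so its transvection fixes \<open>S\<close> and sends \<open>a\<close> to
    \<open>a + (a + b)\<close>, which is \<open>b\<close>.\<close>
  have easy: "\<exists>g\<in>carrier G. (\<forall>s\<in>set S. g *\<^sub>v s = s) \<and> g *\<^sub>v a = b"
    if ab: "a \<in> C" "b \<in> C" "\<omega> a b = 1" "\<And>s. s \<in> set S \<Longrightarrow> \<omega> a s = \<omega> b s" for a b
  proof (intro bexI conjI ballI)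
    show "transvection (a + b) \<in> carrier G" using ab by (intro transvection_G) simp
    show "transvection (a + b) *\<^sub>v s = s" if "s \<in> set S" for s
    proof -
      have sC: "s \<in> C" using that S by blast
      have "\<omega> s (a + b) = \<omega> a s + \<omega> b s" using sC ab by (simp add: add_right sym)
      then have "\<omega> s (a + b) = 0" using ab(4)[OF that] by simp
      then show ?thesis using sC ab by (simp add: transvection_apply zero_smult_vec[of _ n])
    qed
    have "\<omega> a (a + b) = 1" using ab by (simp add: add_right alt)
    then show "transvection (a + b) *\<^sub>v a = b" using ab by (simp add: transvection_apply)
  qed
  have "\<exists>g\<in>carrier G. (\<forall>s\<in>set S. g *\<^sub>v s = s) \<and> g *\<^sub>v x = y"
  proof (cases "\<omega> x y = 1")
    case True then show ?thesis using easy x y eq by blast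
  next
    case False
    then have xy: "\<omega> x y = 0" "\<omega> y x = 0" using sym x y by auto
    define Perp where "Perp z \<longleftrightarrow> z \<in> C \<and> (\<forall>s\<in>set S. \<omega> z s = 0)" for z
    obtain z1 where z1: "Perp z1" "\<omega> z1 x = 1"
      using double_perp[OF S x(1)] x(2) unfolding Perp_def by (metis bit_cases)
    obtain z2 where z2: "Perp z2" "\<omega> z2 y = 1"
      using double_perp[OF S y(1)] y(2) unfolding Perp_def by (metis bit_cases)
    have c: "z1 \<in> C" "z2 \<in> C" using z1 z2 by (auto simp: Perp_def)
    have Perp12: "Perp (z1 + z2)" using z1 z2 S unfolding Perp_def by (auto simp: add_left subsetD)
    \<comment> \<open>\<open>z1\<close> detects \<open>x\<close> and \<open>z2\<close> detects
      \<open>y\<close>; if neither detects both, their sum does. Then \<open>x + z\<close> pairs to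
      1 with both \<open>x\<close> and \<open>y\<close> and has the same products with
      \<open>S\<close>, so the easy case applies twice.\<close>
    have "\<exists>z. Perp z \<and> \<omega> z x = 1 \<and> \<omega> z y = 1"
    proof -
      consider "\<omega> z1 y = 1" | "\<omega> z2 x = 1" | "\<omega> z1 y = 0" "\<omega> z2 x = 0" using bit_cases by blast
      then show ?thesis
      proof cases
        case 3
        then have "\<omega> (z1 + z2) x = 1 \<and> \<omega> (z1 + z2) y = 1" using c x y z1 z2 by (simp add: add_left)
        then show ?thesis using Perp12 by blast
      qed (use z1 z2 in blast)+
    qed
    then obtain z where z: "z \<in> C" "\<And>s. s \<in> set S \<Longrightarrow> \<omega> z s = 0" "\<omega> z x = 1" "\<omega> z y = 1"
      by (auto simp: Perp_def)
    let ?w = "x + z"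
    have w: "?w \<in> C" "\<omega> x ?w = 1" "\<omega> ?w y = 1" using x y z xy sym[of x z] by (simp_all add: add_left add_right alt)
    have ws: "\<omega> ?w s = \<omega> x s" if "s \<in> set S" for s using that S x z by (auto simp: add_left subsetD)
    obtain g1 where g1: "g1 \<in> carrier G" "\<forall>s\<in>set S. g1 *\<^sub>v s = s" "g1 *\<^sub>v x = ?w"
      using easy[of x ?w] x w ws by auto
    obtain g2 where g2: "g2 \<in> carrier G" "\<forall>s\<in>set S. g2 *\<^sub>v s = s" "g2 *\<^sub>v ?w = y"
      using easy[of ?w y] y w ws eq by auto
    interpret group G by (rule group_G)
    have "g2 \<otimes>\<^bsub>G\<^esub> g1 \<in> carrier G" using g1 g2 by blast
    moreover have "(g2 \<otimes>\<^bsub>G\<^esub> g1) *\<^sub>v a = g2 *\<^sub>v (g1 *\<^sub>v a)" if "a \<in> C" for a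
      using that G_mat[OF g1(1)] G_mat[OF g2(1)] by (simp add: mult_G)
    ultimately show ?thesis using g1 g2 x S by (intro bexI[of _ "g2 \<otimes>\<^bsub>G\<^esub> g1"]) (auto simp: subsetD)
  qed
  then show ?thesis using that by blast
qed

section \<open>Hyperbolic pairs and the orbits of a pair stabilizer\<close>

definition pairs :: "(bit vec \<times> bit vec) set" where
  "pairs = {(u, v). u \<in> C \<and> v \<in> C \<and> \<omega> u v = 1}"

definition act_pair :: "bit mat \<Rightarrow> bit vec \<times> bit vec \<Rightarrow> bit vec \<times> bit vec" where
  "act_pair A = (\<lambda>(u, v). (A *\<^sub>v u, A *\<^sub>v v))"

lemma card_C: "card C = 2 ^ n" and finite_C: "finite C"
proof -
  have bij: "bij_betw list_of_vec C {xs. set xs \<subseteq> UNIV \<and> length xs = n}"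
    by (rule bij_betwI[where g = vec_of_list]) (auto simp: vec_list list_vec intro: carrier_vecI)
  have "card {xs. set xs \<subseteq> (UNIV :: bit set) \<and> length xs = n} = card (UNIV :: bit set) ^ n"
    by (rule card_lists_length_eq) (simp add: UNIV_bit)
  then show "card C = 2 ^ n" using bij_betw_same_card[OF bij] by (simp only: card_bit)
  have "finite {xs. set xs \<subseteq> (UNIV :: bit set) \<and> length xs = n}"
    by (rule finite_lists_length_eq) (simp add: UNIV_bit)
  then show "finite C" using bij_betw_finite[OF bij] by blast
qed

lemma finite_pairs: "finite pairs"
  by (rule finite_subset[of _ "C \<times> C"]) (auto simp: pairs_def finite_C)

text \<open>For nonzero \<open>u\<close>, translation by some \<open>v0\<close> with
  \<open>\<omega> u v0 = 1\<close> matches the vectors pairing to 1 with those pairing to 0, so half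
  of all vectors complete \<open>u\<close>. The factor 2 avoids dividing natural numbers.\<close>

lemma card_pairs: "2 * card pairs = (2 ^ n - 1) * 2 ^ n"
proof -
  have half: "2 * card {v \<in> C. \<omega> u v = 1} = 2 ^ n" if u: "u \<in> C - {0\<^sub>v n}" for u
  proof -
    have "\<exists>v0\<in>C. \<omega> u v0 \<noteq> 0" by (rule ccontr) (use nondeg[of u] u in auto)
    then obtain v0 where v0: "v0 \<in> C" "\<omega> u v0 = 1" by auto
    have "bij_betw (\<lambda>v. v0 + v) {v \<in> C. \<omega> u v = 1} {v \<in> C. \<omega> u v = 0}"
      using v0 u by (intro bij_betwI[where g = "\<lambda>v. v0 + v"]) (auto simp: add_right)
    from bij_betw_same_card[OF this]
    have "card {v \<in> C. \<omega> u v = 1} = card {v \<in> C. \<omega> u v = 0}" .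
    moreover have "C = {v \<in> C. \<omega> u v = 1} \<union> {v \<in> C. \<omega> u v = 0}" by auto
    then have "card C = card ({v \<in> C. \<omega> u v = 1} \<union> {v \<in> C. \<omega> u v = 0})" by (rule arg_cong)
    moreover have "card ({v \<in> C. \<omega> u v = 1} \<union> {v \<in> C. \<omega> u v = 0}) =
      card {v \<in> C. \<omega> u v = 1} + card {v \<in> C. \<omega> u v = 0}"
      by (rule card_Un_disjoint) (use finite_C in auto)
    ultimately show ?thesis by (simp add: card_C)
  qed
  have "pairs = Sigma (C - {0\<^sub>v n}) (\<lambda>u. {v \<in> C. \<omega> u v = 1})"
    by (auto simp: pairs_def zero_left)
  then have "card pairs = (\<Sum>u\<in>C - {0\<^sub>v n}. card {v \<in> C. \<omega> u v = 1})"
    using finite_C by (simp add: card_SigmaI)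
  then have "2 * card pairs = (\<Sum>u\<in>C - {0\<^sub>v n}. 2 * card {v \<in> C. \<omega> u v = 1})"
    by (simp add: sum_distrib_left)
  also have "\<dots> = (2 ^ n - 1) * 2 ^ n" using half finite_C by (simp add: card_C card_Diff_singleton)
  finally show ?thesis .
qed

lemma G_inj: "g \<in> carrier G \<Longrightarrow> x \<in> C \<Longrightarrow> y \<in> C \<Longrightarrow> g *\<^sub>v x = g *\<^sub>v y \<Longrightarrow> x = y"
proof -
  assume g: "g \<in> carrier G" and xy: "x \<in> C" "y \<in> C" "g *\<^sub>v x = g *\<^sub>v y"
  obtain B where B: "B \<in> carrier_mat n n" "B * g = 1\<^sub>m n" using g by (auto simp: carrier_G carrier_GL)
  have "B *\<^sub>v (g *\<^sub>v z) = z" if "z \<in> C" for z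
    using that B G_mat[OF g] by (simp flip: assoc_mult_mat_vec)
  then show "x = y" using xy by metis
qed

lemma mult_apply: "g \<in> carrier G \<Longrightarrow> h \<in> carrier G \<Longrightarrow> x \<in> C \<Longrightarrow> (g \<otimes>\<^bsub>G\<^esub> h) *\<^sub>v x = g *\<^sub>v (h *\<^sub>v x)"
  unfolding mult_G by (rule assoc_mult_mat_vec[OF G_mat G_mat])

text \<open>Two Witt steps: one takes \<open>a\<close> to \<open>u\<close> with nothing held fixed,
  the other takes the image of \<open>b\<close> to \<open>v\<close> with \<open>u\<close> held
  fixed. The latter applies because 0 and \<open>u\<close> do not pair to 1 with
  \<open>u\<close>.\<close>

lemma pairs_transitive:
  assumes ab: "(a, b) \<in> pairs" and uv: "(u, v) \<in> pairs"
  shows "\<exists>g\<in>carrier G. act_pair g (a, b) = (u, v)"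
proof -
  have c: "a \<in> C" "b \<in> C" "u \<in> C" "v \<in> C" "\<omega> a b = 1" "\<omega> u v = 1"
    using ab uv by (auto simp: pairs_def)
  have "a \<noteq> 0\<^sub>v n" "u \<noteq> 0\<^sub>v n" using c zero_left by auto
  then obtain g where g: "g \<in> carrier G" "g *\<^sub>v a = u"
    using witt_step[of "[]" a u] c by auto
  have gb: "g *\<^sub>v b \<in> C" "\<omega> u (g *\<^sub>v b) = 1"
    using g c G_vec[OF g(1)] G_form[OF g(1), of a b] by simp_all
  have "w \<notin> subset_sums n [u]" if "w \<in> C" "\<omega> u w = 1" for w
    using that c alt[of u] sym[of u "0\<^sub>v n"] zero_left[of u] by auto
  then obtain h where h: "h \<in> carrier G" "h *\<^sub>v u = u" "h *\<^sub>v (g *\<^sub>v b) = v"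
    using witt_step[of "[u]" "g *\<^sub>v b" v] gb c sym by (metis empty_iff empty_set insert_iff list.simps(15) empty_subsetI insert_subset)
  interpret group G by (rule group_G)
  show ?thesis
    using g h c by (intro bexI[of _ "h \<otimes>\<^bsub>G\<^esub> g"]) (simp_all add: act_pair_def mult_apply)
qed

text \<open>The data needed for Witt's theorem: the products with \<open>a\<close> and
  \<open>b\<close>, and the linear dependencies of \<open>u\<close> and \<open>v\<close> modulo the
  plane. The latter are recorded by membership of the three nonzero combinations of \<open>u\<close>
  and \<open>v\<close>.\<close>

definition pair_invariant :: "bit vec \<times> bit vec \<Rightarrow> bit vec \<times> bit vec \<Rightarrow> (bit \<times> bit \<times> bit \<times> bit) \<times> (bool \<times> bool \<times> bool)" where
  "pair_invariant = (\<lambda>(a, b) (u, v). ((\<omega> u a, \<omega> u b, \<omega> v a, \<omega> v b),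
     (u \<in> subset_sums n [a, b], v \<in> subset_sums n [a, b], u + v \<in> subset_sums n [a, b])))"

text \<open>Unless \<open>u\<close> and \<open>v\<close> are independent modulo the plane of \<open>a\<close> and \<open>b\<close>, the condition \<open>\<omega> u v = 1\<close>
  determines the determinant of their components in that plane; this leaves \<open>16 + 6 * 4\<close> values.\<close>
definition pair_invariants :: "((bit \<times> bit \<times> bit \<times> bit) \<times> (bool \<times> bool \<times> bool)) set" where
  "pair_invariants = UNIV \<times> {(False, False, False)} \<union>
     {(\<alpha>, \<beta>, \<gamma>, \<delta>). \<alpha> * \<delta> + \<beta> * \<gamma> = 1} \<times>
     {(True, True, True), (True, False, False), (False, True, False), (False, False, True)}"

lemma finite_pair_invariants: "finite pair_invariants"
proof -
  have "finite (UNIV :: (bit \<times> bit \<times> bit \<times> bit) set)"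
    unfolding UNIV_Times_UNIV[symmetric] by (intro finite_cartesian_product) (simp_all add: UNIV_bit)
  then show ?thesis unfolding pair_invariants_def by (auto intro: finite_subset)
qed

lemma card_pair_invariants: "card pair_invariants \<le> 40"
proof -
  have U: "card (UNIV :: (bit \<times> bit \<times> bit \<times> bit) set) = 16"
    unfolding UNIV_Times_UNIV[symmetric] card_cartesian_product card_bit by simp
  have "{(\<alpha>, \<beta>, \<gamma>, \<delta>). \<alpha> * \<delta> + \<beta> * \<gamma> = 1} \<subseteq>
    {(1::bit,0::bit,0::bit,1::bit), (1,1,0,1), (1,0,1,1), (0,1,1,0), (1,1,1,0), (0,1,1,1)}"
  proof
    fix t :: "bit \<times> bit \<times> bit \<times> bit"
    assume t: "t \<in> {(\<alpha>, \<beta>, \<gamma>, \<delta>). \<alpha> * \<delta> + \<beta> * \<gamma> = 1}"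
    obtain \<alpha> \<beta> \<gamma> \<delta> where "t = (\<alpha>, \<beta>, \<gamma>, \<delta>)" by (cases t)
    with t show "t \<in> {(1,0,0,1), (1,1,0,1), (1,0,1,1), (0,1,1,0), (1,1,1,0), (0,1,1,1)}"
      by (cases \<alpha>; cases \<beta>; cases \<gamma>; cases \<delta>) simp_all
  qed
  from card_mono[OF _ this]
  have six: "card {(\<alpha>, \<beta>, \<gamma>, \<delta>). \<alpha> * \<delta> + \<beta> * \<gamma> = (1::bit)} \<le> 6" by simp
  have "card pair_invariants \<le> card ((UNIV :: (bit \<times> bit \<times> bit \<times> bit) set) \<times> {(False, False, False)}) +
    card ({(\<alpha>, \<beta>, \<gamma>, \<delta>). \<alpha> * \<delta> + \<beta> * \<gamma> = (1::bit)} \<times>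
      {(True, True, True), (True, False, False), (False, True, False), (False, False, True)})"
    unfolding pair_invariants_def by (rule card_Un_le)
  also have "\<dots> \<le> 16 + 6 * 4" using U six by (simp add: card_cartesian_product)
  finally show ?thesis by simp
qed

text \<open>The vector \<open>x\<close> is \<open>\<omega> x b\<close> times \<open>a\<close> plus
  \<open>\<omega> x a\<close> times \<open>b\<close>; this is checked on the four elements of the
  plane.\<close>

lemma plane_component:
  assumes ab: "(a, b) \<in> pairs" and x: "x \<in> subset_sums n [a, b]" and y: "y \<in> C"
  shows "\<omega> x y = \<omega> x b * \<omega> y a + \<omega> x a * \<omega> y b"
proof -
  have c: "a \<in> C" "b \<in> C" "\<omega> a b = 1" "\<omega> b a = 1" using ab sym[of a b] by (auto simp: pairs_def)
  have "x = 0\<^sub>v n \<or> x = b \<or> x = a \<or> x = a + b" using x c by auto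
  then show ?thesis
    using c y zero_left sym[of y a] sym[of y b] by (auto simp: add_left alt)
qed

lemma plane_eqI:
  assumes ab: "(a, b) \<in> pairs" and x: "x \<in> subset_sums n [a, b]" and y: "y \<in> subset_sums n [a, b]"
    and eq: "\<omega> x a = \<omega> y a" "\<omega> x b = \<omega> y b"
  shows "x = y"
proof -
  have S: "set [a, b] \<subseteq> C" using ab by (auto simp: pairs_def)
  have c: "a \<in> C" "b \<in> C" "x \<in> C" "y \<in> C"
    using S subset_sums_carrier[OF S x] subset_sums_carrier[OF S y] by auto
  have "\<omega> (x + y) z = 0" if "z \<in> C" for z
    using plane_component[OF ab x that] plane_component[OF ab y that] eq c that by (simp add: add_left)
  then have "x + y = 0\<^sub>v n" using c by (intro nondeg) simp_all
  then have "x + (x + y) = x + 0\<^sub>v n" by simp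
  then show ?thesis using c by simp
qed

lemma pair_invariant_in:
  assumes ab: "(a, b) \<in> pairs" and uv: "(u, v) \<in> pairs"
  shows "pair_invariant (a, b) (u, v) \<in> pair_invariants"
proof -
  define P where "P = subset_sums n [a, b]"
  have c: "a \<in> C" "b \<in> C" "u \<in> C" "v \<in> C" "\<omega> a b = 1" "\<omega> u v = 1"
    using ab uv by (auto simp: pairs_def)
  have add: "x + y \<in> P" if "x \<in> P" "y \<in> P" for x y
    using subset_sums_add[of "[a, b]" n x y] c that by (simp add: P_def)
  have uvv: "u + (u + v) = v" using c by simp
  have vuv: "v + (u + v) = u" unfolding comm_add_vec[OF c(3,4)] using c by simp
  show ?thesis
  proof (cases "u \<notin> P \<and> v \<notin> P \<and> u + v \<notin> P")
    case True then show ?thesis by (simp add: pair_invariant_def pair_invariants_def P_def)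
  next
    case False
    \<comment> \<open>Some nonzero combination of \<open>u\<close> and \<open>v\<close> lies in the
      plane. Its product with \<open>u\<close> or \<open>v\<close> is 1, and
      \<open>plane_component\<close> turns that product into the determinant.\<close>
    have det: "\<omega> u a * \<omega> v b + \<omega> u b * \<omega> v a = 1"
    proof -
      consider "u \<in> P" | "v \<in> P" | "u + v \<in> P" using False by blast
      then show ?thesis
      proof cases
        case 1
        from plane_component[OF ab 1[unfolded P_def] c(4)] show ?thesis using c by (simp add: add.commute)
      next
        case 2
        from plane_component[OF ab 2[unfolded P_def] c(3)] show ?thesis using c sym[of u v]
          by (simp add: mult.commute)
      next
        case 3
        from plane_component[OF ab 3[unfolded P_def] c(3)]
        have "\<omega> v u = (\<omega> u b + \<omega> v b) * \<omega> u a + (\<omega> u a + \<omega> v a) * \<omega> u b"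
          using c by (simp add: add_left alt)
        then have "1 = (\<omega> u b + \<omega> v b) * \<omega> u a + (\<omega> u a + \<omega> v a) * \<omega> u b" using c sym[of u v] by simp
        then show ?thesis
          by (cases "\<omega> u a"; cases "\<omega> u b"; cases "\<omega> v a"; cases "\<omega> v b") simp_all
      qed
    qed
    \<comment> \<open>Two of the three combinations in the plane force the third, so exactly one of
      them or all three lie there.\<close>
    have "(u \<in> P, v \<in> P, u + v \<in> P) \<in>
      {(True, True, True), (True, False, False), (False, True, False), (False, False, True)}"
      using False add[of u v] add[of u "u + v"] add[of v "u + v"] unfolding uvv vuv by auto
    then show ?thesis using det by (auto simp: pair_invariant_def pair_invariants_def P_def)
  qed
qed

text \<open>Vectors in the plane are fixed by the stabilizer and equal their targets by
  \<open>plane_eqI\<close>. Otherwise \<open>u\<close> is moved to \<open>u'\<close> first, and then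
  the image of \<open>v\<close> to \<open>v'\<close> with \<open>u'\<close>, \<open>a\<close> and
  \<open>b\<close> held fixed; if \<open>u + v\<close> lies in the plane, the image of
  \<open>v\<close> is already forced.\<close>

lemma pair_orbits:
  assumes ab: "(a, b) \<in> pairs" and uv: "(u, v) \<in> pairs" and uv': "(u', v') \<in> pairs"
    and eq: "pair_invariant (a, b) (u, v) = pair_invariant (a, b) (u', v')"
  shows "\<exists>k\<in>carrier G. act_pair k (a, b) = (a, b) \<and> act_pair k (u, v) = (u', v')"
proof -
  define P where "P = subset_sums n [a, b]"
  have S: "set [a, b] \<subseteq> C" using ab by (auto simp: pairs_def)
  have c: "a \<in> C" "b \<in> C" "u \<in> C" "v \<in> C" "\<omega> u v = 1" "u' \<in> C" "v' \<in> C" "\<omega> u' v' = 1"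
    using ab uv uv' by (auto simp: pairs_def)
  have form: "\<omega> u a = \<omega> u' a" "\<omega> u b = \<omega> u' b" "\<omega> v a = \<omega> v' a" "\<omega> v b = \<omega> v' b"
    and mem: "u \<in> P \<longleftrightarrow> u' \<in> P" "v \<in> P \<longleftrightarrow> v' \<in> P" "u + v \<in> P \<longleftrightarrow> u' + v' \<in> P"
    using eq unfolding pair_invariant_def case_prod_conv P_def[symmetric] prod.inject by (simp_all only:)
  have PC: "x \<in> C" if "x \<in> P" for x using subset_sums_carrier[OF S that[unfolded P_def]] .
  have fixP: "k *\<^sub>v x = x" if "k \<in> carrier G" "k *\<^sub>v a = a" "k *\<^sub>v b = b" "x \<in> P" for k x
  proof (rule fixes_subset_sums[OF G_mat[OF that(1)] S _ that(4)[unfolded P_def]])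
    show "k *\<^sub>v s = s" if "s \<in> set [a, b]" for s
      using that \<open>k *\<^sub>v a = a\<close> \<open>k *\<^sub>v b = b\<close> by auto
  qed
  have move: "\<exists>k\<in>carrier G. k *\<^sub>v a = a \<and> k *\<^sub>v b = b \<and> k *\<^sub>v x = y"
    if xy: "x \<in> C" "y \<in> C" "x \<notin> P" "y \<notin> P" "\<omega> x a = \<omega> y a" "\<omega> x b = \<omega> y b" for x y
  proof -
    have "\<omega> x s = \<omega> y s" if "s \<in> set [a, b]" for s using that xy by auto
    from witt_step[OF S xy(1) xy(3)[unfolded P_def] xy(2) xy(4)[unfolded P_def] this]
    obtain k where "k \<in> carrier G" "\<And>s. s \<in> set [a, b] \<Longrightarrow> k *\<^sub>v s = s" "k *\<^sub>v x = y" by metis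
    then show ?thesis by auto
  qed
  have "\<exists>k\<in>carrier G. k *\<^sub>v a = a \<and> k *\<^sub>v b = b \<and> k *\<^sub>v u = u' \<and> k *\<^sub>v v = v'"
  proof (cases "u \<in> P")
    case uP: True
    have uu': "u = u'" using plane_eqI[OF ab] uP mem form unfolding P_def by blast
    show ?thesis
    proof (cases "v \<in> P")
      case True
      have vv': "v = v'" using plane_eqI[OF ab] True mem form unfolding P_def by blast
      interpret group G by (rule group_G)
      show ?thesis using uu' vv' c one_closed by (intro bexI[of _ "\<one>\<^bsub>G\<^esub>"]) (simp_all add: one_G)
    next
      case False
      have "v' \<notin> P" using False mem by simp
      from move[OF c(4) c(7) False this form(3,4)] obtain k where
        k: "k \<in> carrier G" "k *\<^sub>v a = a" "k *\<^sub>v b = b" "k *\<^sub>v v = v'" by blast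
      show ?thesis using k fixP[OF k(1-3) uP] uu' by (intro bexI[of _ k]) simp_all
    qed
  next
    case uP: False
    show ?thesis
    proof (cases "v \<in> P")
      case True
      have vv': "v = v'" using plane_eqI[OF ab] True mem form unfolding P_def by blast
      have "u' \<notin> P" using uP mem by simp
      from move[OF c(3) c(6) uP this form(1,2)] obtain k where
        k: "k \<in> carrier G" "k *\<^sub>v a = a" "k *\<^sub>v b = b" "k *\<^sub>v u = u'" by blast
      show ?thesis using k fixP[OF k(1-3) True] vv' by (intro bexI[of _ k]) simp_all
    next
      case vP: False
      have "u' \<notin> P" using uP mem by simp
      from move[OF c(3) c(6) uP this form(1,2)] obtain k where
        k: "k \<in> carrier G" "k *\<^sub>v a = a" "k *\<^sub>v b = b" "k *\<^sub>v u = u'" by blast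
      show ?thesis
      proof (cases "u + v \<in> P")
        case True
        have "u + v = u' + v'"
          using plane_eqI[OF ab, of "u + v" "u' + v'"] True mem form c unfolding P_def by (simp add: add_left)
        moreover have "k *\<^sub>v (u + v) = u' + k *\<^sub>v v"
          using mult_add_distrib_mat_vec[OF G_mat[OF k(1)] c(3,4)] k by simp
        moreover have "k *\<^sub>v (u + v) = u + v" using fixP k True by blast
        ultimately have "u' + k *\<^sub>v v = u' + v'" by simp
        then have "k *\<^sub>v v = v'" using bit_vec_add_left_cancel[OF c(6) G_vec[OF k(1) c(4)] c(7)] by simp
        then show ?thesis using k by blast
      next
        case False
        define v1 where "v1 = k *\<^sub>v v"
        have v1C: "v1 \<in> C" using G_vec[OF k(1) c(4)] by (simp add: v1_def)
        have f1: "\<omega> v1 a = \<omega> v' a" "\<omega> v1 b = \<omega> v' b" "\<omega> v1 u' = \<omega> v' u'"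
          using G_form[OF k(1) c(4) c(1)] G_form[OF k(1) c(4) c(2)] G_form[OF k(1) c(4) c(3)] k form c sym[of u v] sym[of u' v']
          by (simp_all add: v1_def)
        have Q: "subset_sums n [u', a, b] = P \<union> (\<lambda>x. u' + x) ` P" by (simp add: P_def)
        \<comment> \<open>Pulled back through \<open>k\<close>, which fixes \<open>P\<close>
          pointwise, such a dependency would put \<open>v\<close> or \<open>u + v\<close> into
          \<open>P\<close>.\<close>
        have "v1 \<notin> subset_sums n [u', a, b]"
        proof
          assume "v1 \<in> subset_sums n [u', a, b]"
          then consider "v1 \<in> P" | x where "x \<in> P" "v1 = u' + x" unfolding Q by blast
          then show False
          proof cases
            case 1
            then have "k *\<^sub>v v1 = k *\<^sub>v v" using fixP k by (simp add: v1_def)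
            then have "v1 = v" using G_inj[OF k(1) v1C c(4)] by simp
            then show False using 1 vP by simp
          next
            case 2
            have "k *\<^sub>v (u + x) = k *\<^sub>v v"
              using mult_add_distrib_mat_vec[OF G_mat[OF k(1)] c(3) PC[OF 2(1)]] k fixP[OF k(1-3) 2(1)] 2 by (simp add: v1_def)
            then have "u + x = v" using G_inj[OF k(1) _ c(4)] c PC[OF 2(1)] by simp
            then have "u + v = x" using c PC[OF 2(1)] by auto
            then show False using 2 False by simp
          qed
        qed
        moreover have "v' \<notin> subset_sums n [u', a, b]"
        proof
          assume "v' \<in> subset_sums n [u', a, b]"
          then consider "v' \<in> P" | x where "x \<in> P" "v' = u' + x" unfolding Q by blast
          then show False
          proof cases
            case 1 then show False using vP mem by simp
          next
            case 2
            then have "u' + v' = x" using c PC[OF 2(1)] by simp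
            then show False using 2 False mem by simp
          qed
        qed
        moreover have "set [u', a, b] \<subseteq> C" using c by simp
        ultimately obtain h where h: "h \<in> carrier G" "\<And>s. s \<in> set [u', a, b] \<Longrightarrow> h *\<^sub>v s = s" "h *\<^sub>v v1 = v'"
          using witt_step[of "[u', a, b]" v1 v'] v1C c(7) f1 by auto
        interpret group G by (rule group_G)
        have "h \<otimes>\<^bsub>G\<^esub> k \<in> carrier G" using h k by blast
        then show ?thesis using h k c by (intro bexI[of _ "h \<otimes>\<^bsub>G\<^esub> k"]) (simp_all add: mult_apply v1_def)
      qed
    qed
  qed
  then obtain k where k: "k \<in> carrier G" "k *\<^sub>v a = a" "k *\<^sub>v b = b" "k *\<^sub>v u = u'" "k *\<^sub>v v = v'"
    by (elim bexE conjE)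
  have "act_pair k (a, b) = (a, b) \<and> act_pair k (u, v) = (u', v')"
    unfolding act_pair_def case_prod_conv k(2-5) by (intro conjI refl)
  then show ?thesis using k(1) by (rule bexI)
qed

end

section \<open>The Bruhat decomposition\<close>

definition mat2 :: "'a \<Rightarrow> 'a \<Rightarrow> 'a \<Rightarrow> 'a \<Rightarrow> 'a mat" where
  "mat2 a b c d = mat 2 2 (\<lambda>(i, j). if i = 0 then (if j = 0 then a else b) else (if j = 0 then c else d))"

lemma mat2_carrier [simp]: "mat2 a b c d \<in> carrier_mat 2 2"
  by (simp add: mat2_def)

lemma mat2_index [simp]:
  "mat2 a b c d $$ (0, 0) = a" "mat2 a b c d $$ (0, Suc 0) = b"
  "mat2 a b c d $$ (Suc 0, 0) = c" "mat2 a b c d $$ (Suc 0, Suc 0) = d"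
  by (simp_all add: mat2_def)

lemma mat2_eqI:
  assumes "A \<in> carrier_mat 2 2" "B \<in> carrier_mat 2 2"
    and "A $$ (0, 0) = B $$ (0, 0)" "A $$ (0, Suc 0) = B $$ (0, Suc 0)"
    and "A $$ (Suc 0, 0) = B $$ (Suc 0, 0)" "A $$ (Suc 0, Suc 0) = B $$ (Suc 0, Suc 0)"
  shows "A = B"
proof (rule eq_matI)
  fix i j assume "i < dim_row B" "j < dim_col B"
  then have "i = 0 \<or> i = Suc 0" "j = 0 \<or> j = Suc 0" using assms(2) by auto
  then show "A $$ (i, j) = B $$ (i, j)" using assms(3-6) by (elim disjE) simp_all
qed (use assms(1,2) in auto)

lemma mat2_eta: "A \<in> carrier_mat 2 2 \<Longrightarrow> A = mat2 (A $$ (0, 0)) (A $$ (0, Suc 0)) (A $$ (Suc 0, 0)) (A $$ (Suc 0, Suc 0))"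
  by (rule mat2_eqI) simp_all

lemma mat2_mult: "mat2 a b c d * mat2 a' b' c' d' =
    mat2 (a * a' + b * c') (a * b' + b * d') (c * a' + d * c') (c * b' + d * d')"
  for a :: "'a::semiring_0"
  by (rule mat2_eqI[OF mult_carrier_mat[OF mat2_carrier mat2_carrier] mat2_carrier])
    (simp_all add: mat2_def scalar_prod_def numeral_2_eq_2)

lemma mat2_one: "1\<^sub>m 2 = mat2 1 0 0 1"
  by (rule mat2_eqI) simp_all

lemma map_mat2: "map_mat f (mat2 a b c d) = mat2 (f a) (f b) (f c) (f d)"
  by (rule mat2_eqI) (simp_all add: mat2_def)

lemma elements_mat2: "elements_mat (mat2 a b c d) = {a, b, c, d}"
proof
  show "elements_mat (mat2 a b c d) \<subseteq> {a, b, c, d}"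
  proof
    fix x assume "x \<in> elements_mat (mat2 a b c d)"
    from elements_matD[OF this] obtain i j where
      "i < dim_row (mat2 a b c d)" "j < dim_col (mat2 a b c d)" and ij: "x = mat2 a b c d $$ (i, j)"
      by (elim exE conjE)
    then have "i < 2" "j < 2" by (simp_all add: mat2_def)
    then have "i = 0 \<or> i = Suc 0" "j = 0 \<or> j = Suc 0" by auto
    then show "x \<in> {a, b, c, d}" unfolding ij by (elim disjE) simp_all
  qed
  have I: "mat2 a b c d $$ (i, j) \<in> elements_mat (mat2 a b c d)" if "i < 2" "j < 2" for i j
    by (rule elements_matI[OF mat2_carrier that refl])
  show "{a, b, c, d} \<subseteq> elements_mat (mat2 a b c d)"
    using I[of 0 0] I[of 0 "Suc 0"] I[of "Suc 0" 0] I[of "Suc 0" "Suc 0"] by simp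
qed

lemma det_mat2: "det (mat2 a b c d) = a * d - b * c" for a :: "'a::comm_ring_1"
proof -
  have del: "mat_delete (mat2 a b c d) 0 0 = mat 1 1 (\<lambda>_. d)" "mat_delete (mat2 a b c d) (Suc 0) 0 = mat 1 1 (\<lambda>_. b)"
    by (auto simp: mat_delete_def mat2_def intro!: eq_matI)
  have "det (mat2 a b c d) = (\<Sum>i<2. mat2 a b c d $$ (i, 0) * cofactor (mat2 a b c d) i 0)"
    by (rule laplace_expansion_column) simp_all
  also have "\<dots> = a * d - b * c"
    by (simp add: numeral_2_eq_2 cofactor_def del det_single mult.commute)
  finally show ?thesis .
qed

section \<open>Arithmetic in characteristic two and field automorphisms\<close>

lemma two_eq_0: "(2 :: bit alg_closure) = 0"
proof -
  have "(2 :: bit alg_closure) = to_ac (2 :: bit)" by (simp only: to_ac_numeral)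
  also have "(2 :: bit) = 0" by simp
  finally show ?thesis by simp
qed

lemma ac_add_self: "x + x = 0" for x :: "bit alg_closure"
  using two_eq_0 by (metis mult_2 mult_zero_left)

lemma ac_uminus: "- x = x" for x :: "bit alg_closure"
  using ac_add_self by (rule minus_unique)

lemma ac_minus: "x - y = x + y" for x y :: "bit alg_closure"
  using ac_uminus[of y] by simp

lemma frobenius_add: "(x + y) ^ (2 ^ k) = x ^ (2 ^ k) + y ^ (2 ^ k)" for x y :: "bit alg_closure"
proof (induction k)
  case (Suc k)
  have sq: "(a + b)\<^sup>2 = a\<^sup>2 + b\<^sup>2" for a b :: "bit alg_closure"
    using two_eq_0 by (simp add: power2_sum)
  have "(x + y) ^ (2 ^ Suc k) = ((x + y) ^ (2 ^ k))\<^sup>2" by (simp add: power_mult mult.commute flip: power_mult)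
  also have "\<dots> = (x ^ (2 ^ k))\<^sup>2 + (y ^ (2 ^ k))\<^sup>2" by (simp only: Suc.IH sq)
  also have "\<dots> = x ^ (2 ^ Suc k) + y ^ (2 ^ Suc k)" by (simp add: mult.commute flip: power_mult)
  finally show ?case .
qed simp

lemma GF2_closed:
  shows "0 \<in> GF2 m" "1 \<in> GF2 m" "x \<in> GF2 m \<Longrightarrow> y \<in> GF2 m \<Longrightarrow> x + y \<in> GF2 m"
    "x \<in> GF2 m \<Longrightarrow> y \<in> GF2 m \<Longrightarrow> x * y \<in> GF2 m" "x \<in> GF2 m \<Longrightarrow> y \<in> GF2 m \<Longrightarrow> x / y \<in> GF2 m"
    "x \<in> GF2 m \<Longrightarrow> x ^ k \<in> GF2 m"
proof -
  show "x \<in> GF2 m \<Longrightarrow> x ^ k \<in> GF2 m"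
  proof -
    assume "x \<in> GF2 m"
    then have "(x ^ (2 ^ m)) ^ k = x ^ k" by (simp add: GF2_def)
    then show "x ^ k \<in> GF2 m" by (simp add: GF2_def mult.commute flip: power_mult)
  qed
qed (simp_all add: GF2_def frobenius_add power_mult_distrib power_divide)

text \<open>On \<open>GF2 m\<close> the \<open>m\<close>-th power of Frobenius is the identity, so
  its \<open>(m - i)\<close>-th power inverts its \<open>i\<close>-th.\<close>

lemma frobenius_surj:
  assumes "y \<in> GF2 m" "i \<le> m" obtains z where "z \<in> GF2 m" "z ^ (2 ^ i) = y"
proof
  show "y ^ (2 ^ (m - i)) \<in> GF2 m" using assms(1) by (rule GF2_closed)
  have "(y ^ (2 ^ (m - i))) ^ (2 ^ i) = y ^ (2 ^ m)"
    using assms(2) by (simp flip: power_mult power_add)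
  then show "(y ^ (2 ^ (m - i))) ^ (2 ^ i) = y" using assms(1) by (simp add: GF2_def)
qed

lemma carrier_SL2:
  "mat2 a b c d \<in> carrier (SL2 m) \<longleftrightarrow> {a, b, c, d} \<subseteq> GF2 m \<and> a * d + b * c = 1"
proof -
  have "mat2 a b c d \<in> carrier (GL TYPE(bit alg_closure) 2)" if "a * d - b * c = 1"
  proof -
    have "mat2 d (- b) (- c) a * mat2 a b c d = 1\<^sub>m 2" "mat2 a b c d * mat2 d (- b) (- c) a = 1\<^sub>m 2"
      using that by (simp_all add: mat2_mult mat2_one algebra_simps)
    then show ?thesis unfolding carrier_GL by (intro conjI bexI[of _ "mat2 d (- b) (- c) a"]) simp_all
  qed
  then show ?thesis
    by (auto simp: SL2_def elements_mat2 det_mat2 ac_minus)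
qed

lemma carrier_SL2_mat: "A \<in> carrier (SL2 m) \<Longrightarrow> A \<in> carrier_mat 2 2"
  by (simp add: SL2_def carrier_GL)

lemma carrier_SL2_ext: "m > 0 \<Longrightarrow> carrier (SL2_ext m) = carrier (SL2 m) \<times> {0..<int m}"
  by (simp add: SL2_ext_def semidirect_product_def carrier_integer_mod_group)

lemma mult_SL2_ext: "(A, i) \<otimes>\<^bsub>SL2_ext m\<^esub> (B, j) = (A * map_mat (\<lambda>x. x ^ (2 ^ nat i)) B, (i + j) mod int m)"
  by (simp add: SL2_ext_def semidirect_product_def SL2_def mult_GL)

definition unipotents :: "nat \<Rightarrow> (bit alg_closure mat \<times> int) set" where
  "unipotents m = (\<lambda>x. (mat2 1 x 0 1, 0)) ` GF2 m"

text \<open>The monomial matrices of determinant 1, that is, the torus and its Weyl coset, each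
  combined with every field automorphism. The antidiagonal matrices have determinant -1, which is 1
  here.\<close>

definition bruhat_reps :: "nat \<Rightarrow> (bit alg_closure mat \<times> int) set" where
  "bruhat_reps m = (\<lambda>(p, i). (mat2 p 0 0 (1 / p), i)) ` ((GF2 m - {0}) \<times> {0..<int m}) \<union>
     (\<lambda>(p, i). (mat2 0 (1 / p) p 0, i)) ` ((GF2 m - {0}) \<times> {0..<int m})"

lemma finite_GF2: "m > 0 \<Longrightarrow> finite (GF2 m)"
  using card_GF2[of m] by (intro card_ge_0_finite) simp

lemma unipotents_carrier: "m > 0 \<Longrightarrow> unipotents m \<subseteq> carrier (SL2_ext m)"
  by (auto simp: unipotents_def carrier_SL2_ext carrier_SL2 GF2_closed)

lemma card_unipotents: "m > 0 \<Longrightarrow> card (unipotents m) \<le> 2 ^ m"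
  unfolding unipotents_def using card_image_le[OF finite_GF2[of m]] by (simp add: card_GF2)

lemma unipotents_mult:
  assumes "m > 0"
  shows "(mat2 1 x 0 1, 0) \<otimes>\<^bsub>SL2_ext m\<^esub> (mat2 1 y 0 1, 0) = (mat2 1 (x + y) 0 1, 0)"
  using assms by (simp add: mult_SL2_ext map_mat2 mat2_mult add.commute)

lemma bruhat_reps_carrier: "m > 0 \<Longrightarrow> bruhat_reps m \<subseteq> carrier (SL2_ext m)"
  by (auto simp: bruhat_reps_def carrier_SL2_ext carrier_SL2 GF2_closed)

lemma finite_bruhat_reps: "m > 0 \<Longrightarrow> finite (bruhat_reps m)"
  by (simp add: bruhat_reps_def finite_GF2)

lemma card_bruhat_reps: "m > 0 \<Longrightarrow> card (bruhat_reps m) \<le> 2 * (2 ^ m * m)"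
proof -
  assume m: "m > 0"
  let ?I = "(GF2 m - {0}) \<times> {0..<int m}"
  have fin: "finite ?I" using finite_GF2[OF m] by simp
  have "card (GF2 m - {0}) \<le> 2 ^ m" using card_Diff1_le[of "GF2 m" 0] card_GF2[OF m] by simp
  then have I: "card ?I \<le> 2 ^ m * m" by (simp add: card_cartesian_product)
  have "card (bruhat_reps m) \<le> card ((\<lambda>(p, i). (mat2 p 0 0 (1 / p), i)) ` ?I) + card ((\<lambda>(p, i). (mat2 0 (1 / p) p 0, i)) ` ?I)"
    unfolding bruhat_reps_def by (rule card_Un_le)
  also have "\<dots> \<le> card ?I + card ?I" by (intro add_mono card_image_le fin)
  finally show ?thesis using I by simp
qed

text \<open>For \<open>c \<noteq> 0\<close> the factors have entries \<open>a / c\<close> on the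
  left, \<open>1 / c\<close> and \<open>c\<close> in the middle and \<open>d / c\<close> on the
  right. For \<open>c = 0\<close> the matrix is diagonal times unitriangular with entry
  \<open>b / a\<close>.\<close>

lemma bruhat:
  assumes m: "m > 0" and g: "g \<in> carrier (SL2_ext m)"
  shows "\<exists>a\<in>unipotents m. \<exists>r\<in>bruhat_reps m. \<exists>a'\<in>unipotents m.
    g = a \<otimes>\<^bsub>SL2_ext m\<^esub> (r \<otimes>\<^bsub>SL2_ext m\<^esub> a')"
proof -
  obtain A i where gA: "g = (A, i)" "A \<in> carrier (SL2 m)" and i: "0 \<le> i" "i < int m"
    using g by (auto simp: carrier_SL2_ext[OF m])
  obtain a b c d where A: "A = mat2 a b c d" using mat2_eta[OF carrier_SL2_mat[OF gA(2)]] by blast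
  have K: "a \<in> GF2 m" "b \<in> GF2 m" "c \<in> GF2 m" "d \<in> GF2 m" and det: "a * d + b * c = 1"
    using gA(2) by (simp_all add: A carrier_SL2)
  \<comment> \<open>The field automorphism of the middle factor twists the right unipotent. This is
    why \<open>z\<close> is chosen below as a Frobenius preimage of the entry wanted.\<close>
  have prod: "(mat2 1 x 0 1, 0) \<otimes>\<^bsub>SL2_ext m\<^esub> ((mat2 p r s t, i) \<otimes>\<^bsub>SL2_ext m\<^esub> (mat2 1 z 0 1, 0)) =
      (mat2 1 x 0 1 * (mat2 p r s t * mat2 1 (z ^ (2 ^ nat i)) 0 1), i)" for x p r s t z
    using i by (simp add: mult_SL2_ext map_mat2 mat2_mult zero_power)
  have nat_i: "nat i \<le> m" using i by simp
  show ?thesis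
  proof (cases "c = 0")
    case True
    have ad: "a * d = 1" using det True by simp
    then have "a \<noteq> 0" by auto
    with ad nonzero_mult_div_cancel_left[of a d] have a0: "a \<noteq> 0" "d = 1 / a" by simp_all
    have "b / a \<in> GF2 m" using K by (simp add: GF2_closed)
    from frobenius_surj[OF this nat_i]
    obtain z where z: "z \<in> GF2 m" "z ^ (2 ^ nat i) = b / a" .
    have "g = (mat2 1 0 0 1, 0) \<otimes>\<^bsub>SL2_ext m\<^esub> ((mat2 a 0 0 (1 / a), i) \<otimes>\<^bsub>SL2_ext m\<^esub> (mat2 1 z 0 1, 0))"
      unfolding prod z(2) gA A True a0(2) using a0(1)
      by (simp only: mat2_mult mult_1_left mult_1_right mult_zero_left mult_zero_right add_0_left add_0_right) simp
    moreover have "(mat2 1 0 0 1, 0) \<in> unipotents m" "(mat2 1 z 0 1, 0) \<in> unipotents m"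
      using z GF2_closed(1) by (auto simp: unipotents_def)
    moreover have "(mat2 a 0 0 (1 / a), i) \<in> bruhat_reps m"
      using a0 K i by (auto simp: bruhat_reps_def)
    ultimately show ?thesis by blast
  next
    case False
    have "d / c \<in> GF2 m" "a / c \<in> GF2 m" using K by (simp_all add: GF2_closed)
    from frobenius_surj[OF this(1) nat_i]
    obtain z where z: "z \<in> GF2 m" "z ^ (2 ^ nat i) = d / c" .
    \<comment> \<open>Only three entries are free: with \<open>c\<close> invertible, the determinant
      condition determines \<open>b\<close>, which makes the upper right entry of the product come
      out right.\<close>
    have "b * c = 1 + a * d"
    proof -
      have "1 + a * d = (a * d + b * c) + a * d" using det by simp
      also have "\<dots> = b * c" using ac_add_self[of "a * d"] by (simp add: algebra_simps)
      finally show ?thesis ..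
    qed
    then have "b = (1 + a * d) / c" using nonzero_mult_div_cancel_right[OF False, of b] by simp
    then have b: "1 / c + a / c * d = b" by (simp add: add_divide_distrib)
    have e: "a / c * c = a" "c * (d / c) = d" using False by simp_all
    have "g = (mat2 1 (a / c) 0 1, 0) \<otimes>\<^bsub>SL2_ext m\<^esub> ((mat2 0 (1 / c) c 0, i) \<otimes>\<^bsub>SL2_ext m\<^esub> (mat2 1 z 0 1, 0))"
      unfolding prod z(2) gA A
      by (simp only: mat2_mult mult_1_left mult_1_right mult_zero_left mult_zero_right add_0_left add_0_right e b)
    moreover have "(mat2 1 (a / c) 0 1, 0) \<in> unipotents m" "(mat2 1 z 0 1, 0) \<in> unipotents m"
      using z \<open>a / c \<in> GF2 m\<close> by (auto simp: unipotents_def)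
    moreover have "(mat2 0 (1 / c) c 0, i) \<in> bruhat_reps m"
      using False K i by (auto simp: bruhat_reps_def)
    ultimately show ?thesis by blast
  qed
qed

text \<open>\<open>L\<close> comes without group axioms, so its identity is recognised as an
  idempotent: its preimage is an idempotent of the group \<open>G\<close>, hence the
  identity.\<close>

lemma iso_one:
  assumes "group G" "\<phi> \<in> iso G L" "e \<in> carrier L" "e \<otimes>\<^bsub>L\<^esub> e = e"
  shows "\<phi> \<one>\<^bsub>G\<^esub> = e"
proof -
  interpret group G by fact
  have hom: "\<phi> (x \<otimes>\<^bsub>G\<^esub> y) = \<phi> x \<otimes>\<^bsub>L\<^esub> \<phi> y" if "x \<in> carrier G" "y \<in> carrier G" for x y
    using assms(2) that by (simp add: iso_def hom_def)
  have bij: "bij_betw \<phi> (carrier G) (carrier L)" using assms(2) by (simp add: iso_def)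
  have "e \<in> \<phi> ` carrier G" using assms(3) bij_betw_imp_surj_on[OF bij] by simp
  then obtain g where g: "g \<in> carrier G" "\<phi> g = e" by blast
  have "\<phi> (g \<otimes>\<^bsub>G\<^esub> g) = \<phi> g" using g assms(4) by (simp add: hom)
  then have "g \<otimes>\<^bsub>G\<^esub> g = g" using bij g by (simp add: bij_betw_def inj_on_def)
  then have "g = \<one>\<^bsub>G\<^esub>" using g(1) by (simp add: r_cancel_one)
  then show ?thesis using g by simp
qed

text \<open>Taking preimages along the bijection \<open>\<phi>\<close> does not increase
  cardinalities, and its injectivity turns equations in \<open>SL2_ext m\<close> into equations in
  \<open>G\<close>.\<close>

lemma bruhat_transfer:
  assumes G: "group G" and \<phi>: "\<phi> \<in> iso G (SL2_ext m)" and m: "m > 0"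
  obtains A R where "subgroup A G" "\<And>a. a \<in> A \<Longrightarrow> a \<otimes>\<^bsub>G\<^esub> a = \<one>\<^bsub>G\<^esub>" "card A \<le> 2 ^ m"
    "finite R" "R \<subseteq> carrier G" "card R \<le> 2 * (2 ^ m * m)"
    "\<And>g. g \<in> carrier G \<Longrightarrow> \<exists>a\<in>A. \<exists>r\<in>R. \<exists>a'\<in>A. g = a \<otimes>\<^bsub>G\<^esub> (r \<otimes>\<^bsub>G\<^esub> a')"
proof -
  interpret group G by fact
  let ?L = "SL2_ext m"
  have hom: "\<phi> (x \<otimes>\<^bsub>G\<^esub> y) = \<phi> x \<otimes>\<^bsub>?L\<^esub> \<phi> y" if "x \<in> carrier G" "y \<in> carrier G" for x y
    using \<phi> that by (simp add: iso_def hom_def)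
  have bij: "bij_betw \<phi> (carrier G) (carrier ?L)" using \<phi> by (simp add: iso_def)
  have inj: "x = y" if "x \<in> carrier G" "y \<in> carrier G" "\<phi> x = \<phi> y" for x y
    using bij that by (simp add: bij_betw_def inj_on_def)
  define pre where "pre S = {g \<in> carrier G. \<phi> g \<in> S}" for S
  have inj_pre: "inj_on \<phi> (pre S)" for S using inj by (auto simp: pre_def inj_on_def)
  have im_pre: "\<phi> ` pre S \<subseteq> S" for S by (auto simp: pre_def)
  have lift: "\<exists>g\<in>pre S. \<phi> g = s" if "s \<in> S" "S \<subseteq> carrier ?L" for s S
  proof -
    have "s \<in> \<phi> ` carrier G" using bij that by (auto simp: bij_betw_def)
    then show ?thesis using that by (auto simp: pre_def)
  qed
  have fin: "finite (pre S)" "card (pre S) \<le> card S" if "finite S" for S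
    using finite_imageD[OF finite_subset[OF im_pre that] inj_pre] card_inj_on_le[OF inj_pre im_pre that] by auto
  have one_U: "(mat2 1 0 0 1, 0) \<in> unipotents m" using GF2_closed(1) by (auto simp: unipotents_def)
  then have one_L: "(mat2 1 0 0 1, 0) \<in> carrier ?L" using unipotents_carrier[OF m] by blast
  have one: "\<phi> \<one>\<^bsub>G\<^esub> = (mat2 1 0 0 1, 0)"
    by (rule iso_one[OF G \<phi> one_L]) (simp add: unipotents_mult[OF m])
  have U_mult: "x \<otimes>\<^bsub>?L\<^esub> y \<in> unipotents m" if "x \<in> unipotents m" "y \<in> unipotents m" for x y
    using that by (auto simp: unipotents_def unipotents_mult[OF m] GF2_closed(3))
  have U_sq: "x \<otimes>\<^bsub>?L\<^esub> x = (mat2 1 0 0 1, 0)" if "x \<in> unipotents m" for x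
    using that by (auto simp: unipotents_def unipotents_mult[OF m] ac_add_self)
  define A where "A = pre (unipotents m)"
  define R where "R = pre (bruhat_reps m)"
  have AG: "A \<subseteq> carrier G" by (auto simp: A_def pre_def)
  have sq: "a \<otimes>\<^bsub>G\<^esub> a = \<one>\<^bsub>G\<^esub>" if "a \<in> A" for a
  proof (rule inj)
    have a: "a \<in> carrier G" "\<phi> a \<in> unipotents m" using that by (auto simp: A_def pre_def)
    show "a \<otimes>\<^bsub>G\<^esub> a \<in> carrier G" using a by simp
    show "\<phi> (a \<otimes>\<^bsub>G\<^esub> a) = \<phi> \<one>\<^bsub>G\<^esub>" using a by (simp add: hom one U_sq)
  qed simp
  show ?thesis
  proof (rule that[of A R])
    show "subgroup A G"
    proof (rule subgroupI)
      show "A \<subseteq> carrier G" by (rule AG)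
      have "\<one>\<^bsub>G\<^esub> \<in> A" using one one_U by (simp add: A_def pre_def)
      then show "A \<noteq> {}" by blast
      show "inv\<^bsub>G\<^esub> a \<in> A" if "a \<in> A" for a
        using inv_equality[OF sq[OF that]] that AG by auto
      show "a \<otimes>\<^bsub>G\<^esub> b \<in> A" if "a \<in> A" "b \<in> A" for a b
        using that by (auto simp: A_def pre_def hom U_mult)
    qed
    have "finite (unipotents m)" by (simp add: unipotents_def finite_GF2[OF m])
    from fin(2)[OF this] card_unipotents[OF m] show "card A \<le> 2 ^ m" by (simp add: A_def)
    show "finite R" unfolding R_def by (rule fin(1)[OF finite_bruhat_reps[OF m]])
    show "R \<subseteq> carrier G" by (auto simp: R_def pre_def)
    from fin(2)[OF finite_bruhat_reps[OF m]] card_bruhat_reps[OF m]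
    show "card R \<le> 2 * (2 ^ m * m)" by (simp add: R_def)
    fix g assume g: "g \<in> carrier G"
    then have "\<phi> g \<in> carrier ?L" using bij by (auto simp: bij_betw_def)
    from bruhat[OF m this] obtain a r a' where ara: "a \<in> unipotents m" "r \<in> bruhat_reps m"
      "a' \<in> unipotents m" "\<phi> g = a \<otimes>\<^bsub>?L\<^esub> (r \<otimes>\<^bsub>?L\<^esub> a')" by blast
    obtain x where x: "x \<in> A" "\<phi> x = a" using lift[OF ara(1) unipotents_carrier[OF m]] by (auto simp: A_def)
    obtain y where y: "y \<in> R" "\<phi> y = r" using lift[OF ara(2) bruhat_reps_carrier[OF m]] by (auto simp: R_def)
    obtain x' where x': "x' \<in> A" "\<phi> x' = a'" using lift[OF ara(3) unipotents_carrier[OF m]] by (auto simp: A_def)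
    have c: "x \<in> carrier G" "y \<in> carrier G" "x' \<in> carrier G" using x y x' by (auto simp: A_def R_def pre_def)
    have "g = x \<otimes>\<^bsub>G\<^esub> (y \<otimes>\<^bsub>G\<^esub> x')"
      using g c ara(4) x(2) y(2) x'(2) by (intro inj) (simp_all add: hom)
    then show "\<exists>a\<in>A. \<exists>r\<in>R. \<exists>a'\<in>A. g = a \<otimes>\<^bsub>G\<^esub> (r \<otimes>\<^bsub>G\<^esub> a')" using x(1) y(1) x'(1) by blast
  qed (rule sq)
qed

text \<open>160 is 2 * 2 * 40: one 2 from the doubled count of pairs, one from the two families of
  Bruhat representatives, and 40 from the orbit bound. The base case is 801 < 1024. The added 1
  absorbs the subtraction in \<open>2 ^ n - 1\<close>.\<close>

lemma four_power_gt: "5 \<le> m \<Longrightarrow> 160 * m + 1 < 4 ^ m" for m :: nat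
  by (induction m rule: dec_induct) simp_all

theorem mainTheorem4:
  fixes m n :: nat and \<omega> :: "bit vec \<Rightarrow> bit vec \<Rightarrow> bit" and Dye :: "bit mat set"
  assumes "prime m" and "n = 2 * m" and "n > 6"
    and "symplectic_form n \<omega>"
    and "Dye_subgroup m \<omega> Dye"
  shows "\<not> strong_Gelfand_pair (Sp n \<omega>) Dye"
proof
  assume sg: "strong_Gelfand_pair (Sp n \<omega>) Dye"
  have m0: "m > 0" and m5: "m \<ge> 5"
  proof -
    \<comment> \<open>\<open>n > 6\<close> gives \<open>m \<ge> 4\<close>. Primality removes 4,
      where the final comparison would fail: 641 exceeds 256.\<close>
    have "m \<noteq> 4" using assms(1) prime_nat_iff[of 4] by auto
    then show "m \<ge> 5" "m > 0" using assms(2,3) by auto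
  qed
  interpret symplectic_bit n \<omega> using assms(4) by unfold_locales
  interpret G: group G by (rule group_G)
  have H: "subgroup Dye G" and iso: "G\<lparr>carrier := Dye\<rparr> \<cong> SL2_ext m"
    using assms(2,5) by (auto simp: Dye_subgroup_def maximal_subgroup_def)
  have gH: "group (G\<lparr>carrier := Dye\<rparr>)" by (rule G.subgroup_imp_group[OF H])
  obtain \<phi> where \<phi>: "\<phi> \<in> iso (G\<lparr>carrier := Dye\<rparr>) (SL2_ext m)" using iso by (auto simp: is_iso_def)
  obtain A R where AR: "subgroup A (G\<lparr>carrier := Dye\<rparr>)" "\<And>a. a \<in> A \<Longrightarrow> a \<otimes>\<^bsub>G\<^esub> a = \<one>\<^bsub>G\<^esub>" "card A \<le> 2 ^ m"
    "finite R" "R \<subseteq> Dye" "card R \<le> 2 * (2 ^ m * m)"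
    "\<And>g. g \<in> Dye \<Longrightarrow> \<exists>a\<in>A. \<exists>r\<in>R. \<exists>a'\<in>A. g = a \<otimes>\<^bsub>G\<^esub> (r \<otimes>\<^bsub>G\<^esub> a')"
  proof (rule bruhat_transfer[OF gH \<phi> m0])
    let ?H = "G\<lparr>carrier := Dye\<rparr>"
    fix A R
    assume "subgroup A ?H" "\<And>a. a \<in> A \<Longrightarrow> a \<otimes>\<^bsub>?H\<^esub> a = \<one>\<^bsub>?H\<^esub>" "card A \<le> 2 ^ m"
      "finite R" "R \<subseteq> carrier ?H" "card R \<le> 2 * (2 ^ m * m)"
      "\<And>g. g \<in> carrier ?H \<Longrightarrow> \<exists>a\<in>A. \<exists>r\<in>R. \<exists>a'\<in>A. g = a \<otimes>\<^bsub>?H\<^esub> (r \<otimes>\<^bsub>?H\<^esub> a')"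
    then show thesis by (intro that[of A R]) simp_all
  qed
  have AD: "A \<subseteq> Dye" using subgroup.subset[OF AR(1)] by simp
  have AG: "subgroup A G" using G.incl_subgroup[OF H AR(1)] .
  interpret perm_rep G pairs act_pair
  proof unfold_locales
    show "finite pairs" by (rule finite_pairs)
    show "finite (carrier G)" by (rule finite_G)
    show "act_pair g x \<in> pairs" if "g \<in> carrier G" "x \<in> pairs" for g x
      using that by (auto simp: pairs_def act_pair_def G_vec G_form)
    show "act_pair \<one>\<^bsub>G\<^esub> x = x" if "x \<in> pairs" for x
      using that by (auto simp: pairs_def act_pair_def one_G)
    show "act_pair (g \<otimes>\<^bsub>G\<^esub> h) x = act_pair g (act_pair h x)"
      if "g \<in> carrier G" "h \<in> carrier G" "x \<in> pairs" for g h x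
      using that by (auto simp: pairs_def act_pair_def mult_apply)
  qed
  have deg: "cf.dim V \<le> 2 ^ m * (2 * (2 ^ m * m))" if V: "irr V" for V
  proof -
    have "cf.dim V \<le> card A * card R"
      by (rule dim_irr_le[OF V H sg AG AD AR(2,4,5,7)])
    also have "\<dots> \<le> 2 ^ m * (2 * (2 ^ m * m))" by (rule mult_le_mono[OF AR(3,6)])
    finally show ?thesis .
  qed
  have n1: "(2::nat) ^ n > 1" using assms(3) by (intro one_less_power) auto
  have "card pairs > 0" using card_pairs n1 by (intro Nat.gr0I) simp
  then obtain a b where ab: "(a, b) \<in> pairs" by (metis card_gt_0_iff ex_in_conv surj_pair)
  have "card pairs \<le> 2 ^ m * (2 * (2 ^ m * m)) * card pair_invariants"
  proof (rule card_le_max_degree_mult_rank[OF ab _ finite_pair_invariants, of "pair_invariant (a, b)"])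
    show "\<exists>g\<in>carrier G. act_pair g (a, b) = x" if "x \<in> pairs" for x
      using pairs_transitive[OF ab] that by (cases x) blast
    show "pair_invariant (a, b) ` pairs \<subseteq> pair_invariants"
      using pair_invariant_in[OF ab] by auto
    show "\<exists>k\<in>carrier G. act_pair k (a, b) = (a, b) \<and> act_pair k x = y"
      if "x \<in> pairs" "y \<in> pairs" "pair_invariant (a, b) x = pair_invariant (a, b) y" for x y
      using pair_orbits[OF ab] that by (cases x; cases y) blast
  qed (rule deg)
  also have "\<dots> \<le> 2 ^ m * (2 * (2 ^ m * m)) * 40"
    using card_pair_invariants by (rule mult_le_mono2)
  also have "\<dots> = 80 * m * 2 ^ n"
    using assms(2) by (simp add: mult_2 power_add)
  finally have "(2 ^ n - 1) * 2 ^ n \<le> (160 * m) * 2 ^ n"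
    using card_pairs by linarith
  then have "2 ^ n - 1 \<le> 160 * m" by simp
  moreover have "(2::nat) ^ n = 4 ^ m" unfolding assms(2) by (simp add: power_mult)
  ultimately show False using four_power_gt[OF m5] by simp
qed

end
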